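(* Let $r\ge 2$ be an integer. For $m$ ranging over the positive integers such that $p=2m+1$ is a prime, asymptotically almost surely a random tree with $m$ edges decomposes $K_{2m+1}(r)$; that is, the probability that a random tree $T$ with $m$ edges decomposes $K_{2m+1}(r)$ tends to $1$ as $m\to\infty$ through the integers $m$ such that $2m+1$ is prime.
   Context: A graph $H$ decomposes a graph $G$ if $G$ is the edge-disjoint union of isomorphic copies of $H$ (i.e. the edge set of $G$ can be partitioned into edge sets of subgraphs of $G$ each isomorphic to $H$). A random tree with $m$ edges is an unlabelled tree (isomorphism class of trees) chosen uniformly at random among all unlabelled trees with $m$ edges. For positive integers $n,r$, $K_n(r)$ denotes the blow-up graph obtained from the complete graph $K_n$ by replacing each vertex by a coclique (independent set) of order $r$ and joining every pair of vertices which do not belong to the same coclique. *)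

theory Defs
  imports "HOL-Probability.Probability_Mass_Function" "HOL-Library.Disjoint_Sets"
    "HOL-Computational_Algebra.Primes"
begin

type_synonym 'a ugraph = "'a set \<times> 'a set set"

abbreviation verts :: "'a ugraph \<Rightarrow> 'a set" where
  "verts \<equiv> fst"

abbreviation edges :: "'a ugraph \<Rightarrow> 'a set set" where
  "edges \<equiv> snd"

definition simple_graph :: "'a ugraph \<Rightarrow> bool" where
  "simple_graph G \<longleftrightarrow> (\<forall>e\<in>edges G. e \<subseteq> verts G \<and> card e = 2)"

definition subgraph :: "'a ugraph \<Rightarrow> 'a ugraph \<Rightarrow> bool" where
  "subgraph H G \<longleftrightarrow> simple_graph H \<and> verts H \<subseteq> verts G \<and> edges H \<subseteq> edges G"

definition graph_iso :: "'a ugraph \<Rightarrow> 'b ugraph \<Rightarrow> bool" where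
  "graph_iso G H \<longleftrightarrow> (\<exists>f. bij_betw f (verts G) (verts H) \<and>
     (\<forall>u\<in>verts G. \<forall>v\<in>verts G. {u, v} \<in> edges G \<longleftrightarrow> {f u, f v} \<in> edges H))"

abbreviation adj :: "'a ugraph \<Rightarrow> 'a \<Rightarrow> 'a \<Rightarrow> bool" where
  "adj G u v \<equiv> {u, v} \<in> edges G"

definition connected_graph :: "'a ugraph \<Rightarrow> bool" where
  "connected_graph G \<longleftrightarrow> verts G \<noteq> {} \<and> (\<forall>u\<in>verts G. \<forall>v\<in>verts G. (adj G)\<^sup>*\<^sup>* u v)"

text \<open>A cycle is the list of its vertices in cyclic order, without repeating the first vertex.\<close>

definition is_cycle :: "'a ugraph \<Rightarrow> 'a list \<Rightarrow> bool" where
  "is_cycle G c \<longleftrightarrow> 3 \<le> length c \<and> distinct c \<and> successively (adj G) c \<and> adj G (last c) (hd c)"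

definition is_tree :: "'a ugraph \<Rightarrow> bool" where
  "is_tree G \<longleftrightarrow> simple_graph G \<and> finite (verts G) \<and> connected_graph G \<and> (\<nexists>c. is_cycle G c)"

definition decomposes :: "'a ugraph \<Rightarrow> 'b ugraph \<Rightarrow> bool" where
  "decomposes H G \<longleftrightarrow> (\<exists>P. partition_on (edges G) P \<and>
     (\<forall>E\<in>P. \<exists>S. subgraph S G \<and> edges S = E \<and> graph_iso H S))"

definition blowup_complete :: "nat \<Rightarrow> nat \<Rightarrow> (nat \<times> nat) ugraph" where
  "blowup_complete n r = ({..<n} \<times> {..<r},
     {{x, y} | x y. x \<in> {..<n} \<times> {..<r} \<and> y \<in> {..<n} \<times> {..<r} \<and> fst x \<noteq> fst y})"

text \<open>Every finite tree is isomorphic to one with vertices in \<^typ>\<open>nat\<close>, so an unlabelled tree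
  is taken to be an isomorphism class of trees on finite sets of natural numbers.\<close>

definition trees :: "nat \<Rightarrow> nat ugraph set" where
  "trees m = {T. is_tree T \<and> card (edges T) = m}"

definition unlabelled_trees :: "nat \<Rightarrow> nat ugraph set set" where
  "unlabelled_trees m = trees m // {(S, T). S \<in> trees m \<and> T \<in> trees m \<and> graph_iso S T}"

definition random_tree :: "nat \<Rightarrow> nat ugraph set pmf" where
  "random_tree m = pmf_of_set (unlabelled_trees m)"

text \<open>\<^const>\<open>pmf_of_set\<close> is only meaningful on finite nonempty sets; the facts
  \<open>finite_unlabelled_trees\<close> and \<open>unlabelled_trees_nonempty\<close> below guarantee this.\<close>

lemma graph_iso_refl: "graph_iso G G"
  unfolding graph_iso_def by (rule exI[of _ "\<lambda>x. x"]) (auto simp: bij_betw_def)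

lemma graph_iso_sym:
  assumes "graph_iso G H" shows "graph_iso H G"
proof -
  obtain f where f: "bij_betw f (verts G) (verts H)"
    "\<And>u v. u \<in> verts G \<Longrightarrow> v \<in> verts G \<Longrightarrow> {u, v} \<in> edges G \<longleftrightarrow> {f u, f v} \<in> edges H"
    using assms unfolding graph_iso_def by blast
  let ?g = "inv_into (verts G) f"
  have g: "bij_betw ?g (verts H) (verts G)" by (rule bij_betw_inv_into[OF f(1)])
  have fg: "\<And>x. x \<in> verts H \<Longrightarrow> f (?g x) = x" by (rule bij_betw_inv_into_right[OF f(1)])
  have gv: "\<And>x. x \<in> verts H \<Longrightarrow> ?g x \<in> verts G" using g bij_betwE by blast
  have "{x, y} \<in> edges H \<longleftrightarrow> {?g x, ?g y} \<in> edges G" if "x \<in> verts H" "y \<in> verts H" for x y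
    using f(2)[OF gv[OF that(1)] gv[OF that(2)]] fg that by simp
  then show ?thesis unfolding graph_iso_def using g by blast
qed

lemma graph_iso_trans:
  assumes "graph_iso G H" "graph_iso H K" shows "graph_iso G K"
proof -
  obtain f where f: "bij_betw f (verts G) (verts H)"
    "\<And>u v. u \<in> verts G \<Longrightarrow> v \<in> verts G \<Longrightarrow> {u, v} \<in> edges G \<longleftrightarrow> {f u, f v} \<in> edges H"
    using assms(1) unfolding graph_iso_def by blast
  obtain g where g: "bij_betw g (verts H) (verts K)"
    "\<And>u v. u \<in> verts H \<Longrightarrow> v \<in> verts H \<Longrightarrow> {u, v} \<in> edges H \<longleftrightarrow> {g u, g v} \<in> edges K"
    using assms(2) unfolding graph_iso_def by blast
  have "\<And>x. x \<in> verts G \<Longrightarrow> f x \<in> verts H" using f(1) bij_betwE by blast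
  then have "\<forall>u\<in>verts G. \<forall>v\<in>verts G. {u, v} \<in> edges G \<longleftrightarrow> {(g \<circ> f) u, (g \<circ> f) v} \<in> edges K"
    using f(2) g(2) by simp
  then show ?thesis unfolding graph_iso_def using bij_betw_trans[OF f(1) g(1)] by blast
qed

lemma equiv_trees:
  "equiv (trees m) {(S, T). S \<in> trees m \<and> T \<in> trees m \<and> graph_iso S T}"
  by (intro equivI refl_onI symI transI)
     (auto intro: graph_iso_refl graph_iso_sym graph_iso_trans)

lemma tree_card_verts_le:
  assumes "T \<in> trees m" shows "card (verts T) \<le> 2 * m + 1"
proof -
  have sg: "simple_graph T" and con: "connected_graph T" and fin: "finite (verts T)"
    and m: "card (edges T) = m"
    using assms by (auto simp: trees_def is_tree_def)
  obtain u where u: "u \<in> verts T" using con by (auto simp: connected_graph_def)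
  have finE: "finite (edges T)"
    using sg fin by (intro finite_subset[of "edges T" "Pow (verts T)"]) (auto simp: simple_graph_def)
  have sub: "verts T \<subseteq> insert u (\<Union>(edges T))"
  proof
    fix v assume v: "v \<in> verts T"
    have "(adj T)\<^sup>*\<^sup>* u v" using con u v by (auto simp: connected_graph_def)
    then show "v \<in> insert u (\<Union>(edges T))" by (cases rule: rtranclp.cases) auto
  qed
  have c2: "finite e \<and> card e = 2" if "e \<in> edges T" for e
    using sg that by (auto simp: simple_graph_def intro: card_ge_0_finite)
  have fU: "finite (\<Union>(edges T))" using finE c2 by blast
  have "card (verts T) \<le> card (insert u (\<Union>(edges T)))" using sub fU by (intro card_mono) auto
  also have "\<dots> \<le> Suc (card (\<Union>(edges T)))" by (rule card_insert_le_m1) auto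
  also have "card (\<Union>(edges T)) \<le> (\<Sum>e\<in>edges T. card e)"
    by (rule card_Union_le_sum_card)
  also have "(\<Sum>e\<in>edges T. card e) = 2 * m" using c2 m by simp
  finally show ?thesis by simp
qed

lemma finite_unlabelled_trees: "finite (unlabelled_trees m)"
proof -
  let ?A = "Pow {..2 * m} \<times> Pow (Pow {..2 * m}) :: nat ugraph set"
  let ?cls = "\<lambda>G :: nat ugraph. {T \<in> trees m. graph_iso G T}"
  have "unlabelled_trees m \<subseteq> ?cls ` ?A"
  proof
    fix C assume "C \<in> unlabelled_trees m"
    then obtain T where T: "T \<in> trees m" and C: "C = {S \<in> trees m. graph_iso T S}"
      by (auto simp: unlabelled_trees_def quotient_def)
    have fin: "finite (verts T)" using T by (auto simp: trees_def is_tree_def)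
    have sg: "simple_graph T" using T by (auto simp: trees_def is_tree_def)
    obtain h where h: "bij_betw h (verts T) {0..<card (verts T)}"
      using ex_bij_betw_finite_nat[OF fin] by blast
    let ?G = "({0..<card (verts T)}, (`) h ` edges T) :: nat ugraph"
    have inj: "inj_on h (verts T)" using h by (simp add: bij_betw_def)
    have eq: "{u, v} \<in> edges T \<longleftrightarrow> {h u, h v} \<in> (`) h ` edges T"
      if "u \<in> verts T" "v \<in> verts T" for u v
    proof
      assume "{u, v} \<in> edges T"
      then show "{h u, h v} \<in> (`) h ` edges T" by (intro image_eqI[of _ _ "{u, v}"]) auto
    next
      assume "{h u, h v} \<in> (`) h ` edges T"
      then obtain e where e: "e \<in> edges T" "h ` e = h ` {u, v}" by auto
      have "e = {u, v}"
        using e sg that inj_on_image_eq_iff[OF inj, of e "{u, v}"] by (auto simp: simple_graph_def)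
      then show "{u, v} \<in> edges T" using e by simp
    qed
    have iso: "graph_iso T ?G" unfolding graph_iso_def using h eq by auto
    have "h ` e \<subseteq> {..2 * m}" if "e \<in> edges T" for e
    proof -
      have "h ` e \<subseteq> {0..<card (verts T)}"
        using h that sg by (auto simp: simple_graph_def bij_betw_def)
      then show ?thesis using tree_card_verts_le[OF T] by fastforce
    qed
    moreover have "{0..<card (verts T)} \<subseteq> {..2 * m}" using tree_card_verts_le[OF T] by auto
    ultimately have "?G \<in> ?A" by auto
    moreover have "C = ?cls ?G"
    proof -
      have "graph_iso T S \<longleftrightarrow> graph_iso ?G S" for S :: "nat ugraph"
        using graph_iso_trans[OF iso, of S] graph_iso_trans[OF graph_iso_sym[OF iso], of S] by metis
      then show ?thesis using C by simp
    qed
    ultimately show "C \<in> ?cls ` ?A" by (rule rev_image_eqI)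
  qed
  then show ?thesis by (rule finite_subset) auto
qed

lemma star_in_trees: "({..m}, (\<lambda>i. {0, i}) ` {1..m}) \<in> trees m" (is "?G \<in> _")
proof -
  have adj: "adj ?G u v \<longleftrightarrow> (u = 0 \<and> v \<in> {1..m}) \<or> (v = 0 \<and> u \<in> {1..m})" for u v
    by (auto simp: image_iff doubleton_eq_iff)
  have "simple_graph ?G" by (auto simp: simple_graph_def)
  moreover have "connected_graph ?G" unfolding connected_graph_def
  proof (intro conjI ballI)
    fix u v assume "u \<in> verts ?G" "v \<in> verts ?G"
    then have "u = 0 \<or> adj ?G u 0" "v = 0 \<or> adj ?G 0 v"
      unfolding adj by auto
    then have "(adj ?G)\<^sup>*\<^sup>* u 0" "(adj ?G)\<^sup>*\<^sup>* 0 v"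
      by (metis r_into_rtranclp rtranclp.rtrancl_refl)+
    then show "(adj ?G)\<^sup>*\<^sup>* u v" by (rule rtranclp_trans)
  qed auto
  moreover have "\<not> is_cycle ?G c" for c
  proof
    assume "is_cycle ?G c"
    then have len: "3 \<le> length c" and d: "distinct c" and s: "successively (adj ?G) c"
      and l: "adj ?G (last c) (hd c)" unfolding is_cycle_def by blast+
    obtain x y z zs where c: "c = x # y # z # zs"
      using len by (metis Suc_le_length_iff numeral_3_eq_3)
    have "adj ?G x y" "adj ?G y z" using s c by auto
    moreover have "adj ?G (last (z # zs)) x" using l c by auto
    moreover have "last (z # zs) \<in> set (z # zs)" by (rule last_in_set) simp
    moreover have "x \<noteq> y" "x \<noteq> z" "y \<notin> set (z # zs)" "x \<notin> set (z # zs)" using d c by auto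
    ultimately show False unfolding adj by (metis atLeastAtMost_iff not_one_le_zero)
  qed
  moreover have "card ((\<lambda>i::nat. {0, i}) ` {1..m}) = m"
    by (subst card_image) (auto simp: inj_on_def doubleton_eq_iff)
  ultimately show ?thesis by (auto simp: trees_def is_tree_def)
qed

lemma unlabelled_trees_nonempty: "unlabelled_trees m \<noteq> {}"
  using star_in_trees[of m] by (auto simp: unlabelled_trees_def quotient_def)

end

theory Submission
  imports Defs "Jordan_Normal_Form.Determinant" "HOL-Number_Theory.Cong" "HOL-Library.Multiset"
begin

text \<open>
  Let \<open>p = 2m + 1\<close>. Suppose that the vertices of a tree \<open>T\<close> are mapped to \<open>\<int>/p\<close> such that no two edges have
  the same difference up to sign, no three vertices have the same image, and that \<open>T\<close> has a proper colouring with
  three colours in which vertices with the same image have the same colour. Then the translates of the image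
  cover each edge of \<open>K\<^sub>p\<close> once, and labels \<open>a\<close>, \<open>b\<close>, \<open>a + b\<close> modulo \<open>r\<close> according to the colours lift them to a
  decomposition of \<open>K\<^sub>p(r)\<close> into copies of \<open>T\<close>, the label of one of two vertices with the same image being shifted by 1.

  Such a map is found by embedding the non-leaves of \<open>T\<close> greedily, except for some vertices \<open>Y\<close> of one colour class
  that have a single leaf. The leaves and \<open>Y\<close> are then placed with the remaining differences
  by the Combinatorial Nullstellensatz. This works if the leaves together with the vertices having a single
  leaf as only child are sufficiently numerous, both in \<open>T\<close> and relative to the colour classes of \<open>T\<close>.

  The remaining trees are exponentially rare. Weights on rooted trees that reward the defect of leaves have
  a generating function converging at \<open>0.3395\<close>, hence there are \<open>O(0.3395\<^sup>-\<^sup>n)\<close> exceptional rooted trees with \<open>n\<close> vertices,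
  while the number of all rooted trees is at least \<open>c \<cdot> 0.339\<^sup>-\<^sup>n\<close>. Each unlabelled tree has at most \<open>n\<close> rootings.
\<close>

section \<open>Signed differences by the Combinatorial Nullstellensatz\<close>

text \<open>The difficulty is where a late vertex lands: if it meets an embedded vertex, both need a
  common colour that differs from the colour of its parent. Keeping the vertex of rank
  \<open>r\<close> away from a set of images costs one linear factor per image, and the degree count
  allows \<open>r + 1\<close> of them. A typical tree has more non-leaves than leaves, so the leaves
  alone give too few variables; removing \<open>Y\<close> from the embedded part shortens the list
  of images to avoid and also adds variables. The price is that the position of a child of
  \<open>Y\<close> involves two variables. Three colours are what the blow-up can carry for every
  \<open>r\<close>: the forms \<open>a\<close>, \<open>b\<close>, \<open>a + b\<close> are an
  orthogonal array with three columns, and a fourth column is impossible for \<open>r = 2\<close>.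
  The series of all rooted trees has radius of convergence 0.3383..., so the weighted series must
  converge a little beyond it. The constants 0.3387 < 0.339 < 0.3395 fit in that margin: divergence
  at the first gives the growth rate at the second, and the last two differ by the factor 678/679
  that makes exceptional trees rare.\<close>

lemma vandermonde_expansion:
  fixes a :: "nat \<Rightarrow> int"
  shows "(\<Sum>\<sigma> | \<sigma> permutes {0..<K}. signof \<sigma> * (\<Prod>i=0..<K. a i ^ \<sigma> i)) = (\<Prod>i=0..<K. \<Prod>j=0..<i. a i - a j)"
proof -
  \<comment> \<open>Newton basis: changing from powers to \<open>q\<close> multiplies the
    Vandermonde matrix by a unitriangular one and makes it lower triangular, since
    \<open>q j\<close> vanishes at \<open>a i\<close> for \<open>i < j\<close>.\<close>
  define q :: "nat \<Rightarrow> int poly" where "q j = (\<Prod>l=0..<j. [:- a l, 1:])" for j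
  have degq: "degree (q j) = j" for j
    unfolding q_def by (subst degree_prod_eq_sum_degree) auto
  have monic: "coeff (q j) j = 1" for j
    using lead_coeff_prod[of "\<lambda>l. [:- a l, 1:]" "{0..<j}"] degq[of j] unfolding q_def by simp
  define A where "A = mat K K (\<lambda>(i, j). a i ^ j)"
  define U where "U = mat K K (\<lambda>(k, j). coeff (q j) k)"
  define M where "M = mat K K (\<lambda>(i, j). poly (q j) (a i))"
  have cA: "A \<in> carrier_mat K K" and cU: "U \<in> carrier_mat K K" and cM: "M \<in> carrier_mat K K"
    by (auto simp: A_def U_def M_def)
  have "A * U = M"
  proof (rule eq_matI)
    fix i j assume "i < dim_row M" "j < dim_col M"
    then have ij: "i < K" "j < K" by (auto simp: M_def)
    have "(A * U) $$ (i, j) = (\<Sum>k=0..<K. a i ^ k * coeff (q j) k)"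
      using ij by (simp add: A_def U_def times_mat_def scalar_prod_def)
    also have "\<dots> = (\<Sum>k\<le>j. a i ^ k * coeff (q j) k)"
      using ij by (intro sum.mono_neutral_right) (auto intro: coeff_eq_0 simp: degq)
    also have "\<dots> = poly (q j) (a i)" by (simp add: poly_altdef degq mult.commute)
    finally show "(A * U) $$ (i, j) = M $$ (i, j)" using ij by (simp add: M_def)
  qed (auto simp: A_def U_def M_def)
  moreover have "det U = 1"
  proof -
    have "det U = prod_list (diag_mat U)"
      by (rule det_upper_triangular[OF _ cU]) (auto simp: U_def upper_triangular_def degq intro: coeff_eq_0)
    also have "\<dots> = (\<Prod>i=0..<K. coeff (q i) i)" by (simp add: prod_list_diag_prod U_def)
    finally show ?thesis by (simp add: monic)
  qed
  moreover have "det M = (\<Prod>i=0..<K. \<Prod>j=0..<i. a i - a j)"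
  proof -
    have "det M = prod_list (diag_mat M)"
      by (rule det_lower_triangular[OF _ cM]) (auto simp: M_def q_def poly_prod)
    also have "\<dots> = (\<Prod>i=0..<K. poly (q i) (a i))" by (simp add: prod_list_diag_prod M_def)
    finally show ?thesis by (simp add: q_def poly_prod)
  qed
  ultimately have "det A = (\<Prod>i=0..<K. \<Prod>j=0..<i. a i - a j)"
    using det_mult[OF cA cU] by simp
  moreover have "det A = (\<Sum>\<sigma> | \<sigma> permutes {0..<K}. signof \<sigma> * (\<Prod>i=0..<K. a i ^ \<sigma> i))"
    unfolding det_def'[OF cA]
    by (intro sum.cong refl arg_cong2[where f="(*)"] prod.cong)
       (auto simp: A_def dest: permutes_in_image)
  ultimately show ?thesis by simp
qed

section \<open>Weighted sums over a grid of integers\<close>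

definition grid_deriv :: "int set \<Rightarrow> int \<Rightarrow> int" where
  "grid_deriv G x = (\<Prod>y\<in>G - {x}. x - y)"

text \<open>This is \<open>grid_norm G\<close> divided by \<open>grid_deriv G x\<close>, written as
  a product to stay in the integers. Up to the factor \<open>grid_norm G\<close>, the weights are
  the coefficients of the divided difference over \<open>G\<close>.\<close>

definition grid_weight :: "int set \<Rightarrow> int \<Rightarrow> int" where
  "grid_weight G x = (\<Prod>y\<in>G - {x}. grid_deriv G y)"

definition grid_norm :: "int set \<Rightarrow> int" where
  "grid_norm G = (\<Prod>y\<in>G. grid_deriv G y)"

lemma grid_weight_deriv:
  assumes "finite G" "x \<in> G" shows "grid_weight G x * grid_deriv G x = grid_norm G"
  unfolding grid_weight_def grid_norm_def using prod.remove[OF assms, of "grid_deriv G"] by simp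

text \<open>Clearing denominators is harmless modulo \<open>p\<close> because the grid points stay
  distinct modulo \<open>p\<close>.\<close>

lemma grid_norm_coprime:
  assumes "finite G" "prime p" and inj: "\<And>a b. a \<in> G \<Longrightarrow> b \<in> G \<Longrightarrow> int p dvd a - b \<Longrightarrow> a = b"
  shows "\<not> int p dvd grid_norm G"
proof
  assume "int p dvd grid_norm G"
  then obtain y where "y \<in> G" "int p dvd grid_deriv G y"
    unfolding grid_norm_def using assms by (auto simp: prime_dvd_prod_iff)
  then obtain z where "z \<in> G - {y}" "int p dvd y - z"
    unfolding grid_deriv_def using assms by (auto simp: prime_dvd_prod_iff)
  then show False using inj[of y z] \<open>y \<in> G\<close> by auto
qed

text \<open>Lagrange interpolation, with the denominators cleared by the factor \<^term>\<open>grid_norm G\<close>.\<close>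

lemma grid_sum_poly:
  fixes h :: "int poly"
  assumes fin: "finite G" and deg: "degree h < card G"
  shows "(\<Sum>x\<in>G. grid_weight G x * poly h x) = grid_norm G * coeff h (card G - 1)"
proof -
  define l :: "int \<Rightarrow> int poly" where "l x = (\<Prod>y\<in>G - {x}. [:- y, 1:])" for x
  have degl: "degree (l x) = card G - 1" if "x \<in> G" for x
    unfolding l_def using that fin by (subst degree_prod_eq_sum_degree) auto
  have monic: "coeff (l x) (card G - 1) = 1" if "x \<in> G" for x
    using lead_coeff_prod[of "\<lambda>l. [:- l, 1:]" "G - {x}"] degl[OF that] unfolding l_def by simp
  have eval: "poly (l x) z = (if z = x then grid_deriv G x else 0)" if "x \<in> G" "z \<in> G" for x z
    using that fin by (auto simp: l_def grid_deriv_def poly_prod prod_zero_iff)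
  define r where "r = (\<Sum>x\<in>G. Polynomial.smult (grid_weight G x * poly h x) (l x)) - Polynomial.smult (grid_norm G) h"
  have "r = 0"
  proof (rule ccontr)
    assume r0: "r \<noteq> 0"
    have "G \<subseteq> {z. poly r z = 0}"
    proof
      fix z assume z: "z \<in> G"
      have "poly r z = (\<Sum>x\<in>G. if x = z then grid_weight G x * poly h x * grid_deriv G x else 0)
          - grid_norm G * poly h z"
        unfolding r_def poly_diff poly_sum poly_smult
        by (intro arg_cong2[where f="(-)"] sum.cong) (auto simp: eval z)
      also have "\<dots> = grid_weight G z * grid_deriv G z * poly h z - grid_norm G * poly h z"
        using z fin by (simp add: mult_ac)
      also have "\<dots> = 0" using grid_weight_deriv[OF fin z] by simp
      finally show "z \<in> {z. poly r z = 0}" by simp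
    qed
    then have "card G \<le> degree r"
      using card_poly_roots_bound[OF r0] poly_roots_finite[OF r0] card_mono by (metis order_trans)
    moreover have "degree r \<le> card G - 1"
      unfolding r_def using deg
      by (intro degree_diff_le degree_sum_le fin order_trans[OF degree_smult_le]) (auto simp: degl)
    ultimately show False using deg by auto
  qed
  then have "coeff r (card G - 1) = 0" by simp
  then show ?thesis by (simp add: r_def coeff_sum monic[unfolded One_nat_def])
qed

lemma grid_sum_monic:
  fixes h :: "int poly"
  assumes "finite G" "degree h = d" "coeff h d = 1" "Suc H = card G" "d \<le> H"
  shows "(\<Sum>x\<in>G. grid_weight G x * poly h x) = (if d = H then grid_norm G else 0)"
proof -
  have "card G - 1 = H" "degree h < card G" using assms by auto
  then show ?thesis using grid_sum_poly[of G h] assms by (auto simp: coeff_eq_0)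
qed

lemma monic_compose_shift:
  fixes f :: "int poly"
  assumes "degree f = d" "coeff f d = 1"
  shows "degree (f \<circ>\<^sub>p [:c, 1:]) = d" "coeff (f \<circ>\<^sub>p [:c, 1:]) d = 1"
proof -
  show 1: "degree (f \<circ>\<^sub>p [:c, 1:]) = d" using assms by (simp add: degree_pcompose)
  show "coeff (f \<circ>\<^sub>p [:c, 1:]) d = 1" using lead_coeff_comp[of "[:c, 1:]" f] 1 assms by simp
qed

lemma monic_times:
  fixes f g :: "int poly"
  assumes "degree f = d" "coeff f d = 1" "degree g = e" "coeff g e = 1"
  shows "degree (f * g) = d + e" "coeff (f * g) (d + e) = 1"
proof -
  have "f \<noteq> 0" "g \<noteq> 0" using assms by auto
  then show "degree (f * g) = d + e" using assms by (simp add: degree_mult_eq)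
  show "coeff (f * g) (d + e) = 1" using assms coeff_mult_degree_sum[of f g] by simp
qed

lemma grid_sum_single:
  assumes "finite G" "Suc H = card G" "degree f = e" "coeff f e = 1" "m + e \<le> H"
  shows "(\<Sum>x\<in>G. grid_weight G x * (x ^ m * poly f (x + c))) = (if m + e = H then grid_norm G else 0)"
proof -
  let ?h = "Polynomial.monom 1 m * (f \<circ>\<^sub>p [:c, 1:])"
  have "degree ?h = m + e" "coeff ?h (m + e) = 1"
    using monic_times[of "Polynomial.monom 1 m" m "f \<circ>\<^sub>p [:c, 1:]" e] monic_compose_shift[OF assms(3,4), of c]
    by (auto simp: degree_monom_eq)
  from grid_sum_monic[OF assms(1) this assms(2)] assms(5) show ?thesis
    by (simp add: poly_monom poly_pcompose add.commute)
qed

lemma sum_swap_pairs: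
  "(\<Sum>x\<in>A. \<Sum>y\<in>B. \<Sum>k\<in>C. \<Sum>j\<in>D k. F x y k j) = (\<Sum>k\<in>C. \<Sum>j\<in>D k. \<Sum>x\<in>A. \<Sum>y\<in>B. F x y k j)"
proof -
  have "(\<Sum>y\<in>B. \<Sum>k\<in>C. \<Sum>j\<in>D k. F x y k j) = (\<Sum>k\<in>C. \<Sum>j\<in>D k. \<Sum>y\<in>B. F x y k j)" for x
    by (subst sum.swap) (intro sum.cong refl sum.swap)
  then show ?thesis by (simp only:) (subst sum.swap, intro sum.cong refl sum.swap)
qed

text \<open>The sum extracts the coefficient of \<open>x ^ H * y ^ H\<close>. As the total degree is
  at most \<open>2 * H\<close>, only terms of top degree count: the shifts \<open>c\<close> and
  \<open>c'\<close> disappear, and the binomial coefficient is that of \<open>y ^ (H - m')\<close>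
  in \<open>(y + x) ^ e'\<close>.\<close>

lemma grid_sum_pair:
  assumes fin: "finite G" and H: "Suc H = card G"
    and f: "degree f = e" "coeff f e = 1" and g: "degree g = e'" "coeff g e' = 1"
    and le: "m + e + (m' + e') \<le> 2 * H"
  shows "(\<Sum>x\<in>G. \<Sum>y\<in>G. grid_weight G x * grid_weight G y *
           (x ^ m * poly f (x + c) * (y ^ m' * poly g (y + (x + c')))))
    = (if m + e + (m' + e') = 2 * H \<and> m' \<le> H \<and> H \<le> m' + e' then int (e' choose (H - m')) * grid_norm G ^ 2 else 0)"
proof -
  let ?w = "grid_weight G" and ?N = "grid_norm G"
  define S where "S j = (\<Sum>y\<in>G. ?w y * y ^ (m' + j))" for j
  define R where "R i = (\<Sum>x\<in>G. ?w x * (x ^ m * (poly f (x + c) * (x + c') ^ i)))" for i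
  have S: "S j = (if m' + j = H then ?N else 0)" if "m' + j \<le> H" for j
    using grid_sum_single[OF fin H, of 1 0 "m' + j" 0] that by (simp add: S_def)
  have R: "R i = (if m + e + i = H then ?N else 0)" if "m + e + i \<le> H" for i
  proof -
    let ?f = "(f \<circ>\<^sub>p [:c, 1:]) * [:c', 1:] ^ i"
    have d: "degree ([:c', 1:] ^ i) = i" "coeff ([:c', 1:] ^ i) i = 1"
      by (auto simp: degree_linear_power coeff_linear_power)
    have "degree ?f = e + i" "coeff ?f (e + i) = 1"
      using monic_times[OF monic_compose_shift[OF f, of c] d] by auto
    from grid_sum_single[OF fin H this, of m 0] that show ?thesis
      by (simp add: R_def poly_pcompose algebra_simps)
  qed
  have "(\<Sum>x\<in>G. \<Sum>y\<in>G. ?w x * ?w y * (x ^ m * poly f (x + c) * (y ^ m' * poly g (y + (x + c')))))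
    = (\<Sum>x\<in>G. \<Sum>y\<in>G. \<Sum>k\<le>e'. \<Sum>j\<le>k. coeff g k * int (k choose j) *
        ((?w y * y ^ (m' + j)) * (?w x * (x ^ m * (poly f (x + c) * (x + c') ^ (k - j))))))"
    by (intro sum.cong refl)
       (simp add: poly_altdef[of g] g binomial_ring sum_distrib_left sum_distrib_right power_add mult_ac)
  also have "\<dots> = (\<Sum>k\<le>e'. \<Sum>j\<le>k. \<Sum>x\<in>G. \<Sum>y\<in>G. coeff g k * int (k choose j) *
        ((?w y * y ^ (m' + j)) * (?w x * (x ^ m * (poly f (x + c) * (x + c') ^ (k - j))))))"
    by (rule sum_swap_pairs)
  also have "\<dots> = (\<Sum>k\<le>e'. \<Sum>j\<le>k. coeff g k * int (k choose j) * (R (k - j) * S j))"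
    by (intro sum.cong refl, simp only: S_def R_def sum_product)
       (simp only: sum_distrib_left mult.commute[of "_ * _ ^ (m' + _)"])
  also have "\<dots> = (\<Sum>k\<le>e'. \<Sum>j\<le>k. if k = e' \<and> m + e + (m' + e') = 2 * H \<and> m' + j = H
      then int (e' choose j) * ?N ^ 2 else 0)"
  proof (intro sum.cong refl)
    fix k j assume kj: "k \<in> {..e'}" "j \<in> {..k}"
    show "coeff g k * int (k choose j) * (R (k - j) * S j) =
      (if k = e' \<and> m + e + (m' + e') = 2 * H \<and> m' + j = H then int (e' choose j) * ?N ^ 2 else 0)"
    \<comment> \<open>If the exponent of \<open>y\<close> is too small, the sum over
      \<open>y\<close> vanishes. Otherwise the bound on the total degree leaves degree at most
      \<open>H\<close> for \<open>x\<close>, so that \<open>R\<close> can be evaluated.\<close>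
    proof (cases "m' + j < H")
      case True then show ?thesis using S[of j] by simp
    next
      case False
      then have "m + e + (k - j) \<le> H" using le kj by auto
      note R = R[OF this]
      show ?thesis
      proof (cases "m + e + (k - j) < H")
        case True then show ?thesis using R kj False le by auto
      next
        case F2: False
        then have "k = e'" "m' + j = H" "m + e + (m' + e') = 2 * H" "m + e + (k - j) = H"
          using le kj False \<open>m + e + (k - j) \<le> H\<close> by auto
        then show ?thesis using R S[of j] g by (simp add: power2_eq_square)
      qed
    qed
  qed
  also have "\<dots> = (\<Sum>j\<le>e'. if m + e + (m' + e') = 2 * H \<and> m' + j = H then int (e' choose j) * ?N ^ 2 else 0)"
    by (subst sum.remove[of _ e']) (auto intro!: sum.neutral)
  also have "\<dots> = (\<Sum>j\<le>e'. if j = H - m' then (if m + e + (m' + e') = 2 * H \<and> m' \<le> H then int (e' choose j) * ?N ^ 2 else 0) else 0)"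
    by (intro sum.cong) auto
  also have "\<dots> = (if m + e + (m' + e') = 2 * H \<and> m' \<le> H \<and> H \<le> m' + e' then int (e' choose (H - m')) * ?N ^ 2 else 0)"
    by (subst sum.delta) auto
  finally show ?thesis .
qed

text \<open>Only one pair of permutations contributes to the leading coefficient: with \<open>\<sigma>\<close> read backwards, the
  rank \<open>j\<close> of each permutation is forced to sit at position \<open>j\<close>, by induction on \<open>j\<close>.\<close>

lemma forced_permutations:
  fixes s t :: "nat \<Rightarrow> nat" and b :: "nat \<Rightarrow> nat"
  assumes s: "s permutes {0..<K}" and t: "t permutes {0..<K}" and y: "2 * y \<le> K"
    and single: "\<And>v. y \<le> v \<Longrightarrow> v < K - y \<Longrightarrow> v + t v = 2 * s v"
    and pair: "\<And>i. i < y \<Longrightarrow> i + t i + (K - y + i + t (K - y + i)) = 2 * s i + 2 * s (K - y + i)"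
    and pos: "\<And>i. i < y \<Longrightarrow> 2 * s (K - y + i) \<le> K - y + i + t (K - y + i)"
    and late: "\<And>i. i < y \<Longrightarrow> K - y + i \<le> 2 * s (K - y + i) + b i"
    and gap: "\<And>i. i < y \<Longrightarrow> 2 * i + 1 + b i \<le> K - y + i"
    and j: "j < K"
  shows "s j = j \<and> t j = j"
  using j
proof (induction j rule: less_induct)
  case (less j)
  have sin: "inj s" "inj t" using s t permutes_inj by auto
  have "j \<in> s ` {0..<K}" using permutes_image[OF s] less.prems by auto
  \<comment> \<open>All smaller ranks are fixed points already, hence both \<open>v\<close> and
    \<open>t v\<close> are at least \<open>j\<close>; the bound \<open>v + t v \<le> 2 * j\<close>
    then leaves no choice.\<close>
  then obtain v where v: "v < K" "s v = j" by auto
  have vj: "j \<le> v"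
  proof (rule ccontr)
    assume "\<not> j \<le> v"
    then show False using less.IH[of v] v by auto
  qed
  have tv: "j \<le> t v"
  proof (rule ccontr)
    assume "\<not> j \<le> t v"
    then have "t (t v) = t v" using less.IH[of "t v"] less.prems by auto
    then have "t v = v" using sin by (auto dest: injD)
    then show False using \<open>\<not> j \<le> t v\<close> vj by simp
  qed
  have key: "v + t v \<le> 2 * j"
  proof -
    consider "v < y" | "y \<le> v" "v < K - y" | "K - y \<le> v" by linarith
    then show ?thesis
    proof cases
      case 1 then show ?thesis using pair[OF 1] pos[OF 1] v by linarith
    next
      case 2 then show ?thesis using single[OF 2] v by linarith
    next
      case 3
      \<comment> \<open>\<open>gap\<close> forces the partner \<open>i\<close> of \<open>v\<close>
        below \<open>j\<close>. The induction hypothesis settles \<open>i\<close>, and the joint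
        equation of the pair reduces to \<open>v + t v = 2 * j\<close>.\<close>
      define i where "i = v - (K - y)"
      have i: "i < y" "v = K - y + i" using 3 v(1) y by (auto simp: i_def)
      have "v \<le> 2 * j + b i" "2 * i + 1 + b i \<le> v" using late[OF i(1)] gap[OF i(1)] v i by auto
      then have "i < j" by linarith
      then have "s i = i" "t i = i" using less.IH[of i] less.prems by auto
      then show ?thesis using pair[OF i(1)] v i by auto
    qed
  qed
  have "v = j" "t v = j" using key vj tv by linarith+
  then show ?case using v by simp
qed

text \<open>Combinatorial Nullstellensatz: the weighted sum over the grid extracts the coefficient of the monomial
  \<open>\<Prod> x\<^sub>r\<^bsup>2K-1\<^esup>\<close>. The last \<open>y\<close> variables are attached to the first \<open>y\<close> ones, so that the
  position of variable \<open>K - y + i\<close> also depends on variable \<open>i\<close>.\<close>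

lemma signed_assignment:
  fixes p K y :: nat and G :: "int set" and c :: "nat \<Rightarrow> int" and B :: "nat \<Rightarrow> int set"
  assumes p: "prime p" and G: "card G = 2 * K"
    and inj: "\<And>a b. a \<in> G \<Longrightarrow> b \<in> G \<Longrightarrow> int p dvd a - b \<Longrightarrow> a = b"
    and y: "2 * y \<le> K"
    and B: "\<And>r. r < K \<Longrightarrow> finite (B r) \<and> card (B r) \<le> r + 1"
    and gap: "\<And>i. i < y \<Longrightarrow> 2 * i + 1 + card (B (K - y + i)) \<le> K - y + i"
  obtains x :: "nat \<Rightarrow> int" where "\<And>r. r < K \<Longrightarrow> x r \<in> G"
    and "\<And>i j. j < i \<Longrightarrow> i < K \<Longrightarrow> \<not> int p dvd (x i)\<^sup>2 - (x j)\<^sup>2"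
    and "\<And>i j. j < i \<Longrightarrow> i < K \<Longrightarrow> \<not> int p dvd (c i + x i + (if i < K - y then 0 else x (i - (K - y))))
           - (c j + x j + (if j < K - y then 0 else x (j - (K - y))))"
    and "\<And>r \<beta>. r < K \<Longrightarrow> \<beta> \<in> B r \<Longrightarrow> \<not> int p dvd c r + x r + (if r < K - y then 0 else x (r - (K - y))) - \<beta>"
proof (cases "K = 0")
  case True
  then show ?thesis using that[of "\<lambda>_. 0"] by auto
next
  case False
  define n where "n = K - y"
  define H where "H = 2 * K - 1"
  \<comment> \<open>Block \<open>i\<close> stores variable \<open>i\<close> in its first component
    and, for \<open>i < y\<close>, the attached variable \<open>n + i\<close> in its second one. The
    blocks are independent of each other, so sums over the grid factor into blocks.\<close>
  define X :: "(nat \<Rightarrow> int \<times> int) \<Rightarrow> nat \<Rightarrow> int" where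
    "X g r = (if r < n then fst (g r) else snd (g (r - n)))" for g r
  define L where "L g r = c r + X g r + (if r < n then 0 else X g (r - n))" for g r
  define b where "b r = card (B r)" for r
  define N where "N = grid_norm G"
  have finG: "finite G" using G False card.infinite by fastforce
  have H: "Suc H = card G" using G False by (simp add: H_def)
  have nK: "n + y = K" "y \<le> n" using y by (auto simp: n_def)
  have b: "b r \<le> r + 1" if "r < K" for r using B[OF that] by (simp add: b_def)
  define Q :: "(nat \<Rightarrow> nat) \<Rightarrow> nat \<Rightarrow> int poly" where
    "Q \<tau> r = Polynomial.monom 1 (\<tau> r) * (\<Prod>\<beta>\<in>B r. [:- \<beta>, 1:])" for \<tau> r
  have Q: "degree (Q \<tau> r) = \<tau> r + b r" "coeff (Q \<tau> r) (\<tau> r + b r) = 1" for \<tau> r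
  proof -
    have d: "degree (\<Prod>\<beta>\<in>B r. [:- \<beta>, 1:] :: int poly) = b r"
      unfolding b_def by (subst degree_prod_eq_sum_degree) auto
    then have "coeff (\<Prod>\<beta>\<in>B r. [:- \<beta>, 1:] :: int poly) (b r) = 1"
      using lead_coeff_prod[of "\<lambda>\<beta>. [:- \<beta>, 1:] :: int poly" "B r"] by simp
    from monic_times[OF _ _ d this, of "Polynomial.monom 1 (\<tau> r)" "\<tau> r"]
    show "degree (Q \<tau> r) = \<tau> r + b r" "coeff (Q \<tau> r) (\<tau> r + b r) = 1"
      by (auto simp: Q_def degree_monom_eq)
  qed
  define m :: "(nat \<Rightarrow> nat) \<Rightarrow> nat \<Rightarrow> nat" where "m \<sigma> r = 2 * \<sigma> r + (r + 1 - b r)" for \<sigma> r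
  \<comment> \<open>The powers \<open>X g r ^ (r + 1 - b r)\<close> are padding: they raise the
    total degree to exactly \<open>K * H\<close>, which is possible because
    \<open>b r \<le> r + 1\<close>. A value of \<open>P\<close> that is nonzero modulo
    \<open>p\<close> gives the wanted inequalities with or without them.\<close>
  define P where "P g = (\<Prod>i=0..<K. \<Prod>j=0..<i. (X g i)\<^sup>2 - (X g j)\<^sup>2) * (\<Prod>i=0..<K. \<Prod>j=0..<i. L g i - L g j)
    * (\<Prod>r=0..<K. X g r ^ (r + 1 - b r) * (\<Prod>\<beta>\<in>B r. L g r - \<beta>))" for g
  define V where "V \<sigma> \<tau> g = (\<Prod>r=0..<K. X g r ^ m \<sigma> r * poly (Q \<tau> r) (L g r))" for \<sigma> \<tau> g
  define S where "S = {\<sigma>. \<sigma> permutes {0..<K}}"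
  have P_expand: "P g = (\<Sum>\<sigma>\<in>S. \<Sum>\<tau>\<in>S. signof \<sigma> * signof \<tau> * V \<sigma> \<tau> g)" for g
  proof -
    have V: "V \<sigma> \<tau> g = (\<Prod>i=0..<K. ((X g i)\<^sup>2) ^ \<sigma> i) * (\<Prod>i=0..<K. L g i ^ \<tau> i)
      * (\<Prod>r=0..<K. X g r ^ (r + 1 - b r) * (\<Prod>\<beta>\<in>B r. L g r - \<beta>))" for \<sigma> \<tau>
      unfolding V_def prod.distrib[symmetric]
      by (intro prod.cong refl) (simp add: m_def Q_def poly_prod poly_monom power_add flip: power_mult)
    show ?thesis
      unfolding P_def vandermonde_expansion[symmetric] S_def[symmetric] V sum_product
      unfolding sum_distrib_right
      by (intro sum.cong refl) (simp only: mult_ac)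
  qed
  define Bx where "Bx i = (if i < y then G \<times> G else G \<times> {0})" for i
  define w :: "nat \<Rightarrow> int \<times> int \<Rightarrow> int" where
    "w i z = grid_weight G (fst z) * (if i < y then grid_weight G (snd z) else 1)" for i z
  define blk where "blk \<sigma> \<tau> i z = fst z ^ m \<sigma> i * poly (Q \<tau> i) (fst z + c i) *
      (if i < y then snd z ^ m \<sigma> (n + i) * poly (Q \<tau> (n + i)) (snd z + (fst z + c (n + i))) else 1)"
    for \<sigma> \<tau> i and z :: "int \<times> int"
  define T where "T \<sigma> \<tau> i = (\<Sum>z\<in>Bx i. w i z * blk \<sigma> \<tau> i z)" for \<sigma> \<tau> i
  have split: "(\<Prod>r=0..<K. h r) = (\<Prod>i=0..<n. h i * (if i < y then h (n + i) else 1))" for h :: "nat \<Rightarrow> int"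
  proof -
    have "(\<Prod>r=0..<K. h r) = (\<Prod>r=0..<n. h r) * (\<Prod>r=n..<n+y. h r)"
      using prod.atLeastLessThan_concat[of 0 n K h] nK by simp
    also have "(\<Prod>r=n..<n+y. h r) = (\<Prod>i=0..<y. h (n + i))"
      using prod.shift_bounds_nat_ivl[of h 0 n y] by (simp add: add.commute)
    also have "\<dots> = (\<Prod>i=0..<n. if i < y then h (n + i) else 1)"
      using nK(2) by (intro prod.mono_neutral_cong_left) auto
    finally show ?thesis by (simp add: prod.distrib)
  qed
  have V_blk: "V \<sigma> \<tau> g = (\<Prod>i=0..<n. blk \<sigma> \<tau> i (g i))" for \<sigma> \<tau> g
    unfolding V_def split by (intro prod.cong refl) (auto simp: blk_def X_def L_def add_ac)
  have E: "(\<Sum>g\<in>PiE {0..<n} Bx. (\<Prod>i=0..<n. w i (g i)) * V \<sigma> \<tau> g) = (\<Prod>i=0..<n. T \<sigma> \<tau> i)" for \<sigma> \<tau>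
    unfolding V_blk T_def
    by (subst prod_sum_PiE) (auto simp: Bx_def finG prod.distrib)
  have T_single: "T \<sigma> \<tau> i = (if m \<sigma> i + (\<tau> i + b i) = H then N else 0)"
    if "y \<le> i" "m \<sigma> i + (\<tau> i + b i) \<le> H" for \<sigma> \<tau> i
  proof -
    have "T \<sigma> \<tau> i = (\<Sum>x\<in>G. grid_weight G x * (x ^ m \<sigma> i * poly (Q \<tau> i) (x + c i)))"
      unfolding T_def Bx_def using that
      by (simp add: sum.cartesian_product' w_def blk_def)
    then show ?thesis using grid_sum_single[OF finG H Q[of \<tau> i] that(2)] by (simp add: N_def)
  qed
  have T_pair: "T \<sigma> \<tau> i = (if m \<sigma> i + (\<tau> i + b i) + (m \<sigma> (n + i) + (\<tau> (n + i) + b (n + i))) = 2 * H \<and> m \<sigma> (n + i) \<le> H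
       \<and> H \<le> m \<sigma> (n + i) + (\<tau> (n + i) + b (n + i))
     then int ((\<tau> (n + i) + b (n + i)) choose (H - m \<sigma> (n + i))) * N ^ 2 else 0)"
    if "i < y" "m \<sigma> i + (\<tau> i + b i) + (m \<sigma> (n + i) + (\<tau> (n + i) + b (n + i))) \<le> 2 * H" for \<sigma> \<tau> i
  proof -
    have "T \<sigma> \<tau> i = (\<Sum>x\<in>G. \<Sum>z\<in>G. grid_weight G x * grid_weight G z *
        (x ^ m \<sigma> i * poly (Q \<tau> i) (x + c i) * (z ^ m \<sigma> (n + i) * poly (Q \<tau> (n + i)) (z + (x + c (n + i))))))"
      unfolding T_def Bx_def using that
      by (simp add: sum.cartesian_product' w_def blk_def mult_ac)
    then show ?thesis using grid_sum_pair[OF finG H Q[of \<tau> i] Q[of \<tau> "n + i"] that(2)] by (simp add: N_def)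
  qed
  \<comment> \<open>With the reversal and \<open>\<tau> = id\<close>, variable \<open>r\<close> has
    degree \<open>2 * (K - 1 - r) + (r + 1) + r = H\<close> for every \<open>r\<close>, counting its
    linear form as one power of the variable.\<close>
  define \<sigma>0 :: "nat \<Rightarrow> nat" where "\<sigma>0 r = (if r < K then K - 1 - r else r)" for r
  have \<sigma>0: "\<sigma>0 permutes {0..<K}"
    by (rule bij_imp_permutes, rule bij_betw_byWitness[of _ \<sigma>0]) (auto simp: \<sigma>0_def)
  have forced: "\<sigma> = \<sigma>0 \<and> \<tau> = id" if st: "\<sigma> \<in> S" "\<tau> \<in> S" and nz: "\<forall>i<n. T \<sigma> \<tau> i \<noteq> 0" for \<sigma> \<tau>
  proof -
    have perm: "\<sigma> permutes {0..<K}" "\<tau> permutes {0..<K}" using st by (auto simp: S_def)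
    have \<sigma>K: "\<sigma> r < K" if "r < K" for r using permutes_in_image[OF perm(1), of r] that by simp
    define D where "D i = m \<sigma> i + (\<tau> i + b i) + (if i < y then m \<sigma> (n + i) + (\<tau> (n + i) + b (n + i)) else 0)" for i
    define t where "t i = (if i < y then 2 * H else H)" for i
    \<comment> \<open>A block of degree below \<open>t i\<close> contributes 0. Since the total
      degree is \<open>K * H\<close>, the sum of all \<open>t i\<close>, no block can exceed its
      share either.\<close>
    have ge: "t i \<le> D i" if "i < n" for i
    proof (rule ccontr)
      assume "\<not> t i \<le> D i"
      then show False
        using nz[rule_format, OF that] T_single[of i \<sigma> \<tau>] T_pair[of i \<sigma> \<tau>]
        by (cases "i < y") (simp_all add: t_def D_def)
    qed
    have splits: "(\<Sum>r=0..<K. h r) = (\<Sum>i=0..<n. h i + (if i < y then h (n + i) else 0))" for h :: "nat \<Rightarrow> nat"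
    proof -
      have "(\<Sum>r=0..<K. h r) = (\<Sum>r=0..<n. h r) + (\<Sum>r=n..<n+y. h r)"
        using sum.atLeastLessThan_concat[of 0 n K h] nK by simp
      also have "(\<Sum>r=n..<n+y. h r) = (\<Sum>i=0..<y. h (n + i))"
        using sum.shift_bounds_nat_ivl[of h 0 n y] by (simp add: add.commute)
      also have "\<dots> = (\<Sum>i=0..<n. if i < y then h (n + i) else 0)"
        using nK(2) by (intro sum.mono_neutral_cong_left) auto
      finally show ?thesis by (simp add: sum.distrib)
    qed
    have "(\<Sum>i=0..<n. D i) = (\<Sum>r=0..<K. m \<sigma> r + (\<tau> r + b r))"
      unfolding splits D_def by (intro sum.cong) auto
    also have "\<dots> = (\<Sum>r=0..<K. 2 * \<sigma> r + \<tau> r + r + 1)"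
    proof (intro sum.cong refl)
      fix r assume "r \<in> {0..<K}"
      then show "m \<sigma> r + (\<tau> r + b r) = 2 * \<sigma> r + \<tau> r + r + 1" using b[of r] by (simp add: m_def)
    qed
    also have "\<dots> = 2 * (\<Sum>r=0..<K. \<sigma> r) + (\<Sum>r=0..<K. \<tau> r) + (\<Sum>r=0..<K. r) + K"
      by (simp only: sum.distrib sum_distrib_left sum_constant) simp
    also have "(\<Sum>r=0..<K. \<sigma> r) = (\<Sum>r=0..<K. r)"
      using sum.permute[OF perm(1), of id] by simp
    also have "(\<Sum>r=0..<K. \<tau> r) = (\<Sum>r=0..<K. r)"
      using sum.permute[OF perm(2), of id] by simp
    also have "2 * (\<Sum>r=0..<K. r) + (\<Sum>r=0..<K. r) + (\<Sum>r=0..<K. r) + K = K * H"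
    proof -
      have "2 * (\<Sum>r=0..<K. r) + K = K * K"
        by (induction K) auto
      then have "2 * (\<Sum>r=0..<K. r) + (\<Sum>r=0..<K. r) + (\<Sum>r=0..<K. r) + K + K = 2 * (K * K)" by linarith
      moreover have "K * H + K = 2 * (K * K)" using False by (simp add: H_def algebra_simps)
      ultimately show ?thesis by linarith
    qed
    also have "K * H = (\<Sum>r=0..<K. H)" by simp
    also have "\<dots> = (\<Sum>i=0..<n. t i)"
      unfolding splits t_def by (intro sum.cong) auto
    finally have "(\<Sum>i=0..<n. D i) = (\<Sum>i=0..<n. t i)" .
    then have eq: "D i = t i" if "i < n" for i
      using sum_mono_inv[of t "{0..<n}" D i] ge that by simp
    define s where "s r = \<sigma>0 (\<sigma> r)" for r
    have s: "s permutes {0..<K}" unfolding s_def using permutes_compose[OF perm(1) \<sigma>0] by (simp add: o_def)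
    have sr: "s r + \<sigma> r = K - 1" if "r < K" for r using \<sigma>K[OF that] by (simp add: s_def \<sigma>0_def)
    have mr: "m \<sigma> r + b r + 2 * s r = H + r" if "r < K" for r
      using sr[OF that] b[OF that] False by (auto simp: m_def H_def)
    have main: "s j = j \<and> \<tau> j = j" if "j < K" for j
    proof (rule forced_permutations[OF s perm(2) y, of "\<lambda>i. b (n + i)"])
      show "v + \<tau> v = 2 * s v" if "y \<le> v" "v < K - y" for v
      proof -
        have "v < n" "v < K" using that by (auto simp: n_def)
        then show ?thesis using eq[of v] that(1) mr[of v] by (simp add: D_def t_def)
      qed
      fix i assume i: "i < y"
      then have iK: "i < n" "n + i < K" "i < K" using nK by auto
      note mr = mr[OF iK(2)] mr[OF iK(3)]
      show "i + \<tau> i + (K - y + i + \<tau> (K - y + i)) = 2 * s i + 2 * s (K - y + i)"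
        unfolding n_def[symmetric] using eq[OF iK(1)] i mr by (simp add: D_def t_def)
      have *: "m \<sigma> (n + i) \<le> H" "H \<le> m \<sigma> (n + i) + (\<tau> (n + i) + b (n + i))"
        using nz[rule_format, OF iK(1)] T_pair[OF i, of \<sigma> \<tau>] eq[OF iK(1)] i
        by (simp_all add: D_def t_def split: if_splits)
      show "2 * s (K - y + i) \<le> K - y + i + \<tau> (K - y + i)"
        unfolding n_def[symmetric] using *(2) mr by linarith
      show "K - y + i \<le> 2 * s (K - y + i) + b (n + i)"
        unfolding n_def[symmetric] using *(1) mr by linarith
      show "2 * i + 1 + b (n + i) \<le> K - y + i" using gap[OF i] by (simp only: b_def n_def)
    qed (use that in auto)
    have "\<sigma> r = \<sigma>0 r" for r
      using main[of r] sr[of r] permutes_not_in[OF perm(1), of r] by (cases "r < K") (auto simp: \<sigma>0_def)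
    moreover have "\<tau> r = r" for r
      using main[of r] permutes_not_in[OF perm(2), of r] by (cases "r < K") auto
    ultimately show ?thesis by (auto simp: fun_eq_iff)
  qed
  have T0: "T \<sigma>0 id i = (if i < y then N ^ 2 else N)" if i: "i < n" for i
  proof (cases "i < y")
    case False
    then have "m \<sigma>0 i + (id i + b i) = H"
      using b[of i] i nK by (auto simp: m_def \<sigma>0_def H_def)
    then show ?thesis using T_single[of i \<sigma>0 id] False by simp
  next
    case True
    then have iK: "n + i < K" "i < K" using nK by auto
    have 1: "m \<sigma>0 i + (id i + b i) = H" using b[OF iK(2)] iK by (auto simp: m_def \<sigma>0_def H_def)
    have 2: "m \<sigma>0 (n + i) + (id (n + i) + b (n + i)) = H"
      using b[OF iK(1)] iK by (auto simp: m_def \<sigma>0_def H_def)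
    \<comment> \<open>The lower index equals the upper one, so the binomial coefficient is 1 and the
      surviving term is a power of \<open>N\<close> up to sign.\<close>
    have 3: "m \<sigma>0 (n + i) \<le> H" "H - m \<sigma>0 (n + i) = id (n + i) + b (n + i)" using 2 by linarith+
    show ?thesis using T_pair[OF True, of \<sigma>0 id] True 1 2 3 by simp
  qed
  have "\<exists>g\<in>PiE {0..<n} Bx. \<not> int p dvd P g"
  \<comment> \<open>Otherwise \<open>p\<close> would divide the weighted sum of \<open>P\<close>
    over the whole grid, which collapses to \<open>N ^ K\<close> up to sign.\<close>
  proof (rule ccontr)
    assume "\<not> ?thesis"
    then have "int p dvd (\<Sum>g\<in>PiE {0..<n} Bx. (\<Prod>i=0..<n. w i (g i)) * P g)"
      by (intro dvd_sum) auto
    also have "(\<Sum>g\<in>PiE {0..<n} Bx. (\<Prod>i=0..<n. w i (g i)) * P g)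
      = (\<Sum>\<sigma>\<in>S. \<Sum>\<tau>\<in>S. signof \<sigma> * signof \<tau> * (\<Prod>i=0..<n. T \<sigma> \<tau> i))"
      unfolding P_expand E[symmetric] sum_distrib_left
      by (subst sum.swap, intro sum.cong refl, subst sum.swap) (simp add: mult_ac)
    also have "\<dots> = (\<Sum>\<sigma>\<in>S. \<Sum>\<tau>\<in>S. if \<sigma> = \<sigma>0 \<and> \<tau> = id then signof \<sigma> * signof \<tau> * (\<Prod>i=0..<n. T \<sigma> \<tau> i) else 0)"
    proof (intro sum.cong refl)
      fix \<sigma> \<tau> assume "\<sigma> \<in> S" "\<tau> \<in> S"
      then show "signof \<sigma> * signof \<tau> * (\<Prod>i=0..<n. T \<sigma> \<tau> i)
        = (if \<sigma> = \<sigma>0 \<and> \<tau> = id then signof \<sigma> * signof \<tau> * (\<Prod>i=0..<n. T \<sigma> \<tau> i) else 0)"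
        using forced[of \<sigma> \<tau>] by (auto simp: prod_zero_iff)
    qed
    also have "\<dots> = (\<Sum>\<sigma>\<in>S. if \<sigma> = \<sigma>0 then signof \<sigma>0 * (\<Prod>i=0..<n. T \<sigma>0 id i) else 0)"
    proof (intro sum.cong refl)
      fix \<sigma> assume "\<sigma> \<in> S"
      have S: "finite S" "id \<in> S" unfolding S_def by (auto simp: finite_permutations permutes_id)
      show "(\<Sum>\<tau>\<in>S. if \<sigma> = \<sigma>0 \<and> \<tau> = id then signof \<sigma> * signof \<tau> * (\<Prod>i=0..<n. T \<sigma> \<tau> i) else 0)
        = (if \<sigma> = \<sigma>0 then signof \<sigma>0 * (\<Prod>i=0..<n. T \<sigma>0 id i) else 0)"
        using S by (subst sum.remove[of _ id]) (auto intro!: sum.neutral)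
    qed
    also have "\<dots> = signof \<sigma>0 * (\<Prod>i=0..<n. T \<sigma>0 id i)"
      using \<sigma>0 by (simp add: S_def finite_permutations)
    finally have "int p dvd signof \<sigma>0 * (\<Prod>i=0..<n. T \<sigma>0 id i)" .
    then have "int p dvd (\<Prod>i=0..<n. T \<sigma>0 id i)" by (auto simp: sign_def split: if_splits)
    then obtain i where "i < n" "int p dvd T \<sigma>0 id i"
      using p by (auto simp: prime_dvd_prod_iff)
    then have "int p dvd N"
      using p T0[of i] by (auto simp: prime_dvd_power_iff split: if_splits)
    then show False using grid_norm_coprime[OF finG p inj] by (simp add: N_def)
  qed
  then obtain g where g: "g \<in> PiE {0..<n} Bx" and nd: "\<not> int p dvd P g" by blast
  have 1: "\<not> int p dvd (\<Prod>i=0..<K. \<Prod>j=0..<i. (X g i)\<^sup>2 - (X g j)\<^sup>2)"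
    and 2: "\<not> int p dvd (\<Prod>i=0..<K. \<Prod>j=0..<i. L g i - L g j)"
    and 3: "\<not> int p dvd (\<Prod>r=0..<K. X g r ^ (r + 1 - b r) * (\<Prod>\<beta>\<in>B r. L g r - \<beta>))"
    using nd by (auto simp: P_def)
  have *: "int p dvd prod h A" if "finite A" "a \<in> A" "int p dvd h a" for h :: "nat \<Rightarrow> int" and A a
    using that dvd_trans dvd_prodI by blast
  show ?thesis
  proof (rule that[of "X g", folded n_def, folded L_def])
    show "X g r \<in> G" if "r < K" for r
    proof (cases "r < n")
      case True
      then have "g r \<in> Bx r" using g by auto
      then show ?thesis using True by (auto simp: X_def Bx_def split: if_splits)
    next
      case False
      then have "r - n < y" "r - n < n" using that nK by auto
      then have "g (r - n) \<in> Bx (r - n)" using g by auto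
      then show ?thesis using False \<open>r - n < y\<close> by (auto simp: X_def Bx_def)
    qed
    show "\<not> int p dvd (X g i)\<^sup>2 - (X g j)\<^sup>2" if "j < i" "i < K" for i j
    proof
      assume "int p dvd (X g i)\<^sup>2 - (X g j)\<^sup>2"
      then have "int p dvd (\<Prod>j=0..<i. (X g i)\<^sup>2 - (X g j)\<^sup>2)" using that by (intro *[of _ j]) auto
      then show False using 1 *[of "{0..<K}" i "\<lambda>i. \<Prod>j=0..<i. (X g i)\<^sup>2 - (X g j)\<^sup>2"] that by auto
    qed
    show "\<not> int p dvd L g i - L g j" if "j < i" "i < K" for i j
    proof
      assume "int p dvd L g i - L g j"
      then have "int p dvd (\<Prod>j=0..<i. L g i - L g j)" using that by (intro *[of _ j]) auto
      then show False using 2 *[of "{0..<K}" i "\<lambda>i. \<Prod>j=0..<i. L g i - L g j"] that by auto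
    qed
    show "\<not> int p dvd L g r - \<beta>" if "r < K" "\<beta> \<in> B r" for r \<beta>
    proof
      assume "int p dvd L g r - \<beta>"
      then have "int p dvd (\<Prod>\<beta>\<in>B r. L g r - \<beta>)"
        using B[OF that(1)] that(2) dvd_trans dvd_prodI by blast
      then have "int p dvd X g r ^ (r + 1 - b r) * (\<Prod>\<beta>\<in>B r. L g r - \<beta>)" by simp
      then show False using 3 *[of "{0..<K}" r "\<lambda>r. X g r ^ (r + 1 - b r) * (\<Prod>\<beta>\<in>B r. L g r - \<beta>)"] that by simp
    qed
  qed
qed

section \<open>Lifting a labelling to the blow-up\<close>

text \<open>Normal form of a tree with \<open>m\<close> edges, provided that
  \<open>par i < i\<close>: vertices are numbered in a search order from the root 0, so that every
  vertex comes after its parent.\<close>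

definition par_graph :: "nat \<Rightarrow> (nat \<Rightarrow> nat) \<Rightarrow> nat ugraph" where
  "par_graph m par = ({..m}, (\<lambda>i. {par i, i}) ` {1..m})"

text \<open>Any two of the three forms have determinant 1 or -1, so they are independent modulo
  every \<open>r\<close>, prime or not.\<close>

definition label_form :: "nat \<Rightarrow> nat \<Rightarrow> nat \<Rightarrow> nat" where
  "label_form c a b = (if c = 0 then a else if c = 1 then b else a + b)"

lemma label_form_inj:
  assumes c: "c < 3" "c' < 3" "c \<noteq> c'" and ab: "a < r" "b < r" "a' < r" "b' < r"
    and 1: "(label_form c a b + s) mod r = (label_form c a' b' + s) mod r"
    and 2: "(label_form c' a b + s') mod r = (label_form c' a' b' + s') mod r"
  shows "a = a' \<and> b = b'"
proof -
  have 1: "[label_form c a b = label_form c a' b'] (mod r)"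
    using 1 by (simp add: cong_def[symmetric] cong_add_rcancel_nat)
  have 2: "[label_form c' a b = label_form c' a' b'] (mod r)"
    using 2 by (simp add: cong_def[symmetric] cong_add_rcancel_nat)
  have c: "c = 0 \<or> c = 1 \<or> c = 2" "c' = 0 \<or> c' = 1 \<or> c' = 2" "c \<noteq> c'" using c by auto
  have *: "[a = a'] (mod r) \<and> [b = b'] (mod r)"
  proof (cases "[a = a'] (mod r)")
    case True
    then have "[a + b = a' + b'] (mod r) \<longleftrightarrow> [b = b'] (mod r)"
      by (metis cong_add cong_add_lcancel_nat cong_refl cong_sym cong_trans)
    then show ?thesis using True 1 2 c by (auto simp: label_form_def)
  next
    case False
    then have b: "[b = b'] (mod r)" "[a + b = a' + b'] (mod r)" using 1 2 c by (auto simp: label_form_def)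
    then have "[a + b = a' + b] (mod r)" by (metis cong_add_lcancel_nat cong_sym cong_trans)
    then show ?thesis using b by (simp add: cong_add_rcancel_nat)
  qed
  then show ?thesis using ab by (auto simp: cong_def)
qed

lemma label_form_surj:
  assumes c: "c < 3" "c' < 3" "c \<noteq> c'" and l: "l < r" "l' < r"
  obtains a b where "a < r" "b < r" "(label_form c a b + s) mod r = l" "(label_form c' a b + s') mod r = l'"
proof -
  let ?F = "\<lambda>(a, b). ((label_form c a b + s) mod r, (label_form c' a b + s') mod r)"
  let ?R = "{..<r} \<times> {..<r}"
  have "?F ` ?R = ?R"
  proof (rule endo_inj_surj)
    show "inj_on ?F ?R"
    proof (rule inj_onI)
      fix u v assume uv: "u \<in> ?R" "v \<in> ?R" "?F u = ?F v"
      obtain a b a' b' where [simp]: "u = (a, b)" "v = (a', b')" by (cases u, cases v)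
      show "u = v" using label_form_inj[OF c, of a r b a' b' s s'] uv by simp
    qed
    show "?F ` ?R \<subseteq> ?R" using l by auto
  qed simp
  then have "(l, l') \<in> ?F ` ?R" using l by simp
  then show ?thesis using that by auto
qed

text \<open>The residues \<open>d i\<close> and \<open>- d i\<close> are
  \<open>2 * m = p - 1\<close> distinct nonzero ones, hence all of them. The case
  \<open>i = j\<close> of \<open>add\<close> excludes zero.\<close>

lemma signed_differences_cover:
  fixes d :: "nat \<Rightarrow> int"
  assumes m: "p = 2 * m + 1"
    and add: "\<And>i j. i \<in> {1..m} \<Longrightarrow> j \<in> {1..m} \<Longrightarrow> \<not> int p dvd d i + d j"
    and diff: "\<And>i j. i \<in> {1..m} \<Longrightarrow> j \<in> {1..m} \<Longrightarrow> i \<noteq> j \<Longrightarrow> \<not> int p dvd d i - d j"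
    and e: "\<not> int p dvd e"
  obtains i where "i \<in> {1..m}" "int p dvd d i - e \<or> int p dvd d i + e"
proof -
  let ?A = "(\<lambda>i. d i mod int p) ` {1..m}" and ?B = "(\<lambda>i. (- d i) mod int p) ` {1..m}"
  have A: "card ?A = m"
  proof (subst card_image)
    show "inj_on (\<lambda>i. d i mod int p) {1..m}"
      by (rule inj_onI, rule ccontr) (use diff in \<open>auto simp: mod_eq_dvd_iff\<close>)
  qed simp
  have B: "card ?B = m"
  proof (subst card_image)
    show "inj_on (\<lambda>i. (- d i) mod int p) {1..m}"
    proof (rule inj_onI, rule ccontr)
      fix i j assume "i \<in> {1..m}" "j \<in> {1..m}" "(- d i) mod int p = (- d j) mod int p" "i \<noteq> j"
      then show False using diff[of j i] by (simp add: mod_eq_dvd_iff)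
    qed
  qed simp
  have "?A \<inter> ?B = {}"
    using add by (auto simp: mod_eq_dvd_iff)
  then have card: "card (?A \<union> ?B) = 2 * m" using A B by (simp add: card_Un_disjoint)
  have sub: "?A \<union> ?B \<subseteq> {1..<int p}"
  proof
    fix x assume "x \<in> ?A \<union> ?B"
    then obtain i where i: "i \<in> {1..m}" "x = d i mod int p \<or> x = (- d i) mod int p" by auto
    have nd: "\<not> int p dvd d i"
    proof
      assume "int p dvd d i"
      then have "int p dvd d i + d i" by simp
      then show False using add[OF i(1) i(1)] by simp
    qed
    then have "x \<noteq> 0" using i(2) by (metis dvd_eq_mod_eq_0 dvd_minus_iff)
    moreover have "0 \<le> x" "x < int p" using i(2) m by auto
    ultimately show "x \<in> {1..<int p}" by auto
  qed
  have "?A \<union> ?B = {1..<int p}"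
    using sub card m by (intro card_subset_eq) auto
  moreover have "e mod int p \<in> {1..<int p}"
  proof -
    have "e mod int p \<noteq> 0" using e by (auto simp: dvd_eq_mod_eq_0)
    moreover have "0 \<le> e mod int p" "e mod int p < int p" using m by auto
    ultimately show ?thesis by auto
  qed
  ultimately obtain i where i: "i \<in> {1..m}" "e mod int p = d i mod int p \<or> e mod int p = (- d i) mod int p"
    by blast
  have "int p dvd d i - e \<or> int p dvd d i + e"
    using i(2) by (metis add.commute diff_minus_eq_add mod_eq_dvd_iff)
  with i(1) show ?thesis by (rule that)
qed

text \<open>The copies are indexed by a translation \<open>z\<close> of the first coordinate and a pair \<open>(a, b)\<close>; a vertex of
  colour 0, 1, 2 receives the label \<open>a\<close>, \<open>b\<close> or \<open>a + b\<close>, and any two of these forms are orthogonal.\<close>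

lemma decomposes_if_labelling:
  fixes par :: "nat \<Rightarrow> nat" and f :: "nat \<Rightarrow> int" and ch s :: "nat \<Rightarrow> nat"
  assumes m: "m > 0" and p: "p = 2 * m + 1" and r: "r \<ge> 2"
    and par: "\<And>i. i \<in> {1..m} \<Longrightarrow> par i < i"
    and add: "\<And>i j. i \<in> {1..m} \<Longrightarrow> j \<in> {1..m} \<Longrightarrow> \<not> int p dvd (f i - f (par i)) + (f j - f (par j))"
    and diff: "\<And>i j. i \<in> {1..m} \<Longrightarrow> j \<in> {1..m} \<Longrightarrow> i \<noteq> j \<Longrightarrow> \<not> int p dvd (f i - f (par i)) - (f j - f (par j))"
    and ch: "\<And>i. i \<le> m \<Longrightarrow> ch i < 3" "\<And>i. i \<in> {1..m} \<Longrightarrow> ch i \<noteq> ch (par i)"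
    and s: "\<And>i. i \<le> m \<Longrightarrow> s i < 2"
    and sep: "\<And>i j. i \<le> m \<Longrightarrow> j \<le> m \<Longrightarrow> i \<noteq> j \<Longrightarrow> int p dvd f i - f j \<Longrightarrow> ch i = ch j \<and> s i \<noteq> s j"
  shows "decomposes (par_graph m par) (blowup_complete p r)"
proof -
  define pos where "pos v z = nat ((f v + int z) mod int p)" for v z
  define lab where "lab v a b = (label_form (ch v) a b + s v) mod r" for v a b
  define g where "g z a b v = (pos v z, lab v a b)" for z a b v
  define E where "E z a b = (\<lambda>i. {g z a b (par i), g z a b i}) ` {1..m}" for z a b
  define P where "P = {E z a b | z a b. z < p \<and> a < r \<and> b < r}"
  have p0: "int p > 0" using p by simp
  have nat_cong: "u = v" if "u < p" "v < p" "int p dvd int u - int v" for u v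
  proof -
    have "int u mod int p = int v mod int p" using that(3) by (simp add: mod_eq_dvd_iff)
    then show ?thesis using that(1,2) by simp
  qed
  have pos_eq: "pos v z = pos v' z' \<longleftrightarrow> int p dvd (f v + int z) - (f v' + int z')" for v v' z z'
  proof -
    have "pos v z = pos v' z' \<longleftrightarrow> (f v + int z) mod int p = (f v' + int z') mod int p"
      unfolding pos_def using p0 by (subst eq_nat_nat_iff) auto
    then show ?thesis by (simp add: mod_eq_dvd_iff)
  qed
  have pos_lt: "pos v z < p" for v z unfolding pos_def using p0 by (simp add: nat_less_iff)
  have lab_lt: "lab v a b < r" for v a b unfolding lab_def using r by simp
  have par': "par i \<le> m" "i \<le> m" if "i \<in> {1..m}" for i using par[OF that] that by auto
  have edge_pos: "pos (par i) z \<noteq> pos i z" if i: "i \<in> {1..m}" for i z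
  proof
    assume "pos (par i) z = pos i z"
    then have "int p dvd f i - f (par i)" by (simp add: pos_eq dvd_diff_commute)
    then have "int p dvd (f i - f (par i)) + (f i - f (par i))" by (intro dvd_add)
    then show False using add[OF i i] by simp
  qed
  \<comment> \<open>Vertices in the same position have the same colour and hence the same form; only
    the shifts 0 and 1 separate them, and these differ modulo \<open>r\<close> because
    \<open>r \<ge> 2\<close>.\<close>
  have g_inj: "inj_on (g z a b) {..m}" for z a b
  proof (rule inj_onI, rule ccontr)
    fix i j assume ij: "i \<in> {..m}" "j \<in> {..m}" "g z a b i = g z a b j" "i \<noteq> j"
    then have "int p dvd f i - f j" by (simp add: g_def pos_eq)
    then have chs: "ch i = ch j" "s i \<noteq> s j" using sep ij by auto
    have "[s i = s j] (mod r)"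
      using ij(3) chs(1) by (simp add: g_def lab_def cong_def[symmetric] cong_add_lcancel_nat)
    then show False using chs(2) s[of i] s[of j] ij r by (auto simp: cong_def)
  qed
  have sub: "E z a b \<subseteq> edges (blowup_complete p r)" for z a b
  proof
    fix e assume "e \<in> E z a b"
    then obtain i where i: "i \<in> {1..m}" "e = {g z a b (par i), g z a b i}" by (auto simp: E_def)
    show "e \<in> edges (blowup_complete p r)"
      unfolding blowup_complete_def snd_conv
      by (rule CollectI, rule exI[of _ "g z a b (par i)"], rule exI[of _ "g z a b i"])
         (use i edge_pos[OF i(1)] pos_lt lab_lt in \<open>simp add: g_def\<close>)
  qed
  \<comment> \<open>The signed difference determines the tree edge and its orientation, the position
    then determines \<open>z\<close>, and the labels of the two ends determine
    \<open>(a, b)\<close>.\<close>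
  have unique: "z = z' \<and> a = a' \<and> b = b'"
    if lt: "z < p" "z' < p" "a < r" "a' < r" "b < r" "b' < r"
      and i: "i \<in> {1..m}" and j: "j \<in> {1..m}"
      and eq: "{g z a b (par i), g z a b i} = {g z' a' b' (par j), g z' a' b' j}" for z z' a a' b b' i j
  proof -
    have "g z a b (par i) = g z' a' b' (par j) \<and> g z a b i = g z' a' b' j"
    proof (rule ccontr)
      assume "\<not> ?thesis"
      then have "g z a b (par i) = g z' a' b' j" "g z a b i = g z' a' b' (par j)"
        using eq by (auto simp: doubleton_eq_iff)
      then have h: "int p dvd (f (par i) + int z) - (f j + int z')" "int p dvd (f i + int z) - (f (par j) + int z')"
        by (auto simp: g_def pos_eq)
      note dvd_diff[OF h(2,1)]
      then show False using add[OF i j] by (simp add: algebra_simps)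
    qed
    then have pl: "int p dvd (f (par i) + int z) - (f (par j) + int z')" "int p dvd (f i + int z) - (f j + int z')"
      "lab (par i) a b = lab (par j) a' b'" "lab i a b = lab j a' b'"
      by (auto simp: g_def pos_eq)
    note dvd_diff[OF pl(2,1)]
    then have ij: "i = j" using diff[OF i j] by (auto simp: algebra_simps)
    then have "int p dvd int z - int z'" using pl(2) by simp
    then have "z = z'" using nat_cong lt by simp
    moreover have "a = a' \<and> b = b'"
      using label_form_inj[of "ch i" "ch (par i)" a r b a' b' "s i" "s (par i)"] pl(3,4) ij lt
        ch(1)[OF par'(1)[OF i]] ch(1)[OF par'(2)[OF i]] ch(2)[OF i] by (simp add: lab_def)
    ultimately show ?thesis by simp
  qed
  have cover_dir: "\<exists>z<p. \<exists>a<r. \<exists>b<r. g z a b (par i) = x \<and> g z a b i = x'"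
    if i: "i \<in> {1..m}" and x: "fst x < p" "snd x < r" "fst x' < p" "snd x' < r"
      and d: "int p dvd (f i - f (par i)) - (int (fst x') - int (fst x))" for i and x x' :: "nat \<times> nat"
  proof -
    define z where "z = nat ((int (fst x) - f (par i)) mod int p)"
    have z: "z < p" unfolding z_def using p0 by (simp add: nat_less_iff)
    have iz: "int z = (int (fst x) - f (par i)) mod int p" unfolding z_def using p0 by simp
    have "pos (par i) z = fst x"
    proof -
      have "(f (par i) + int z) mod int p = int (fst x) mod int p" unfolding iz by (simp add: mod_simps)
      then show ?thesis using x by (simp add: pos_def)
    qed
    moreover have "pos i z = fst x'"
    proof -
      have "(f i + int z) mod int p = (f i + (int (fst x) - f (par i))) mod int p" unfolding iz by (simp add: mod_simps)
      also have "\<dots> = int (fst x') mod int p"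
        unfolding mod_eq_dvd_iff using d by (simp add: algebra_simps)
      finally show ?thesis using x by (simp add: pos_def)
    qed
    moreover obtain a b where "a < r" "b < r" "lab (par i) a b = snd x" "lab i a b = snd x'"
      unfolding lab_def
      by (rule label_form_surj[OF ch(1)[OF par'(1)[OF i]] ch(1)[OF par'(2)[OF i]] ch(2)[OF i, symmetric] x(2,4)])
    ultimately show ?thesis using z by (intro exI[of _ z] exI[of _ a] exI[of _ b]) (auto simp: g_def prod_eq_iff)
  qed
  have cover: "\<exists>z<p. \<exists>a<r. \<exists>b<r. e \<in> E z a b" if e: "e \<in> edges (blowup_complete p r)" for e
  proof -
    obtain x x' where x: "e = {x, x'}" "fst x < p" "snd x < r" "fst x' < p" "snd x' < r" "fst x \<noteq> fst x'"
      using e by (auto simp: blowup_complete_def)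
    have "\<not> int p dvd int (fst x') - int (fst x)"
      using nat_cong[of "fst x'" "fst x"] x by auto
    from signed_differences_cover[of p m "\<lambda>i. f i - f (par i)", OF p add diff this]
    obtain i where i: "i \<in> {1..m}" and
      "int p dvd (f i - f (par i)) - (int (fst x') - int (fst x)) \<or> int p dvd (f i - f (par i)) + (int (fst x') - int (fst x))"
      by blast
    then consider "int p dvd (f i - f (par i)) - (int (fst x') - int (fst x))"
      | "int p dvd (f i - f (par i)) - (int (fst x) - int (fst x'))" by (auto simp: algebra_simps)
    then show ?thesis
    proof cases
      case 1
      from cover_dir[OF i x(2-5) this]
      obtain z a b where zab: "z < p" "a < r" "b < r" "g z a b (par i) = x" "g z a b i = x'" by blast
      then have "e \<in> E z a b" unfolding E_def using x(1) i by (intro image_eqI[of _ _ i]) auto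
      then show ?thesis using zab by blast
    next
      case 2
      from cover_dir[OF i x(4,5,2,3) this]
      obtain z a b where zab: "z < p" "a < r" "b < r" "g z a b (par i) = x'" "g z a b i = x" by blast
      then have "e \<in> E z a b" unfolding E_def using x(1) i by (intro image_eqI[of _ _ i]) auto
      then show ?thesis using zab by blast
    qed
  qed
  have part: "partition_on (edges (blowup_complete p r)) P"
  proof (rule partition_onI)
    show "\<Union>P = edges (blowup_complete p r)"
    proof
      show "\<Union>P \<subseteq> edges (blowup_complete p r)" using sub unfolding P_def by blast
      show "edges (blowup_complete p r) \<subseteq> \<Union>P"
      proof
        fix e assume "e \<in> edges (blowup_complete p r)"
        from cover[OF this] obtain z a b where "z < p" "a < r" "b < r" "e \<in> E z a b" by blast
        then show "e \<in> \<Union>P" unfolding P_def by blast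
      qed
    qed
    show "disjnt X Y" if XYP: "X \<in> P" "Y \<in> P" "X \<noteq> Y" for X Y
    proof -
      obtain z a b z' a' b' where XY: "X = E z a b" "z < p" "a < r" "b < r" "Y = E z' a' b'" "z' < p" "a' < r" "b' < r"
        using XYP(1,2) unfolding P_def by blast
      show ?thesis
      proof (rule ccontr)
        assume "\<not> disjnt X Y"
        then obtain i j where "i \<in> {1..m}" "j \<in> {1..m}"
          "{g z a b (par i), g z a b i} = {g z' a' b' (par j), g z' a' b' j}"
          unfolding XY E_def disjnt_def by blast
        then show False using unique XY that(3) by metis
      qed
    qed
    show "{} \<notin> P" using m by (auto simp: P_def E_def)
  qed
  moreover have "\<exists>S. subgraph S (blowup_complete p r) \<and> edges S = X \<and> graph_iso (par_graph m par) S" if "X \<in> P" for X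
  proof -
    obtain z a b where X: "X = E z a b" using \<open>X \<in> P\<close> unfolding P_def by blast
    let ?S = "(g z a b ` {..m}, E z a b)"
    have inj: "inj_on (g z a b) {..m}" by (rule g_inj)
    have "subgraph ?S (blowup_complete p r)"
      unfolding subgraph_def simple_graph_def
    proof (intro conjI ballI)
      fix e assume "e \<in> edges ?S"
      then obtain i where i: "i \<in> {1..m}" "e = {g z a b (par i), g z a b i}" by (auto simp: E_def)
      show "e \<subseteq> verts ?S" using i par'[OF i(1)] by auto
      show "card e = 2" using i edge_pos[OF i(1), of z] by (simp add: g_def card_insert_if)
    next
      show "verts ?S \<subseteq> verts (blowup_complete p r)"
        using pos_lt lab_lt by (auto simp: blowup_complete_def g_def)
      show "edges ?S \<subseteq> edges (blowup_complete p r)" using sub by simp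
    qed
    moreover have "graph_iso (par_graph m par) ?S"
      unfolding graph_iso_def
    proof (intro exI[of _ "g z a b"] conjI ballI)
      show "bij_betw (g z a b) (verts (par_graph m par)) (verts ?S)"
        using inj by (simp add: par_graph_def bij_betw_def)
      fix u v assume "u \<in> verts (par_graph m par)" "v \<in> verts (par_graph m par)"
      then have uv: "u \<in> {..m}" "v \<in> {..m}" by (auto simp: par_graph_def)
      have eq: "{g z a b u, g z a b v} = {g z a b (par i), g z a b i} \<longleftrightarrow> {u, v} = {par i, i}" if "i \<in> {1..m}" for i
        using inj_on_image_eq_iff[OF inj, of "{u, v}" "{par i, i}"] uv par'[OF that] by simp
      show "({u, v} \<in> edges (par_graph m par)) = ({g z a b u, g z a b v} \<in> edges ?S)"
      proof -
        have "{u, v} \<in> edges (par_graph m par) \<longleftrightarrow> (\<exists>i\<in>{1..m}. {u, v} = {par i, i})"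
          unfolding par_graph_def snd_conv image_iff by (rule refl)
        also have "\<dots> \<longleftrightarrow> (\<exists>i\<in>{1..m}. {g z a b u, g z a b v} = {g z a b (par i), g z a b i})"
          using eq by (intro bex_cong refl) simp
        also have "\<dots> \<longleftrightarrow> {g z a b u, g z a b v} \<in> edges ?S"
          unfolding E_def snd_conv image_iff by (rule refl)
        finally show ?thesis .
      qed
    qed
    ultimately show ?thesis using X by (intro exI[of _ ?S]) simp
  qed
  ultimately show ?thesis unfolding decomposes_def by (intro exI[of _ P]) simp
qed

section \<open>Embedding a tree modulo a prime\<close>

text \<open>Vertices are placed parents first. With \<open>n\<close> of them placed, at most
  \<open>n\<close> residues are occupied and at most \<open>2 * (n - 1)\<close> would repeat a
  difference up to sign. A residue is left if \<open>3 * n - 2 < p\<close>, which is the stated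
  bound for \<open>card T = n + 1\<close>.\<close>

lemma greedy_embedding:
  fixes T :: "nat set" and par :: "nat \<Rightarrow> nat"
  assumes "finite T" "0 \<in> T" and par: "\<And>i. i \<in> T - {0} \<Longrightarrow> par i \<in> T \<and> par i < i"
    and "3 * card T \<le> p + 4" "p > 1"
  shows "\<exists>f :: nat \<Rightarrow> int. (\<forall>i\<in>T. \<forall>j\<in>T. i \<noteq> j \<longrightarrow> \<not> int p dvd f i - f j) \<and>
    (\<forall>i\<in>T - {0}. \<forall>j\<in>T - {0}. i \<noteq> j \<longrightarrow> \<not> int p dvd (f i - f (par i)) - (f j - f (par j))
       \<and> \<not> int p dvd (f i - f (par i)) + (f j - f (par j)))"
  using assms
proof (induction "card T" arbitrary: T)
  case 0 then show ?case by auto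
next
  case (Suc n T)
  show ?case
  proof (cases "T = {0}")
    case True then show ?thesis by auto
  next
    case False
    define v where "v = Max T"
    define T' where "T' = T - {v}"
    have vT: "v \<in> T" unfolding v_def using Suc.prems by (intro Max_in) auto
    have vmax: "i \<le> v" if "i \<in> T" for i unfolding v_def using Suc.prems that by auto
    have v0: "v \<noteq> 0" using False vmax Suc.prems by fastforce
    have cT': "card T' = n" "finite T'" using Suc vT by (auto simp: T'_def)
    have par': "par i \<in> T' \<and> par i < i" if "i \<in> T' - {0}" for i
      using Suc.prems(3)[of i] vmax[of i] that by (auto simp: T'_def)
    have "\<exists>f :: nat \<Rightarrow> int. (\<forall>i\<in>T'. \<forall>j\<in>T'. i \<noteq> j \<longrightarrow> \<not> int p dvd f i - f j) \<and>
    (\<forall>i\<in>T' - {0}. \<forall>j\<in>T' - {0}. i \<noteq> j \<longrightarrow> \<not> int p dvd (f i - f (par i)) - (f j - f (par j))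
       \<and> \<not> int p dvd (f i - f (par i)) + (f j - f (par j)))"
      using Suc.prems cT' par' v0 Suc.hyps(2) by (intro Suc.hyps(1)) (auto simp: T'_def)
    then obtain f :: "nat \<Rightarrow> int" where f1: "\<And>i j. i \<in> T' \<Longrightarrow> j \<in> T' \<Longrightarrow> i \<noteq> j \<Longrightarrow> \<not> int p dvd f i - f j"
      and f2: "\<And>i j. i \<in> T' - {0} \<Longrightarrow> j \<in> T' - {0} \<Longrightarrow> i \<noteq> j \<Longrightarrow> \<not> int p dvd (f i - f (par i)) - (f j - f (par j))
       \<and> \<not> int p dvd (f i - f (par i)) + (f j - f (par j))" by blast
    define q where "q = par v"
    have q: "q \<in> T'" "q \<noteq> v" using Suc.prems(3)[of v] vT v0 by (auto simp: q_def T'_def)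
    define F where "F = (\<lambda>w. f w mod int p) ` T' \<union> ((\<lambda>w. (f q + (f w - f (par w))) mod int p) ` (T' - {0})
       \<union> (\<lambda>w. (f q - (f w - f (par w))) mod int p) ` (T' - {0}))"
    have "card F \<le> n + ((n - 1) + (n - 1))"
    proof -
      have "card (T' - {0}) = n - 1" using cT' Suc.prems v0 by (simp add: T'_def)
      then have "card ((\<lambda>w. (f q + (f w - f (par w))) mod int p) ` (T' - {0})) \<le> n - 1"
        "card ((\<lambda>w. (f q - (f w - f (par w))) mod int p) ` (T' - {0})) \<le> n - 1"
        by (auto intro!: order_trans[OF card_image_le] simp: cT')
      moreover have "card ((\<lambda>w. f w mod int p) ` T') \<le> n" using card_image_le[OF cT'(2)] cT' by auto
      ultimately show ?thesis unfolding F_def by (intro order_trans[OF card_Un_le] add_mono)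
    qed
    moreover have "n \<ge> 1"
    proof -
      have "0 \<in> T'" using Suc.prems v0 by (simp add: T'_def)
      then have "card T' > 0" using cT' by (auto simp: card_gt_0_iff)
      then show ?thesis using cT' by simp
    qed
    ultimately have "card F < card {0..<int p}" using Suc.prems(4) Suc.hyps(2) by simp
    moreover have "finite F" using cT' by (simp add: F_def)
    ultimately have "\<not> {0..<int p} \<subseteq> F" using card_mono[of F "{0..<int p}"] by linarith
    then obtain z where "z \<in> {0..<int p}" "z \<notin> F" by blast
    then have z: "0 \<le> z" "z < int p" "z \<notin> F" by simp_all
    have zz: "z mod int p = z" using z by simp
    have z1: "\<not> int p dvd z - f w" if "w \<in> T'" for w
    proof
      assume "int p dvd z - f w"
      then have "z = f w mod int p" using zz by (simp add: mod_eq_dvd_iff[symmetric])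
      then show False using z(3) that unfolding F_def by blast
    qed
    have z2: "\<not> int p dvd z - (f q + (f w - f (par w)))" if "w \<in> T' - {0}" for w
    proof
      assume "int p dvd z - (f q + (f w - f (par w)))"
      then have "z = (f q + (f w - f (par w))) mod int p" using zz by (simp add: mod_eq_dvd_iff[symmetric])
      then show False using z(3) that unfolding F_def by blast
    qed
    have z3: "\<not> int p dvd z - (f q - (f w - f (par w)))" if "w \<in> T' - {0}" for w
    proof
      assume "int p dvd z - (f q - (f w - f (par w)))"
      then have "z = (f q - (f w - f (par w))) mod int p" using zz by (simp add: mod_eq_dvd_iff[symmetric])
      then show False using z(3) that unfolding F_def by blast
    qed
    define f' where "f' = f(v := z)"
    have f'T: "f' w = f w" if "w \<in> T'" for w using that by (auto simp: f'_def T'_def)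
    have f'v: "f' v = z" by (simp add: f'_def)
    have f'd: "f' w - f' (par w) = f w - f (par w)" if "w \<in> T' - {0}" for w
      using f'T[of w] f'T[of "par w"] par'[OF that] that by simp
    have f'dv: "f' v - f' (par v) = z - f q" using f'T[OF q(1)] f'v by (simp add: q_def)
    have T: "T = insert v T'" using vT by (auto simp: T'_def)
    show ?thesis
    proof (intro exI[of _ f'] conjI ballI impI)
      fix i j assume ij: "i \<in> T" "j \<in> T" "i \<noteq> j"
      then consider "i \<in> T'" "j \<in> T'" | "i = v" "j \<in> T'" | "i \<in> T'" "j = v" using T by auto
      then show "\<not> int p dvd f' i - f' j"
      proof cases
        case 3 then show ?thesis using z1[of i] f'T f'v by (simp add: dvd_diff_commute)
      qed (use f'T f'v f1 z1 ij in auto)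
    next
      fix i j assume ij: "i \<in> T - {0}" "j \<in> T - {0}" "i \<noteq> j"
      then consider "i \<in> T' - {0}" "j \<in> T' - {0}" | "i = v" "j \<in> T' - {0}" | "i \<in> T' - {0}" "j = v" using T by auto
      then have *: "\<not> int p dvd f' i - f' (par i) - (f' j - f' (par j)) \<and> \<not> int p dvd f' i - f' (par i) + (f' j - f' (par j))"
      proof cases
        case 1
        then show ?thesis
          using f2[of i j] ij f'd by auto
      next
        case 2
        have "f' i - f' (par i) - (f' j - f' (par j)) = z - (f q + (f j - f (par j)))"
          "f' i - f' (par i) + (f' j - f' (par j)) = z - (f q - (f j - f (par j)))"
          using f'd[of j] f'dv 2 by auto
        then show ?thesis using z2[of j] z3[of j] 2 by simp
      next
        case 3
        have "f' i - f' (par i) - (f' j - f' (par j)) = - (z - (f q + (f i - f (par i))))"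
          "f' i - f' (par i) + (f' j - f' (par j)) = z - (f q - (f i - f (par i)))"
          using f'd[of i] f'dv 3 by auto
        then show ?thesis
          using z2[of i] z3[of i] 3 by (simp only: dvd_minus_iff) simp
      qed
      then show "\<not> int p dvd f' i - f' (par i) - (f' j - f' (par j))" "\<not> int p dvd f' i - f' (par i) + (f' j - f' (par j))" by auto
    qed
  qed
qed

text \<open>Serves both for the colours of the embedded vertices and for the bipartition of a
  tree.\<close>

lemma recursive_colouring:
  fixes ord :: "'a \<Rightarrow> nat"
  assumes "\<And>w. w \<in> H \<Longrightarrow> ord (tgt w) < ord w"
  shows "\<exists>g :: 'a \<Rightarrow> bool. \<forall>w\<in>H. g w = (if same w then g (tgt w) else \<not> g (tgt w))"
proof -
  define g where "g = wfrec (Wellfounded.measure ord) (\<lambda>h w. if w \<in> H then (if same w then h (tgt w) else \<not> h (tgt w)) else False)"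
  have "g w = (if same w then g (tgt w) else \<not> g (tgt w))" if "w \<in> H" for w
    unfolding g_def by (subst wfrec[OF wf_measure]) (use that assms[OF that] in \<open>auto simp: cut_apply\<close>)
  then show ?thesis by blast
qed

text \<open>Up to sign, a residue has at most one representative in \<open>{1..m}\<close>, so each
  \<open>w\<close> spoils at most one difference.\<close>

lemma unused_differences:
  fixes f :: "nat \<Rightarrow> int" and \<delta> :: "nat \<Rightarrow> int"
  assumes p: "p = 2 * m + 1" and W: "finite W"
  obtains D :: "int set" where "D \<subseteq> {1..int m}" "m \<le> card D + card W"
    "\<And>d w. d \<in> D \<Longrightarrow> w \<in> W \<Longrightarrow> \<not> int p dvd d - \<delta> w \<and> \<not> int p dvd d + \<delta> w"
proof -
  define D where "D = {d \<in> {1..int m}. \<forall>w\<in>W. \<not> int p dvd d - \<delta> w \<and> \<not> int p dvd d + \<delta> w}"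
  define h where "h d = (SOME w. w \<in> W \<and> (int p dvd d - \<delta> w \<or> int p dvd d + \<delta> w))" for d
  have h: "h d \<in> W \<and> (int p dvd d - \<delta> (h d) \<or> int p dvd d + \<delta> (h d))" if "d \<in> {1..int m} - D" for d
    unfolding h_def by (rule someI_ex) (use that in \<open>auto simp: D_def\<close>)
  have "inj_on h ({1..int m} - D)"
  proof (rule inj_onI)
    fix d e assume d: "d \<in> {1..int m} - D" and e: "e \<in> {1..int m} - D" and eq: "h d = h e"
    consider "int p dvd d - \<delta> (h d)" "int p dvd e - \<delta> (h d)" | "int p dvd d - \<delta> (h d)" "int p dvd e + \<delta> (h d)"
      | "int p dvd d + \<delta> (h d)" "int p dvd e - \<delta> (h d)" | "int p dvd d + \<delta> (h d)" "int p dvd e + \<delta> (h d)"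
      using h[OF d] h[OF e] eq by auto
    then have "int p dvd d - e \<or> int p dvd d + e"
    proof cases
      case 1 then show ?thesis using dvd_diff[of "int p" "d - \<delta> (h d)" "e - \<delta> (h d)"] by simp
    next
      case 2 then show ?thesis using dvd_add[of "int p" "d - \<delta> (h d)" "e + \<delta> (h d)"] by simp
    next
      case 3 then show ?thesis using dvd_add[of "int p" "d + \<delta> (h d)" "e - \<delta> (h d)"] by simp
    next
      case 4 then show ?thesis using dvd_diff[of "int p" "d + \<delta> (h d)" "e + \<delta> (h d)"] by simp
    qed
    then show "d = e"
    proof
      assume "int p dvd d - e"
      moreover have "\<bar>d - e\<bar> < int p" using d e p by auto
      ultimately show "d = e" using zdvd_imp_le[of "int p" "\<bar>d - e\<bar>"] by auto
    next
      assume "int p dvd d + e"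
      then have "int p \<le> d + e" using d e by (intro zdvd_imp_le) auto
      then show "d = e" using d e p by auto
    qed
  qed
  then have "card ({1..int m} - D) \<le> card W" using h W by (intro card_inj_on_le[of h]) auto
  moreover have "card ({1..int m} - D) = m - card D"
    by (subst card_Diff_subset) (auto simp: D_def intro: finite_subset[of _ "{1..int m}"])
  ultimately have "m \<le> card D + card W" by linarith
  then show ?thesis by (intro that[of D]) (auto simp: D_def)
qed

text \<open>The set \<open>T\<close> is embedded greedily; then \<open>Y\<close>, \<open>LA\<close>, \<open>LB\<close> and the children of \<open>Y\<close> are placed in this order.
  Vertices of \<open>T\<close> with \<open>side\<close> get colour 1. The others get 0 or 2, chosen recursively:
  a vertex on which a child of \<open>u \<in> T\<close> lands gets a colour different from that of \<open>u\<close>, and one on which the child of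
  \<open>x \<in> Y\<close> lands gets the colour of \<open>par x\<close>, which differs from the colour of \<open>x\<close>.\<close>

lemma tree_decomposes:
  fixes par child :: "nat \<Rightarrow> nat" and side :: "nat \<Rightarrow> bool" and T Y LA LB :: "nat set"
  assumes p: "p = 2 * m + 1" "prime p" and m: "m > 0" and r2: "q \<ge> 2"
    and par: "\<And>i. i \<in> {1..m} \<Longrightarrow> par i < i"
    and T: "T \<subseteq> {..m}" "0 \<in> T"
    and cover: "{..m} - T = Y \<union> LA \<union> LB \<union> child ` Y"
    and disj: "Y \<inter> LA = {}" "(Y \<union> LA) \<inter> LB = {}" "(Y \<union> LA \<union> LB) \<inter> child ` Y = {}"
    and child: "\<And>x. x \<in> Y \<Longrightarrow> par (child x) = x"
    and parT: "\<And>i. i \<in> T - {0} \<Longrightarrow> par i \<in> T \<and> side (par i) \<noteq> side i"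
    and parA: "\<And>i. i \<in> Y \<union> LA \<Longrightarrow> par i \<in> T \<and> \<not> side (par i)"
    and parB: "\<And>i. i \<in> LB \<Longrightarrow> par i \<in> T \<and> side (par i)"
    and cnt: "card {i \<in> T. side i} \<le> card Y + card LA + 1"
      "card {i \<in> T. side i} + card Y \<le> card LA + card LB + 1"
      "3 * card T \<le> p + 4"
  shows "decomposes (par_graph m par) (blowup_complete p q)"
proof -
  define y where "y = card Y"
  define kA where "kA = card LA"
  define kB where "kB = card LB"
  define n where "n = y + kA + kB"
  define K where "K = n + y"
  define Bp where "Bp = {i \<in> T. side i}"
  have sub: "Y \<subseteq> {..m}" "LA \<subseteq> {..m}" "LB \<subseteq> {..m}" "child ` Y \<subseteq> {..m}" using cover by blast+
  have fin: "finite T" "finite Y" "finite LA" "finite LB" "finite Bp"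
    using T sub by (auto intro: finite_subset simp: Bp_def)
  have injc: "inj_on child Y" by (rule inj_onI) (metis child)
  have cardK: "card ({..m} - T) = K"
  proof -
    have "card ({..m} - T) = card (Y \<union> LA \<union> LB) + card (child ` Y)"
      unfolding cover using disj fin by (intro card_Un_disjoint) auto
    also have "card (Y \<union> LA \<union> LB) = card (Y \<union> LA) + card LB" using disj fin by (intro card_Un_disjoint) auto
    also have "card (Y \<union> LA) = card Y + card LA" using disj fin by (intro card_Un_disjoint) auto
    finally show ?thesis using card_image[OF injc] by (simp add: K_def n_def y_def kA_def kB_def)
  qed
  have cardT: "card T + K = m + 1"
    using cardK card_Diff_subset[OF fin(1) T(1)] card_mono[OF _ T(1)] by simp
  have p0: "int p > 0" "p > 2" using p m by auto
  have no2: "\<not> int p dvd a + a" if "\<not> int p dvd a" for a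
  proof
    assume "int p dvd a + a"
    then have "int p dvd 2 * a" by (simp only: mult_2)
    then have "int p dvd 2 \<or> int p dvd a" using p(2) by (simp add: prime_dvd_mult_iff)
    then show False using that zdvd_imp_le[of "int p" 2] p0 by auto
  qed
  obtain f :: "nat \<Rightarrow> int" where f: "\<And>i j. i \<in> T \<Longrightarrow> j \<in> T \<Longrightarrow> i \<noteq> j \<Longrightarrow> \<not> int p dvd f i - f j"
    and fd: "\<And>i j. i \<in> T - {0} \<Longrightarrow> j \<in> T - {0} \<Longrightarrow> i \<noteq> j \<Longrightarrow> \<not> int p dvd (f i - f (par i)) - (f j - f (par j))
       \<and> \<not> int p dvd (f i - f (par i)) + (f j - f (par j))"
  proof -
    have "1 < p" using p0 by simp
    have "\<exists>f :: nat \<Rightarrow> int. (\<forall>i\<in>T. \<forall>j\<in>T. i \<noteq> j \<longrightarrow> \<not> int p dvd f i - f j) \<and>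
      (\<forall>i\<in>T - {0}. \<forall>j\<in>T - {0}. i \<noteq> j \<longrightarrow> \<not> int p dvd (f i - f (par i)) - (f j - f (par j))
       \<and> \<not> int p dvd (f i - f (par i)) + (f j - f (par j)))"
    proof (rule greedy_embedding[OF fin(1) T(2) _ cnt(3) \<open>1 < p\<close>])
      show "par i \<in> T \<and> par i < i" if "i \<in> T - {0}" for i using parT[OF that] par[of i] that T by auto
    qed
    then obtain f :: "nat \<Rightarrow> int" where f: "\<forall>i\<in>T. \<forall>j\<in>T. i \<noteq> j \<longrightarrow> \<not> int p dvd f i - f j"
      "\<forall>i\<in>T - {0}. \<forall>j\<in>T - {0}. i \<noteq> j \<longrightarrow> \<not> int p dvd (f i - f (par i)) - (f j - f (par j))
       \<and> \<not> int p dvd (f i - f (par i)) + (f j - f (par j))" by (elim exE conjE)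
    show ?thesis by (rule that[of f]) (use f in blast)+
  qed
  have par_ne: "par i \<noteq> i" if "i \<in> T - {0}" for i using parT[OF that] by auto
  define \<delta> where "\<delta> w = f w - f (par w)" for w
  obtain D0 :: "int set" where D0: "D0 \<subseteq> {1..int m}" "m \<le> card D0 + card (T - {0})"
    "\<And>d w. d \<in> D0 \<Longrightarrow> w \<in> T - {0} \<Longrightarrow> \<not> int p dvd d - \<delta> w \<and> \<not> int p dvd d + \<delta> w"
    using unused_differences[OF p(1), of "T - {0}" \<delta>] fin by auto
  have "card (T - {0}) = card T - 1" using T(2) fin by simp
  moreover have "card T \<ge> 1" using T(2) fin by (metis One_nat_def Suc_leI card_gt_0_iff empty_iff)
  ultimately have "K \<le> card D0" using D0(2) cardT by linarith
  then obtain D where D: "D \<subseteq> D0" "card D = K" "finite D" by (meson obtain_subset_with_card_n)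
  have Dm: "d \<in> {1..int m}" if "d \<in> D" for d using D D0 that by auto
  define G where "G = D \<union> uminus ` D"
  have Gm: "a \<noteq> 0 \<and> \<bar>a\<bar> \<le> int m" if "a \<in> G" for a using that Dm by (fastforce simp: G_def)
  have Gnd: "\<not> int p dvd a" if "a \<in> G" for a
    using Gm[OF that] p(1) zdvd_imp_le[of "int p" "\<bar>a\<bar>"] by auto
  have cardG: "card G = 2 * K"
  proof -
    have "D \<inter> uminus ` D = {}" using Dm by (auto dest!: Dm)
    then show ?thesis unfolding G_def using D by (simp add: card_Un_disjoint card_image inj_on_def)
  qed
  have injG: "a = b" if "a \<in> G" "b \<in> G" "int p dvd a - b" for a b
  proof (rule ccontr)
    assume "a \<noteq> b"
    then have "int p \<le> \<bar>a - b\<bar>" using that(3) by (intro zdvd_imp_le) auto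
    then show False using Gm[OF that(1)] Gm[OF that(2)] p(1) by linarith
  qed
  have Gd: "\<not> int p dvd a - \<delta> w \<and> \<not> int p dvd a + \<delta> w" if a: "a \<in> G" and w: "w \<in> T - {0}" for a w
  proof -
    consider "a \<in> D" | "- a \<in> D" using a by (auto simp: G_def)
    then show ?thesis
    proof cases
      case 1 then show ?thesis using D0(3)[of a w] D w by auto
    next
      case 2
      then have "\<not> int p dvd - a - \<delta> w \<and> \<not> int p dvd - a + \<delta> w" using D0(3)[of "- a" w] D w by auto
      moreover have "- a - \<delta> w = - (a + \<delta> w)" "- a + \<delta> w = - (a - \<delta> w)" by auto
      ultimately show ?thesis by (simp only: dvd_minus_iff) simp
    qed
  qed
  obtain hY where hY: "bij_betw hY {0..<y} Y" using ex_bij_betw_nat_finite[OF fin(2)] by (auto simp: y_def)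
  obtain hA where hA: "bij_betw hA {0..<kA} LA" using ex_bij_betw_nat_finite[OF fin(3)] by (auto simp: kA_def)
  obtain hB where hB: "bij_betw hB {0..<kB} LB" using ex_bij_betw_nat_finite[OF fin(4)] by (auto simp: kB_def)
  \<comment> \<open>The rank bounds how many images a vertex can be kept away from, so those with
    more images to avoid come later. A child of \<open>Y\<close> sits exactly \<open>n\<close>
    places after its parent.\<close>
  define v where "v i = (if i < y then hY i else if i < y + kA then hA (i - y)
      else if i < n then hB (i - (y + kA)) else child (hY (i - n)))" for i
  have vY: "v i \<in> Y" if "i < y" for i using hY that by (auto simp: v_def bij_betw_def)
  have vA: "v i \<in> LA" if "y \<le> i" "i < y + kA" for i using hA that by (auto simp: v_def bij_betw_def)
  have vB: "v i \<in> LB" if "y + kA \<le> i" "i < n" for i using hB that by (auto simp: v_def bij_betw_def n_def)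
  have vC: "v i = child (v (i - n))" "i - n < y" if "n \<le> i" "i < K" for i
    using that by (auto simp: v_def n_def K_def)
  have vpar: "par (v i) = v (i - n)" if "n \<le> i" "i < K" for i
    using vC[OF that] vY[of "i - n"] child by simp
  have vimg: "v ` {..<K} = {..m} - T"
  proof
    show "v ` {..<K} \<subseteq> {..m} - T"
    proof
      fix w assume "w \<in> v ` {..<K}"
      then obtain i where i: "i < K" "w = v i" by auto
      consider "i < y" | "y \<le> i" "i < y + kA" | "y + kA \<le> i" "i < n" | "n \<le> i" by linarith
      then have "w \<in> Y \<union> LA \<union> LB \<union> child ` Y"
        by cases (use i vY vA vB vC in auto)
      then show "w \<in> {..m} - T" using cover by simp
    qed
    show "{..m} - T \<subseteq> v ` {..<K}"
      unfolding cover
    proof (intro Un_least subsetI)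
      fix w assume "w \<in> Y"
      then obtain i where "i < y" "w = hY i" using hY by (auto simp: bij_betw_def)
      then show "w \<in> v ` {..<K}" by (intro image_eqI[of _ _ i]) (auto simp: v_def K_def n_def)
    next
      fix w assume "w \<in> LA"
      then obtain i where "i < kA" "w = hA i" using hA by (auto simp: bij_betw_def)
      then show "w \<in> v ` {..<K}" by (intro image_eqI[of _ _ "y + i"]) (auto simp: v_def K_def n_def)
    next
      fix w assume "w \<in> LB"
      then obtain i where "i < kB" "w = hB i" using hB by (auto simp: bij_betw_def)
      then show "w \<in> v ` {..<K}" by (intro image_eqI[of _ _ "y + kA + i"]) (auto simp: v_def K_def n_def)
    next
      fix w assume "w \<in> child ` Y"
      then obtain i where "i < y" "w = child (hY i)" using hY by (auto simp: bij_betw_def)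
      then show "w \<in> v ` {..<K}" by (intro image_eqI[of _ _ "n + i"]) (auto simp: v_def K_def n_def)
    qed
  qed
  have vinj: "inj_on v {..<K}"
    by (rule eq_card_imp_inj_on) (use vimg cardK in auto)
  have vparA: "par (v i) \<in> T \<and> \<not> side (par (v i))" if "i < y + kA" for i
    using parA[of "v i"] vY[of i] vA[of i] that by (cases "i < y") auto
  have vparB: "par (v i) \<in> T \<and> side (par (v i))" if "y + kA \<le> i" "i < n" for i
    using parB vB[OF that] by auto
  define PA where "PA = (\<lambda>i. par (v i)) ` {..<y + kA}"
  define first where "first u = (LEAST i. i < y + kA \<and> par (v i) = u)" for u
  have first: "first u < y + kA \<and> par (v (first u)) = u" if "u \<in> PA" for u
    unfolding first_def by (rule LeastI_ex) (use that in \<open>auto simp: PA_def\<close>)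
  have first_le: "first (par (v i)) \<le> i" if "i < y + kA" for i
    unfolding first_def using that by (intro Least_le) auto
  have first_inj: "u = u'" if "u \<in> PA" "u' \<in> PA" "first u = first u'" for u u'
    using first[OF that(1)] first[OF that(2)] that(3) by metis
  \<comment> \<open>When vertex \<open>i\<close> lands on some \<open>w\<close> in
    \<open>PA\<close>, the colour of \<open>w\<close> is derived from that of
    \<open>par (v i)\<close>. Keeping off the parents that occur earlier makes this dependence
    well-founded, and there are at most \<open>i\<close> of them.\<close>
  define Ear where "Ear i = {u \<in> PA. first u < first (par (v i))}" for i
  have Ear: "finite (Ear i) \<and> card (Ear i) \<le> i" if "i < y + kA" for i
  proof -
    have "card (Ear i) \<le> card {..<first (par (v i))}"
      by (rule card_inj_on_le[of first]) (auto simp: Ear_def inj_on_def intro: first_inj)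
    then show ?thesis using first_le[OF that] by (auto simp: Ear_def PA_def)
  qed
  \<comment> \<open>A leaf in \<open>LB\<close> has a parent of colour 1 and must avoid that colour.
    So must a child of \<open>Y\<close>, whose parent may have colour 1; it also avoids what its
    parent avoids, because its colour will be derived from its grandparent.\<close>
  define bs where "bs i = (if i < y + kA then Ear i else if i < n then Bp else Bp \<union> Ear (i - n))" for i
  define B where "B i = f ` bs i" for i
  have cBp: "card Bp \<le> y + kA + 1" "card Bp + y \<le> kA + kB + 1"
    using cnt by (auto simp: Bp_def y_def kA_def kB_def)
  have cardb: "card (B i) \<le> card (bs i)" for i
    unfolding B_def bs_def using fin Ear by (intro card_image_le) (auto simp: Ear_def PA_def)
  have bsC: "finite (bs i) \<and> card (bs i) \<le> card Bp + (i - n)" if "n \<le> i" "i < K" for i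
  proof -
    have "i - n < y + kA" using vC(2)[OF that] by simp
    then show ?thesis
      using Ear[of "i - n"] card_Un_le[of Bp "Ear (i - n)"] fin that by (auto simp: bs_def n_def)
  qed
  have Bsmall: "finite (B i) \<and> card (B i) \<le> i + 1" if i: "i < K" for i
  proof -
    consider "i < y + kA" | "y + kA \<le> i" "i < n" | "n \<le> i" by linarith
    then have "finite (bs i) \<and> card (bs i) \<le> i + 1"
    proof cases
      case 1 then show ?thesis using Ear[OF 1] by (auto simp: bs_def)
    next
      case 2 then show ?thesis using fin cBp by (auto simp: bs_def)
    next
      case 3 then show ?thesis using bsC[OF 3 i] vC(2)[OF 3 i] cBp by (auto simp: n_def)
    qed
    then show ?thesis using cardb[of i] by (auto simp: B_def)
  qed
  \<comment> \<open>For the last index \<open>i = y - 1\<close> this amounts to the second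
    inequality in \<open>cnt\<close>; the first inequality is what \<open>Bsmall\<close> needs at
    the lowest rank \<open>y + kA\<close> of \<open>LB\<close>.\<close>
  have gap: "2 * i + 1 + card (B (K - y + i)) \<le> K - y + i" if i: "i < y" for i
  proof -
    have "card (B (n + i)) \<le> card Bp + i" using cardb[of "n + i"] bsC[of "n + i"] i by (auto simp: K_def)
    moreover have "2 * i + 1 + card Bp \<le> n" using cBp i by (auto simp: n_def)
    ultimately show ?thesis by (simp add: K_def)
  qed
  \<comment> \<open>For a child of \<open>Y\<close> the known position is that of its grandparent;
    the variable of its parent enters through \<open>L\<close>.\<close>
  define c where "c i = (if i < n then f (par (v i)) else f (par (v (i - n))))" for i
  have y2: "2 * y \<le> K" by (simp add: K_def n_def)
  obtain x :: "nat \<Rightarrow> int" where xG: "\<And>i. i < K \<Longrightarrow> x i \<in> G"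
    and xsq: "\<And>i j. j < i \<Longrightarrow> i < K \<Longrightarrow> \<not> int p dvd (x i)\<^sup>2 - (x j)\<^sup>2"
    and xL: "\<And>i j. j < i \<Longrightarrow> i < K \<Longrightarrow> \<not> int p dvd (c i + x i + (if i < K - y then 0 else x (i - (K - y))))
           - (c j + x j + (if j < K - y then 0 else x (j - (K - y))))"
    and xB: "\<And>i \<beta>. i < K \<Longrightarrow> \<beta> \<in> B i \<Longrightarrow> \<not> int p dvd c i + x i + (if i < K - y then 0 else x (i - (K - y))) - \<beta>"
    using signed_assignment[where c = c and B = B, OF p(2) cardG injG y2 Bsmall gap] by blast
  define L where "L i = c i + x i + (if i < n then 0 else x (i - n))" for i
  have nK: "K - y = n" by (simp add: K_def)
  note xL = xL[unfolded nK, folded L_def] and xB = xB[unfolded nK, folded L_def]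
  have xpm: "\<not> int p dvd x i - x j \<and> \<not> int p dvd x i + x j" if "i < K" "j < K" "i \<noteq> j" for i j
  proof -
    have e: "(x i)\<^sup>2 - (x j)\<^sup>2 = (x i - x j) * (x i + x j)" by (simp add: power2_eq_square algebra_simps)
    have "\<not> int p dvd (x i)\<^sup>2 - (x j)\<^sup>2"
    proof (cases "j < i")
      case False
      then show ?thesis using xsq[of i j] that dvd_diff_commute[of "int p" "(x i)\<^sup>2" "(x j)\<^sup>2"] by auto
    qed (use xsq that in auto)
    then show ?thesis unfolding e by auto
  qed
  have Lne: "\<not> int p dvd L i - L j" if "i < K" "j < K" "i \<noteq> j" for i j
  proof (cases "j < i")
    case False
    then show ?thesis using xL[of i j] that dvd_diff_commute[of "int p" "L i" "L j"] by auto
  qed (use xL that in auto)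
  have Lbs: "w \<notin> bs i" if "i < K" "int p dvd L i - f w" for i w
    using xB[OF that(1), of "f w"] that(2) by (auto simp: B_def)
  define idx where "idx = the_inv_into {..<K} v"
  have idx: "idx w < K \<and> v (idx w) = w" if "w \<in> {..m} - T" for w
    using the_inv_into_into[OF vinj, of w "{..<K}"] f_the_inv_into_f[OF vinj, of w] that vimg
    by (simp add: idx_def)
  have idxv: "idx (v i) = i" if "i < K" for i using vinj that by (simp add: idx_def the_inv_into_f_f)
  define F where "F w = (if w \<in> T then f w else L (idx w))" for w
  have vT: "v i \<notin> T" "v i \<le> m" if "i < K" for i using vimg that by blast+
  have Fv: "F (v i) = L i" if "i < K" for i using vT[OF that] idxv[OF that] by (simp add: F_def)
  have Fdv: "F (v i) - F (par (v i)) = x i" if i: "i < K" for i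
  proof (cases "i < n")
    case True
    then have "par (v i) \<in> T" using vparA[of i] vparB[of i] by (cases "i < y + kA") auto
    then show ?thesis using Fv[OF i] True by (simp add: F_def L_def c_def)
  next
    case False
    then have *: "n \<le> i" by simp
    have "i - n < K" "i - n < n" using vC(2)[OF * i] by (auto simp: K_def n_def)
    then show ?thesis using Fv[OF i] Fv[of "i - n"] vpar[OF * i] False by (simp add: L_def c_def)
  qed
  have FdT: "F w - F (par w) = \<delta> w" if "w \<in> T - {0}" for w
    using that parT[OF that] by (simp add: F_def \<delta>_def)
  have split: "(w \<in> T - {0}) \<or> (\<exists>i<K. w = v i)" if "w \<in> {1..m}" for w
    using that vimg by (auto simp: image_iff Bex_def)
  \<comment> \<open>vertices of \<open>T\<close> on which a leaf lands that would need the colour of its parent\<close>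
  define H where "H = {w \<in> T. \<not> side w \<and> (\<exists>i<K. (i < y + kA \<or> n \<le> i) \<and> int p dvd L i - f w)}"
  define hit where "hit w = (SOME i. i < K \<and> (i < y + kA \<or> n \<le> i) \<and> int p dvd L i - f w)" for w
  have hit: "hit w < K \<and> (hit w < y + kA \<or> n \<le> hit w) \<and> int p dvd L (hit w) - f w" if "w \<in> H" for w
    unfolding hit_def by (rule someI_ex) (use that in \<open>auto simp: H_def\<close>)
  have hit_unique: "hit w = i" if "w \<in> H" "i < K" "int p dvd L i - f w" for w i
  proof (rule ccontr)
    assume "hit w \<noteq> i"
    moreover have "int p dvd (L (hit w) - f w) - (L i - f w)" using dvd_diff hit[OF that(1)] that(3) by blast
    ultimately show False using Lne[of "hit w" i] hit[OF that(1)] that by auto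
  qed
  define tgt where "tgt w = (if hit w < y + kA then par (v (hit w)) else par (v (hit w - n)))" for w
  \<comment> \<open>Targets always lie in \<open>PA\<close>, so everything outside \<open>PA\<close>
    can be put on top.\<close>
  define ord where "ord w = (if w \<in> PA then first w else y + kA)" for w
  \<comment> \<open>A vertex never lands on its own target: its distance from there is
    \<open>x i\<close>, or \<open>x i + x (i - n)\<close> for a child of \<open>Y\<close>, and
    neither is 0 modulo \<open>p\<close>. So avoiding \<open>Ear\<close> makes the descent
    strict.\<close>
  have tgt: "ord (tgt w) < ord w" if w: "w \<in> H" for w
  proof -
    obtain j where j: "j < y + kA" "tgt w = par (v j)" "\<not> int p dvd L (hit w) - f (tgt w)"
      "w \<in> PA \<Longrightarrow> w \<notin> Ear j"
    proof (cases "hit w < y + kA")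
      case True
      have "hit w < K" "hit w < n" using hit[OF w] True by (auto simp: n_def)
      have "L (hit w) - f (tgt w) = x (hit w)" using True \<open>hit w < n\<close> by (simp add: L_def c_def tgt_def)
      then have "\<not> int p dvd L (hit w) - f (tgt w)" using Gnd xG \<open>hit w < K\<close> by simp
      moreover have "w \<notin> Ear (hit w)" using Lbs[of "hit w" w] hit[OF w] True by (auto simp: bs_def)
      ultimately show ?thesis using that[of "hit w"] True by (auto simp: tgt_def)
    next
      case False
      then have h: "n \<le> hit w" "hit w < K" using hit[OF w] by auto
      have hn: "hit w - n < y" "hit w - n < K" "hit w - n \<noteq> hit w"
        using vC(2)[OF h] h by (auto simp: K_def n_def)
      have "L (hit w) - f (tgt w) = x (hit w) + x (hit w - n)" using False h by (simp add: L_def c_def tgt_def)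
      then have "\<not> int p dvd L (hit w) - f (tgt w)" using xpm[of "hit w" "hit w - n"] h hn by simp
      moreover have "w \<notin> Ear (hit w - n)" using Lbs[of "hit w" w] hit[OF w] False h by (auto simp: bs_def n_def)
      ultimately show ?thesis using that[of "hit w - n"] hn False by (auto simp: tgt_def)
    qed
    have tPA: "tgt w \<in> PA" using j by (auto simp: PA_def)
    have "w \<noteq> tgt w" using j(3) hit[OF w] by auto
    then show ?thesis
      using j(2,4) tPA first[OF tPA] first_inj[of w "tgt w"] by (fastforce simp: ord_def Ear_def)
  qed
  obtain g :: "nat \<Rightarrow> bool" where g: "\<And>w. w \<in> H \<Longrightarrow> g w = (if n \<le> hit w then g (tgt w) else \<not> g (tgt w))"
    using recursive_colouring[of H ord tgt "\<lambda>w. n \<le> hit w"] tgt by blast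
  define cT where "cT w = (if side w then 1 else if g w then 2 else (0::nat))" for w
  define cl where "cl i d = (if \<exists>w\<in>T. int p dvd L i - f w then cT (SOME w. w \<in> T \<and> int p dvd L i - f w) else d)" for i and d :: nat
  have cl_hit: "cl i d = cT w" if "w \<in> T" "int p dvd L i - f w" for i d w
  proof -
    define w' where "w' = (SOME w. w \<in> T \<and> int p dvd L i - f w)"
    have w': "w' \<in> T \<and> int p dvd L i - f w'" unfolding w'_def by (rule someI_ex) (use that in auto)
    then have "int p dvd (L i - f w') - (L i - f w)" using that dvd_diff by blast
    then have "int p dvd f w - f w'" by simp
    then have "w' = w" using f[OF that(1), of w'] w' by auto
    then show ?thesis using that by (auto simp: cl_def w'_def)
  qed
  have cl_cases: "(\<exists>w\<in>T. int p dvd L i - f w \<and> cl i d = cT w) \<or> (\<not> (\<exists>w\<in>T. int p dvd L i - f w) \<and> cl i d = d)" for i d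
  proof (cases "\<exists>w\<in>T. int p dvd L i - f w")
    case True then show ?thesis using cl_hit by blast
  qed (simp add: cl_def)
  have cl3: "cl i d < 3" if "d < 3" for i d using cl_cases[of i d] that by (auto simp: cT_def)
  \<comment> \<open>The defaults are for vertices that meet no vertex of \<open>T\<close>: 1 is free
    below a parent of colour 0 or 2, 0 is free below a parent of colour 1, and a child of
    \<open>Y\<close> only has to differ from its parent.\<close>
  define cv where "cv i = (if i < y + kA then cl i 1 else if i < n then cl i 0
     else cl i (if cl (i - n) 1 = 0 then 1 else 0))" for i
  define ch where "ch w = (if w \<in> T then cT w else cv (idx w))" for w
  have chv: "ch (v i) = cv i" if "i < K" for i using vT[OF that] idxv[OF that] by (simp add: ch_def)
  have prop_v: "cv i \<noteq> ch (par (v i))" if i: "i < K" for i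
  proof -
    consider "i < y + kA" | "y + kA \<le> i" "i < n" | "n \<le> i" by linarith
    then show ?thesis
    proof cases
      case 1
      define u where "u = par (v i)"
      have u: "u \<in> T" "\<not> side u" using vparA[OF 1] by (auto simp: u_def)
      have chu: "ch u = (if g u then 2 else 0)" using u by (simp add: ch_def cT_def)
      from cl_cases[of i 1] show ?thesis
      proof
        assume "\<exists>w\<in>T. int p dvd L i - f w \<and> cl i 1 = cT w"
        then obtain w where w: "w \<in> T" "int p dvd L i - f w" "cl i 1 = cT w" by blast
        show ?thesis
        proof (cases "side w")
          case True then show ?thesis using w chu 1 by (simp add: cv_def cT_def u_def)
        next
          case False
          then have wH: "w \<in> H" using w 1 i by (auto simp: H_def)
          then have "hit w = i" using hit_unique w i by simp
          moreover have "\<not> n \<le> i" using 1 by (simp add: n_def)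
          ultimately have "g w = (\<not> g u)" using g[OF wH] 1 by (simp add: tgt_def u_def)
          then show ?thesis using w chu 1 False by (simp add: cv_def cT_def u_def)
        qed
      qed (use 1 chu in \<open>auto simp: cv_def u_def\<close>)
    next
      case 2
      have chu: "ch (par (v i)) = 1" using vparB[OF 2] by (simp add: ch_def cT_def)
      have "\<not> side w" if "w \<in> T" "int p dvd L i - f w" for w
        using Lbs[OF i that(2)] 2 that by (auto simp: bs_def Bp_def)
      then show ?thesis using cl_cases[of i 0] chu 2 by (auto simp: cv_def cT_def split: if_splits)
    next
      case 3
      define j where "j = i - n"
      have j: "j < y" "j < K" "par (v i) = v j" using vC(2)[OF 3 i] vpar[OF 3 i] by (auto simp: j_def K_def)
      define u where "u = par (v j)"
      have chx: "ch (par (v i)) = cl j 1" using chv[OF j(2)] j by (simp add: cv_def)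
      have u: "u \<in> T" "\<not> side u" using vparA[of j] j by (auto simp: u_def)
      have cvi: "cv i = cl i (if cl j 1 = 0 then 1 else 0)" using 3 by (simp add: cv_def j_def n_def)
      from cl_cases[of i "if cl j 1 = 0 then 1 else 0"] show ?thesis
      proof
        assume "\<exists>w\<in>T. int p dvd L i - f w \<and> cl i (if cl j 1 = 0 then 1 else 0) = cT w"
        then obtain w where w: "w \<in> T" "int p dvd L i - f w" "cv i = cT w" using cvi by auto
        have nw: "\<not> side w" using Lbs[OF i w(2)] 3 w(1) by (auto simp: bs_def Bp_def n_def)
        then have wH: "w \<in> H" using w 3 i by (auto simp: H_def)
        then have hw: "hit w = i" using hit_unique w i by simp
        have gw: "g w = g u" using g[OF wH] hw 3 by (auto simp: tgt_def u_def j_def n_def)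
        from cl_cases[of j 1] show ?thesis
        proof
          assume "\<exists>w\<in>T. int p dvd L j - f w \<and> cl j 1 = cT w"
          then obtain w1 where w1: "w1 \<in> T" "int p dvd L j - f w1" "cl j 1 = cT w1" by blast
          show ?thesis
          proof (cases "side w1")
            case True then show ?thesis using w w1 nw chx by (simp add: cT_def)
          next
            case False
            then have w1H: "w1 \<in> H" using w1 j by (auto simp: H_def)
            then have "hit w1 = j" using hit_unique w1 j by simp
            moreover have "\<not> n \<le> j" using j by (simp add: n_def)
            ultimately have "g w1 = (\<not> g u)" using g[OF w1H] j by (simp add: tgt_def u_def)
            then show ?thesis using w w1 nw chx gw False by (simp add: cT_def)
          qed
        qed (use w nw chx in \<open>auto simp: cT_def\<close>)
      qed (use cvi chx in \<open>auto split: if_splits\<close>)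
    qed
  qed
  have notcong: "\<not> int p dvd \<delta> w" if "w \<in> T - {0}" for w
    using f[of w "par w"] parT[OF that] par_ne[OF that] that by (auto simp: \<delta>_def)
  show ?thesis
  \<comment> \<open>Both \<open>f\<close> on \<open>T\<close> and \<open>L\<close> are injective
    modulo \<open>p\<close>, so two vertices with the same image are one inside and one outside
    \<open>T\<close>; membership in \<open>T\<close> can serve as the shift.\<close>
  proof (rule decomposes_if_labelling[OF m p(1) r2 par, of F ch "\<lambda>w. if w \<in> T then 0 else 1"])
    fix i j assume ij: "i \<in> {1..m}" "j \<in> {1..m}"
    show "\<not> int p dvd F i - F (par i) + (F j - F (par j))"
    proof -
      from split[OF ij(1)] split[OF ij(2)]
      consider "i \<in> T - {0}" "j \<in> T - {0}" | i' where "i' < K" "i = v i'" "j \<in> T - {0}"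
        | j' where "i \<in> T - {0}" "j' < K" "j = v j'" | i' j' where "i' < K" "i = v i'" "j' < K" "j = v j'"
        by blast
      then show ?thesis
      proof cases
        case 1
        show ?thesis
        proof (cases "i = j")
          case True then show ?thesis using no2[OF notcong[OF 1(1)]] FdT[OF 1(1)] by simp
        next
          case False then show ?thesis using fd[OF 1 False] FdT[OF 1(1)] FdT[OF 1(2)] by (simp add: \<delta>_def)
        qed
      next
        case 2 then show ?thesis using Gd[OF xG, of i' j] Fdv[of i'] FdT[of j] by simp
      next
        case 3 then show ?thesis using Gd[OF xG, of j' i] Fdv[of j'] FdT[of i] by (simp add: add.commute)
      next
        case 4
        then show ?thesis using Fdv[of i'] Fdv[of j'] xpm[of i' j'] no2[OF Gnd[OF xG[of i']]]
          by (cases "i' = j'") auto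
      qed
    qed
    assume ne: "i \<noteq> j"
    show "\<not> int p dvd F i - F (par i) - (F j - F (par j))"
    proof -
      from split[OF ij(1)] split[OF ij(2)]
      consider "i \<in> T - {0}" "j \<in> T - {0}" | i' where "i' < K" "i = v i'" "j \<in> T - {0}"
        | j' where "i \<in> T - {0}" "j' < K" "j = v j'" | i' j' where "i' < K" "i = v i'" "j' < K" "j = v j'"
        by blast
      then show ?thesis
      proof cases
        case 1 then show ?thesis using fd[OF 1 ne] FdT[OF 1(1)] FdT[OF 1(2)] by (simp add: \<delta>_def)
      next
        case 2 then show ?thesis using Gd[OF xG, of i' j] Fdv[of i'] FdT[of j] by simp
      next
        case 3
        then have "\<not> int p dvd x j' - \<delta> i" using Gd[OF xG, of j' i] by simp
        then have "\<not> int p dvd \<delta> i - x j'" by (simp add: dvd_diff_commute)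
        then show ?thesis using Fdv[of j'] FdT[of i] 3 by simp
      next
        case 4
        then show ?thesis using Fdv[of i'] Fdv[of j'] xpm[of i' j'] ne by auto
      qed
    qed
  next
    fix i assume i: "i \<le> m"
    show "ch i < 3" using cl3 by (auto simp: ch_def cT_def cv_def)
    show "(if i \<in> T then 0 else 1) < (2::nat)" by simp
  next
    fix i assume i: "i \<in> {1..m}"
    from split[OF i] show "ch i \<noteq> ch (par i)"
    proof
      assume "i \<in> T - {0}"
      then show ?thesis using parT[of i] by (auto simp: ch_def cT_def)
    next
      assume "\<exists>j<K. i = v j"
      then show ?thesis using prop_v chv by auto
    qed
  next
    have landing: "ch (v j) = ch w" if "j < K" "w \<in> T" "int p dvd L j - f w" for j w
      using chv[OF that(1)] cl_hit[OF that(2,3)] that(2) by (simp add: cv_def ch_def)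
    have inV: "w \<in> T \<or> (\<exists>i<K. w = v i)" if "w \<le> m" for w
      using idx[of w] that by (metis DiffI atMost_iff)
    fix i j assume ij: "i \<le> m" "j \<le> m" "i \<noteq> j" "int p dvd F i - F j"
    from inV[OF ij(1)] inV[OF ij(2)]
    consider "i \<in> T" "j \<in> T" | i' where "i' < K" "i = v i'" "j \<in> T"
      | j' where "i \<in> T" "j' < K" "j = v j'" | i' j' where "i' < K" "i = v i'" "j' < K" "j = v j'"
      by blast
    then show "ch i = ch j \<and> (if i \<in> T then 0 else 1) \<noteq> (if j \<in> T then 0 else (1::nat))"
    proof cases
      case 1 then show ?thesis using f[OF 1 ij(3)] ij(4) by (simp add: F_def)
    next
      case 2 then show ?thesis using ij(4) Fv[of i'] landing[of i' j] vT[of i'] by (auto simp: F_def[of j])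
    next
      case 3
      then have "int p dvd L j' - f i" using ij(4) Fv[of j'] by (simp add: F_def[of i] dvd_diff_commute)
      then show ?thesis using landing[of j' i] vT[of j'] 3 by auto
    next
      case 4 then show ?thesis using ij Fv[of i'] Fv[of j'] Lne[of i' j'] by auto
    qed
  qed
qed

section \<open>Trees and rooted shapes\<close>

lemma rtranclp_imp_distinct_path:
  assumes "R\<^sup>*\<^sup>* x y"
  shows "\<exists>xs. xs \<noteq> [] \<and> hd xs = x \<and> last xs = y \<and> distinct xs \<and> successively R xs"
  using assms
proof (induction rule: rtranclp_induct)
  case base
  show ?case by (intro exI[of _ "[x]"]) simp
next
  case (step y z)
  then obtain xs where xs: "xs \<noteq> []" "hd xs = x" "last xs = y" "distinct xs" "successively R xs" by blast
  show ?case
  proof (cases "z \<in> set xs")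
    case True
    then obtain as bs where ab: "xs = as @ z # bs" by (meson split_list)
    have "successively R (as @ [z])" using xs(5) unfolding ab by (auto simp: successively_append_iff)
    moreover have "hd (as @ [z]) = x" using xs(2) ab by (cases as) auto
    ultimately show ?thesis using xs(4) ab by (intro exI[of _ "as @ [z]"]) auto
  next
    case False
    then show ?thesis using xs step.hyps
      by (intro exI[of _ "xs @ [z]"]) (auto simp: successively_append_iff hd_append)
  qed
qed

lemma rtranclp_crossing:
  assumes "R\<^sup>*\<^sup>* x y" "x \<in> S" "y \<notin> S"
  shows "\<exists>a b. a \<in> S \<and> b \<notin> S \<and> R a b"
  using assms by (induction rule: rtranclp_induct) auto

lemma connected_search_order:
  assumes T: "simple_graph T" "connected_graph T" "finite (verts T)" and v0: "v0 \<in> verts T"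
    and n: "n < card (verts T)"
  shows "\<exists>\<phi> par. inj_on \<phi> {..n} \<and> \<phi> ` {..n} \<subseteq> verts T \<and> \<phi> 0 = v0 \<and>
    (\<forall>i\<in>{1..n}. par i < i \<and> {\<phi> (par i), \<phi> i} \<in> edges T)"
  using n
proof (induction n)
  case 0
  show ?case using v0 by (intro exI[of _ "\<lambda>_. v0"] exI[of _ id]) auto
next
  case (Suc n)
  then obtain \<phi> par where *: "inj_on \<phi> {..n}" "\<phi> ` {..n} \<subseteq> verts T" "\<phi> 0 = v0"
    "\<forall>i\<in>{1..n}. par i < i \<and> {\<phi> (par i), \<phi> i} \<in> edges T" using Suc_lessD by blast
  have "card (\<phi> ` {..n}) < card (verts T)" using card_image[OF *(1)] Suc.prems by simp
  then obtain w where w: "w \<in> verts T" "w \<notin> \<phi> ` {..n}"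
    using card_mono[of "\<phi> ` {..n}" "verts T"] by (auto simp: not_le)
  have "(adj T)\<^sup>*\<^sup>* v0 w" using T(2) v0 w by (simp add: connected_graph_def)
  moreover have "v0 \<in> \<phi> ` {..n}" using *(3) by (intro image_eqI[of _ _ 0]) auto
  ultimately obtain a b where ab: "a \<in> \<phi> ` {..n}" "b \<notin> \<phi> ` {..n}" "{a, b} \<in> edges T"
    using rtranclp_crossing[of "adj T" v0 w] w by blast
  then obtain i where i: "i \<le> n" "a = \<phi> i" by auto
  have b: "b \<in> verts T" using T(1) ab(3) by (auto simp: simple_graph_def)
  let ?\<phi> = "\<phi>(Suc n := b)" and ?par = "par(Suc n := i)"
  have img: "?\<phi> ` {..n} = \<phi> ` {..n}" by (intro image_cong) auto
  have "inj_on ?\<phi> {..n}" using *(1) by (auto simp: inj_on_def)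
  then have "inj_on ?\<phi> {..Suc n}"
    using ab(2) img by (simp add: atMost_Suc)
  moreover have "?\<phi> ` {..Suc n} \<subseteq> verts T"
    unfolding atMost_Suc image_insert img using *(2) b by simp
  moreover have "?par j < j \<and> {?\<phi> (?par j), ?\<phi> j} \<in> edges T" if "j \<in> {1..Suc n}" for j
  proof (cases "j = Suc n")
    case True then show ?thesis using i ab by auto
  next
    case False
    then have "j \<in> {1..n}" using that by auto
    from bspec[OF *(4) this] this show ?thesis by auto
  qed
  moreover have "?\<phi> 0 = v0" using *(3) by simp
  ultimately show ?case by blast
qed

lemma parent_edges_inj:
  assumes "\<And>i. i \<in> {1..m} \<Longrightarrow> par i < i" "inj_on \<phi> {..m}"
  shows "inj_on (\<lambda>i. {\<phi> (par i), \<phi> i}) {1..m::nat}"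
proof (rule inj_onI)
  fix i j assume ij: "i \<in> {1..m}" "j \<in> {1..m}" "{\<phi> (par i), \<phi> i} = {\<phi> (par j), \<phi> j}"
  have "\<phi> ` {par i, i} = \<phi> ` {par j, j}" using ij(3) by simp
  then have "{par i, i} = {par j, j}"
    using assms(1)[OF ij(1)] assms(1)[OF ij(2)] ij by (subst (asm) inj_on_image_eq_iff[OF assms(2)]) auto
  then show "i = j" using assms(1)[OF ij(1)] assms(1)[OF ij(2)] by (auto simp: doubleton_eq_iff)
qed

text \<open>A search from \<open>v0\<close> reaches everything along
  \<open>card (verts T) - 1\<close> edges. Any further edge would close a cycle with a path of
  search edges between its ends.\<close>

lemma tree_parent_function:
  assumes tree: "is_tree T" and m: "card (edges T) = m" and v0: "v0 \<in> verts T"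
  shows "\<exists>\<phi> par. bij_betw \<phi> {..m} (verts T) \<and> \<phi> 0 = v0 \<and> (\<forall>i\<in>{1..m}. par i < i) \<and>
    edges T = (\<lambda>i. {\<phi> (par i), \<phi> i}) ` {1..m}"
proof -
  have T: "simple_graph T" "connected_graph T" "finite (verts T)" "\<And>c. \<not> is_cycle T c"
    using tree by (auto simp: is_tree_def)
  define N where "N = card (verts T) - 1"
  have N: "card (verts T) = Suc N"
  proof -
    have "card (verts T) > 0" using v0 T(3) card_gt_0_iff by blast
    then show ?thesis by (simp add: N_def)
  qed
  obtain \<phi> par where *: "inj_on \<phi> {..N}" "\<phi> ` {..N} \<subseteq> verts T" "\<phi> 0 = v0"
    "\<forall>i\<in>{1..N}. par i < i \<and> {\<phi> (par i), \<phi> i} \<in> edges T"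
    using connected_search_order[OF T(1-3) v0, of N] N by auto
  have img: "\<phi> ` {..N} = verts T"
    using *(1,2) T(3) N by (intro card_subset_eq) (auto simp: card_image)
  define F where "F = (\<lambda>i. {\<phi> (par i), \<phi> i}) ` {1..N}"
  have sub: "F \<subseteq> edges T" using *(4) by (auto simp: F_def)
  have root: "(\<lambda>a b. {a, b} \<in> F)\<^sup>*\<^sup>* (\<phi> i) (\<phi> 0) \<and> (\<lambda>a b. {a, b} \<in> F)\<^sup>*\<^sup>* (\<phi> 0) (\<phi> i)" if "i \<le> N" for i
    using that
  proof (induction i rule: less_induct)
    case (less i)
    show ?case
    proof (cases "i = 0")
      case False
      then have i: "i \<in> {1..N}" using less.prems by auto
      then have "par i < i" using *(4) by blast
      then have IH: "(\<lambda>a b. {a, b} \<in> F)\<^sup>*\<^sup>* (\<phi> (par i)) (\<phi> 0)" "(\<lambda>a b. {a, b} \<in> F)\<^sup>*\<^sup>* (\<phi> 0) (\<phi> (par i))"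
        using less.IH[of "par i"] less.prems by auto
      have F: "{\<phi> i, \<phi> (par i)} \<in> F" "{\<phi> (par i), \<phi> i} \<in> F" using i by (auto simp: F_def insert_commute)
      show ?thesis
        using converse_rtranclp_into_rtranclp[of "\<lambda>a b. {a, b} \<in> F", OF F(1) IH(1)]
          rtranclp.rtrancl_into_rtrancl[of "\<lambda>a b. {a, b} \<in> F", OF IH(2) F(2)] by simp
    qed simp
  qed
  have "edges T \<subseteq> F"
  proof (rule subsetI, rule ccontr)
    fix e assume e: "e \<in> edges T" "e \<notin> F"
    have "card e = 2" "e \<subseteq> verts T" using e T(1) by (auto simp: simple_graph_def)
    then obtain u w where uw: "e = {u, w}" "u \<noteq> w" "u \<in> verts T" "w \<in> verts T" by (auto simp: card_2_iff)
    obtain i j where "i \<le> N" "u = \<phi> i" "j \<le> N" "w = \<phi> j" using uw img by (metis atMost_iff imageE)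
    then have "(\<lambda>a b. {a, b} \<in> F)\<^sup>*\<^sup>* u w" using root by (meson rtranclp_trans)
    then obtain xs where xs: "xs \<noteq> []" "hd xs = u" "last xs = w" "distinct xs" "successively (\<lambda>a b. {a, b} \<in> F) xs"
      using rtranclp_imp_distinct_path by metis
    have "3 \<le> length xs"
    proof (rule ccontr)
      assume "\<not> 3 \<le> length xs"
      moreover have "length xs > 0" using xs(1) by simp
      ultimately have "length xs = Suc 0 \<or> length xs = Suc (Suc 0)" by linarith
      then show False using xs uw e by (auto simp: length_Suc_conv)
    qed
    moreover have "successively (adj T) xs" using xs(5) sub by (auto intro: successively_mono)
    moreover have "adj T (last xs) (hd xs)" using xs uw e by (simp add: insert_commute)
    ultimately have "is_cycle T xs" using xs by (simp add: is_cycle_def)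
    then show False using T(4) by blast
  qed
  then have E: "edges T = F" using sub by blast
  have "card F = N" unfolding F_def using parent_edges_inj[of N par \<phi>] * by (subst card_image) auto
  then have "N = m" using E m by simp
  then show ?thesis using * img E by (intro exI[of _ \<phi>] exI[of _ par]) (auto simp: F_def bij_betw_def)
qed

text \<open>Meant for the largest vertex of a cycle: in a parent graph it has only one smaller
  neighbour, its parent.\<close>

lemma cycle_neighbours:
  assumes c: "is_cycle G c" and v: "v \<in> set c"
  shows "\<exists>a b. a \<noteq> b \<and> a \<in> set c \<and> b \<in> set c \<and> a \<noteq> v \<and> b \<noteq> v \<and> adj G v a \<and> adj G v b"
proof -
  define n where "n = length c"
  have n: "3 \<le> n" "distinct c" using c by (auto simp: is_cycle_def n_def)
  have step: "adj G (c ! i) (c ! (Suc i mod n))" if "i < n" for i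
  proof (cases "Suc i < n")
    case True
    then show ?thesis using c by (auto simp: is_cycle_def successively_conv_nth n_def)
  next
    case False
    then have "Suc i = n" using that by simp
    moreover have "c \<noteq> []" using n by (auto simp: n_def)
    moreover have "adj G (last c) (hd c)" using c by (simp add: is_cycle_def)
    moreover have "i = length c - 1" using \<open>Suc i = n\<close> by (simp add: n_def)
    moreover have "Suc i mod n = 0" using \<open>Suc i = n\<close> by simp
    ultimately show ?thesis by (simp add: last_conv_nth hd_conv_nth)
  qed
  obtain i where i: "i < n" "c ! i = v" using v by (auto simp: in_set_conv_nth n_def)
  define j where "j = (if i = 0 then n - 1 else i - 1)"
  have j: "j < n" "Suc j mod n = i" "j \<noteq> i" using i n by (auto simp: j_def)
  define k where "k = Suc i mod n"
  have k: "k < n" "k \<noteq> i" "k \<noteq> j" using i n by (auto simp: k_def j_def mod_Suc)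
  have "adj G v (c ! k)" using step[OF i(1)] i by (simp add: k_def)
  moreover have "adj G v (c ! j)" using step[OF j(1)] j i by (simp add: insert_commute)
  moreover have "c ! k \<noteq> c ! j" "c ! k \<noteq> v" "c ! j \<noteq> v"
    using n(2) i j k by (auto simp: nth_eq_iff_index_eq n_def)
  moreover have "c ! k \<in> set c" "c ! j \<in> set c" using j k by (auto simp: n_def)
  ultimately show ?thesis by blast
qed

lemma par_graph_adj:
  "adj (par_graph m par) u v \<longleftrightarrow> (\<exists>i\<in>{1..m}. {u, v} = {par i, i})"
  by (auto simp: par_graph_def image_iff)

lemma par_graph_in_trees:
  assumes par: "\<And>i. i \<in> {1..m} \<Longrightarrow> par i < i"
  shows "par_graph m par \<in> trees m"
proof -
  let ?G = "par_graph m par"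
  have "simple_graph ?G"
    unfolding simple_graph_def par_graph_def using par by (auto simp: card_insert_if) (fastforce dest: par)+
  moreover have "connected_graph ?G"
  proof -
    have root: "(adj ?G)\<^sup>*\<^sup>* i 0 \<and> (adj ?G)\<^sup>*\<^sup>* 0 i" if "i \<le> m" for i
      using that
    proof (induction i rule: less_induct)
      case (less i)
      show ?case
      proof (cases "i = 0")
        case False
        then have i: "i \<in> {1..m}" using less.prems by auto
        then have IH: "(adj ?G)\<^sup>*\<^sup>* (par i) 0" "(adj ?G)\<^sup>*\<^sup>* 0 (par i)"
          using less.IH[of "par i"] less.prems par[OF i] by auto
        have "adj ?G i (par i)" "adj ?G (par i) i" unfolding par_graph_adj using i by (auto simp: insert_commute)
        then show ?thesis using IH
          by (meson converse_rtranclp_into_rtranclp rtranclp.rtrancl_into_rtrancl)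
      qed simp
    qed
    show ?thesis unfolding connected_graph_def
    proof (intro conjI ballI)
      fix u v assume "u \<in> verts ?G" "v \<in> verts ?G"
      then show "(adj ?G)\<^sup>*\<^sup>* u v" using root[of u] root[of v] by (auto simp: par_graph_def intro: rtranclp_trans)
    qed (simp add: par_graph_def)
  qed
  moreover have "\<not> is_cycle ?G c" for c
  proof
    assume c: "is_cycle ?G c"
    then have "set c \<noteq> {}" by (auto simp: is_cycle_def)
    then have "Max (set c) \<in> set c" by simp
    from cycle_neighbours[OF c this] obtain a b where ab: "a \<noteq> b" "a \<in> set c" "b \<in> set c"
      "a \<noteq> Max (set c)" "b \<noteq> Max (set c)" "adj ?G (Max (set c)) a" "adj ?G (Max (set c)) b" by blast
    have "a \<le> Max (set c)" "b \<le> Max (set c)" using ab by simp_all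
    then have "a < Max (set c)" "b < Max (set c)" using ab by linarith+
    then have "a = par (Max (set c))" "b = par (Max (set c))"
      using ab(6,7) par unfolding par_graph_adj by (fastforce simp: doubleton_eq_iff)+
    then show False using ab by simp
  qed
  moreover have "card (edges ?G) = m"
  proof -
    have "inj_on (\<lambda>i. {par i, i}) {1..m}" using parent_edges_inj[of m par id] par by simp
    then show ?thesis by (simp add: par_graph_def card_image)
  qed
  ultimately show ?thesis by (auto simp: trees_def is_tree_def par_graph_def)
qed

lemma tree_iso_par_graph:
  assumes bij: "bij_betw \<phi> {..m} (verts T)" and par: "\<And>i. i \<in> {1..m} \<Longrightarrow> par i < i"
    and E: "edges T = (\<lambda>i. {\<phi> (par i), \<phi> i}) ` {1..m}"
  shows "\<forall>u\<in>{..m}. \<forall>v\<in>{..m}. adj (par_graph m par) u v \<longleftrightarrow> adj T (\<phi> u) (\<phi> v)"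
proof (intro ballI)
  fix u v assume uv: "u \<in> {..m}" "v \<in> {..m}"
  have inj: "inj_on \<phi> {..m}" using bij by (simp add: bij_betw_def)
  have eq: "{\<phi> u, \<phi> v} = {\<phi> (par i), \<phi> i} \<longleftrightarrow> {u, v} = {par i, i}" if "i \<in> {1..m}" for i
  proof -
    have "{u, v} \<subseteq> {..m}" "{par i, i} \<subseteq> {..m}" using uv that par[OF that] by auto
    from inj_on_image_eq_iff[OF inj this] show ?thesis by simp
  qed
  have "adj T (\<phi> u) (\<phi> v) \<longleftrightarrow> (\<exists>i\<in>{1..m}. {\<phi> u, \<phi> v} = {\<phi> (par i), \<phi> i})"
    unfolding E by (auto simp: image_iff)
  also have "\<dots> \<longleftrightarrow> (\<exists>i\<in>{1..m}. {u, v} = {par i, i})" using eq by (intro bex_cong refl) simp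
  finally show "adj (par_graph m par) u v \<longleftrightarrow> adj T (\<phi> u) (\<phi> v)" by (simp add: par_graph_adj)
qed

section \<open>Rooted trees up to isomorphism\<close>

datatype rtree = Node "rtree multiset"

primrec rsize :: "rtree \<Rightarrow> nat" where
  "rsize (Node M) = Suc (\<Sum>\<^sub># (image_mset rsize M))"

text \<open>The condition \<open>i < j\<close> lets the recursion of \<open>shape\<close> terminate
  for arbitrary \<open>par\<close>.\<close>

definition kids :: "(nat \<Rightarrow> nat) \<Rightarrow> nat \<Rightarrow> nat \<Rightarrow> nat set" where
  "kids par m i = {j. i < j \<and> j \<le> m \<and> par j = i}"

lemma finite_kids [simp]: "finite (kids par m i)"
  by (rule finite_subset[of _ "{..m}"]) (auto simp: kids_def)

function shape :: "(nat \<Rightarrow> nat) \<Rightarrow> nat \<Rightarrow> nat \<Rightarrow> rtree" where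
  "shape par m i = Node (image_mset (shape par m) (mset_set (kids par m i)))"
  by auto
termination
  by (relation "Wellfounded.measure (\<lambda>(par, m, i). m - i)") (auto simp: kids_def)

declare shape.simps [simp del]

lemma image_mset_eq_imp_bij:
  assumes "finite A" "finite B" "image_mset f (mset_set A) = image_mset g (mset_set B)"
  shows "\<exists>\<beta>. bij_betw \<beta> A B \<and> (\<forall>a\<in>A. g (\<beta> a) = f a)"
  using assms
proof (induction A arbitrary: B rule: finite_induct)
  case empty
  then have "mset_set B = {#}" by simp
  then have "B = {}" using empty.prems(1) by (simp add: mset_set_empty_iff)
  then show ?case by (intro exI[of _ "\<lambda>_. undefined"]) (simp add: bij_betw_def)
next
  case (insert a A)
  have "f a \<in># image_mset g (mset_set B)"
    using insert.prems(2)[symmetric] insert.hyps by simp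
  then obtain b where b: "b \<in> B" "g b = f a" using insert.prems(1) by auto
  have "mset_set B = add_mset b (mset_set (B - {b}))"
    using b(1) insert.prems(1) by (metis mset_set.remove)
  then have "image_mset f (mset_set A) = image_mset g (mset_set (B - {b}))"
    using insert.prems(2) insert.hyps b(2) by simp
  then obtain \<beta> where \<beta>: "bij_betw \<beta> A (B - {b})" "\<forall>a\<in>A. g (\<beta> a) = f a"
    using insert.IH[of "B - {b}"] insert.prems(1) by auto
  have "bij_betw (\<beta>(a := b)) A (B - {b})"
    using \<beta>(1) insert.hyps(2) by (subst bij_betw_cong[of A _ \<beta>]) auto
  then have "bij_betw (\<beta>(a := b)) (insert a A) (insert b (B - {b}))"
    using notIn_Un_bij_betw[of a A "\<beta>(a := b)" "B - {b}"] insert.hyps(2) by simp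
  moreover have "insert b (B - {b}) = B" using b by blast
  moreover have "\<forall>x\<in>insert a A. g ((\<beta>(a := b)) x) = f x" using \<beta>(2) b by auto
  ultimately show ?case by metis
qed

text \<open>Equal multisets of branches yield a shape-preserving bijection between the children of
  two vertices; \<open>h\<close> follows these bijections from the root downwards.\<close>

lemma shape_eq_imp_iso:
  assumes par: "\<And>i. i \<in> {1..m} \<Longrightarrow> par i < i" and par': "\<And>i. i \<in> {1..m} \<Longrightarrow> par' i < i"
    and eq: "shape par m 0 = shape par' m 0"
  shows "graph_iso (par_graph m par) (par_graph m par')"
proof -
  define \<beta> where "\<beta> i i' = (SOME b. bij_betw b (kids par m i) (kids par' m i') \<and>
    (\<forall>j\<in>kids par m i. shape par' m (b j) = shape par m j))" for i i'
  have \<beta>: "bij_betw (\<beta> i i') (kids par m i) (kids par' m i') \<and>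
    (\<forall>j\<in>kids par m i. shape par' m (\<beta> i i' j) = shape par m j)" if "shape par m i = shape par' m i'" for i i'
  proof -
    have "\<exists>b. bij_betw b (kids par m i) (kids par' m i') \<and> (\<forall>j\<in>kids par m i. shape par' m (b j) = shape par m j)"
      using that shape.simps[of par m i] shape.simps[of par' m i'] by (intro image_mset_eq_imp_bij) auto
    from someI_ex[OF this] show ?thesis unfolding \<beta>_def .
  qed
  define h where "h = wfrec less_than (\<lambda>h i. if i \<in> {1..m} then \<beta> (par i) (h (par i)) i else 0)"
  have h0: "h 0 = 0" unfolding h_def by (subst wfrec[OF wf_less_than]) simp
  have h: "h i = \<beta> (par i) (h (par i)) i" if "i \<in> {1..m}" for i
    unfolding h_def by (subst wfrec[OF wf_less_than]) (use that par[OF that] in \<open>simp add: cut_apply\<close>)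
  have kid: "i \<in> kids par m (par i)" if "i \<in> {1..m}" for i using par[OF that] that by (simp add: kids_def)
  have sh: "shape par m i = shape par' m (h i)" if "i \<le> m" for i
    using that
  proof (induction i rule: less_induct)
    case (less i)
    show ?case
    proof (cases "i = 0")
      case False
      then have i: "i \<in> {1..m}" using less.prems by auto
      then show ?thesis using \<beta>[OF less.IH[OF par[OF i]]] less.prems par[OF i] h[OF i] kid[OF i] by simp
    qed (simp add: eq h0)
  qed
  have hk: "h i \<in> kids par' m (h (par i))" if i: "i \<in> {1..m}" for i
    using \<beta>[OF sh[of "par i"]] par[OF i] i h[OF i] kid[OF i] by (auto simp: bij_betw_def)
  have hm: "h i \<in> {1..m} \<and> par' (h i) = h (par i)" if "i \<in> {1..m}" for i
    using hk[OF that] by (auto simp: kids_def)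
  have inj: "i = j" if "i \<le> m" "j \<le> m" "h i = h j" for i j
    using that
  proof (induction i arbitrary: j rule: less_induct)
    case (less i)
    show ?case
    proof (cases "i = 0 \<or> j = 0")
      case True
      then show ?thesis using hm[of i] hm[of j] h0 less.prems by (cases "i = 0"; cases "j = 0") auto
    next
      case False
      then have ij: "i \<in> {1..m}" "j \<in> {1..m}" using less.prems by auto
      then have "h (par i) = h (par j)" using hm less.prems by metis
      then have pij: "par i = par j" using less.IH[of "par i" "par j"] par[OF ij(1)] par[OF ij(2)] ij by auto
      have "inj_on (\<beta> (par i) (h (par i))) (kids par m (par i))"
        using \<beta>[OF sh[of "par i"]] par[OF ij(1)] ij by (auto simp: bij_betw_def)
      then show ?thesis using h[OF ij(1)] h[OF ij(2)] less.prems(3) pij kid[OF ij(1)] kid[OF ij(2)]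
        by (auto dest: inj_onD)
    qed
  qed
  have injh: "inj_on h {..m}" by (rule inj_onI) (use inj in auto)
  have range: "h ` {..m} \<subseteq> {..m}"
  proof
    fix x assume "x \<in> h ` {..m}"
    then obtain i where "i \<le> m" "x = h i" by auto
    then show "x \<in> {..m}" using hm[of i] h0 by (cases "i = 0") auto
  qed
  then have img: "h ` {..m} = {..m}" using injh by (simp add: endo_inj_surj)
  have bij: "bij_betw h {..m} (verts (par_graph m par'))" using injh img by (simp add: bij_betw_def par_graph_def)
  have "edges (par_graph m par') = (\<lambda>i. {h (par i), h i}) ` {1..m}"
  proof -
    have "h ` {1..m} = {1..m}"
      using hm injh by (intro endo_inj_surj) (auto intro: inj_on_subset)
    then have "edges (par_graph m par') = (\<lambda>i. {par' i, i}) ` (h ` {1..m})" by (simp add: par_graph_def)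
    also have "\<dots> = (\<lambda>i. {h (par i), h i}) ` {1..m}" unfolding image_image using hm by (intro image_cong) auto
    finally show ?thesis .
  qed
  from tree_iso_par_graph[OF bij par this] bij show ?thesis
    unfolding graph_iso_def by (intro exI[of _ h]) (simp add: par_graph_def)
qed

text \<open>An isomorphism that fixes the root commutes with the parent functions: if
  \<open>\<phi> i\<close> were the parent of \<open>\<phi> (par i)\<close>, the induction hypothesis
  and injectivity would give \<open>i = par (par i)\<close>. It therefore maps children onto
  children, and shapes agree from the leaves upwards.\<close>

lemma rooted_iso_imp_shape_eq:
  assumes par: "\<And>i. i \<in> {1..m} \<Longrightarrow> par i < i" and par': "\<And>i. i \<in> {1..m} \<Longrightarrow> par' i < i"
    and bij: "bij_betw \<phi> {..m} {..m}" and \<phi>0: "\<phi> 0 = 0"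
    and adj: "\<forall>u\<in>{..m}. \<forall>v\<in>{..m}. adj (par_graph m par) u v \<longleftrightarrow> adj (par_graph m par') (\<phi> u) (\<phi> v)"
  shows "shape par m 0 = shape par' m 0"
proof -
  have inj: "\<phi> i = \<phi> j \<longleftrightarrow> i = j" if "i \<le> m" "j \<le> m" for i j
    using bij that by (auto simp: bij_betw_def inj_on_def)
  have \<phi>m: "\<phi> i \<le> m" if "i \<le> m" for i using bij that by (auto simp: bij_betw_def)
  have adj_par: "u = par' v \<and> v \<in> {1..m} \<or> v = par' u \<and> u \<in> {1..m}" if "adj (par_graph m par') u v" for u v
    using that unfolding par_graph_adj by (auto simp: doubleton_eq_iff)
  have comm: "\<phi> (par i) = par' (\<phi> i) \<and> \<phi> i \<in> {1..m}" if "i \<in> {1..m}" for i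
    using that
  proof (induction i rule: less_induct)
    case (less i)
    have pi: "par i < i" "par i \<le> m" using par[OF less.prems] less.prems by auto
    have "\<phi> i \<noteq> 0" using inj[of i 0] less.prems \<phi>0 by auto
    then have \<phi>i: "\<phi> i \<in> {1..m}" using \<phi>m[of i] less.prems by auto
    have "adj (par_graph m par) (par i) i" unfolding par_graph_adj using less.prems by auto
    then have "adj (par_graph m par') (\<phi> (par i)) (\<phi> i)" using adj pi less.prems by auto
    from adj_par[OF this] show ?case
    proof
      assume "\<phi> i = par' (\<phi> (par i)) \<and> \<phi> (par i) \<in> {1..m}"
      moreover from this have "par i \<in> {1..m}" using \<phi>0 pi by (cases "par i = 0") auto
      ultimately have "\<phi> i = \<phi> (par (par i))" "par (par i) < par i"
        using less.IH[OF pi(1)] par by auto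
      then have "i = par (par i)" using inj[of i "par (par i)"] less.prems pi by auto
      then show ?thesis using \<open>par (par i) < par i\<close> pi by simp
    qed (use \<phi>i in simp)
  qed
  have "shape par m i = shape par' m (\<phi> i)" if "i \<le> m" for i
    using that
  proof (induction "m - i" arbitrary: i rule: less_induct)
    case less
    have K: "kids par' m (\<phi> i) = \<phi> ` kids par m i"
    proof
      show "\<phi> ` kids par m i \<subseteq> kids par' m (\<phi> i)"
      proof
        fix x assume "x \<in> \<phi> ` kids par m i"
        then obtain j where "j \<in> kids par m i" and x: "x = \<phi> j" by auto
        then have j: "j \<in> {1..m}" "par j = i" "x = \<phi> j" by (auto simp: kids_def)
        then show "x \<in> kids par' m (\<phi> i)" using comm[OF j(1)] par'[of x] by (auto simp: kids_def)
      qed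
      show "kids par' m (\<phi> i) \<subseteq> \<phi> ` kids par m i"
      proof
        fix x assume x: "x \<in> kids par' m (\<phi> i)"
        then have x': "x \<in> {1..m}" "par' x = \<phi> i" by (auto simp: kids_def)
        then have "x \<in> \<phi> ` {..m}" using bij by (simp add: bij_betw_def)
        then obtain j where j: "j \<le> m" "x = \<phi> j" by auto
        then have "j \<noteq> 0" using x'(1) \<phi>0 by (cases "j = 0") auto
        then have j1: "j \<in> {1..m}" using j by auto
        then have "\<phi> (par j) = \<phi> i" using comm[OF j1] x' j by simp
        then have "par j = i" using inj[of "par j" i] par[OF j1] j1 less.prems by auto
        then show "x \<in> \<phi> ` kids par m i" using j j1 par[OF j1] by (auto simp: kids_def)
      qed
    qed
    have "inj_on \<phi> (kids par m i)" using bij by (auto simp: bij_betw_def kids_def intro: inj_on_subset)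
    then have "image_mset (shape par' m) (mset_set (kids par' m (\<phi> i)))
      = image_mset (\<lambda>j. shape par' m (\<phi> j)) (mset_set (kids par m i))"
      unfolding K by (simp add: image_mset_mset_set[symmetric] multiset.map_comp o_def)
    also have "\<dots> = image_mset (shape par m) (mset_set (kids par m i))"
    proof (rule image_mset_cong)
      fix j assume "j \<in># mset_set (kids par m i)"
      then have "i < j" "j \<le> m" by (auto simp: kids_def)
      then show "shape par' m (\<phi> j) = shape par m j" using less.hyps[of j] by simp
    qed
    finally show ?case using shape.simps[of par m i] shape.simps[of par' m "\<phi> i"] by simp
  qed
  from this[of 0] show ?thesis using \<phi>0 by simp
qed

text \<open>One branch \<open>c\<close> is split off at the root. Its numbering is shifted by
  \<open>Suc m1\<close>, behind the numbering of the remaining tree, and its root is attached to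
  0.\<close>

lemma shape_realisation:
  "\<exists>par. (\<forall>i\<in>{1..rsize t - 1}. par i < i) \<and> shape par (rsize t - 1) 0 = t"
proof (induction "rsize t" arbitrary: t rule: less_induct)
  case less
  obtain M where t: "t = Node M" by (cases t)
  show ?case
  proof (cases "M = {#}")
    case True
    have "kids id 0 0 = {}" by (auto simp: kids_def)
    then have "shape id 0 0 = Node {#}" by (subst shape.simps) simp
    then show ?thesis using t True by (intro exI[of _ id]) simp
  next
    case False
    then obtain c M' where M: "M = add_mset c M'" by (meson multiset_cases)
    define m1 where "m1 = rsize (Node M') - 1"
    define m2 where "m2 = rsize c - 1"
    have c1: "rsize c = Suc m2" by (cases c) (simp add: m2_def)
    have M1: "rsize (Node M') = Suc m1" by (simp add: m1_def)
    have sz: "rsize t = Suc (m1 + m2 + 1)" using M1 c1 by (simp add: t M)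
    have "rsize (Node M') < rsize t" "rsize c < rsize t" using sz M1 c1 by linarith+
    then have ex: "\<exists>P. (\<forall>i\<in>{1..m1}. P i < i) \<and> shape P m1 0 = Node M'"
      "\<exists>Q. (\<forall>i\<in>{1..m2}. Q i < i) \<and> shape Q m2 0 = c"
      using less unfolding m1_def m2_def by blast+
    obtain P where P': "\<forall>i\<in>{1..m1}. P i < i" "shape P m1 0 = Node M'" using ex(1) by blast
    obtain Q where Q': "\<forall>i\<in>{1..m2}. Q i < i" "shape Q m2 0 = c" using ex(2) by blast
    note P = bspec[OF P'(1)] P'(2) and Q = bspec[OF Q'(1)] Q'(2)
    define m where "m = m1 + m2 + 1"
    define R where "R i = (if i \<le> m1 then P i else if i = Suc m1 then 0 else Q (i - Suc m1) + Suc m1)" for i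
    have R: "R i < i" if "i \<in> {1..m}" for i
    proof -
      consider "i \<le> m1" | "i = Suc m1" | "i > Suc m1" by linarith
      then show ?thesis
      proof cases
        case 1 then show ?thesis using P(1)[of i] that by (simp add: R_def)
      next
        case 3
        then have "i - Suc m1 \<in> {1..m2}" using that by (auto simp: m_def)
        from Q(1)[OF this] 3 show ?thesis by (simp add: R_def)
      qed (simp add: R_def)
    qed
    have Qs: "shape R m (Suc m1 + i) = shape Q m2 i" if "i \<le> m2" for i
      using that
    proof (induction "m2 - i" arbitrary: i rule: less_induct)
      case less
      have K: "kids R m (Suc m1 + i) = (\<lambda>j. Suc m1 + j) ` kids Q m2 i"
      proof
        show "(\<lambda>j. Suc m1 + j) ` kids Q m2 i \<subseteq> kids R m (Suc m1 + i)"
          by (auto simp: kids_def R_def m_def)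
        show "kids R m (Suc m1 + i) \<subseteq> (\<lambda>j. Suc m1 + j) ` kids Q m2 i"
        proof
          fix x assume "x \<in> kids R m (Suc m1 + i)"
          then have "x - Suc m1 \<in> kids Q m2 i" "x = Suc m1 + (x - Suc m1)" by (auto simp: kids_def R_def m_def)
          then show "x \<in> (\<lambda>j. Suc m1 + j) ` kids Q m2 i" by blast
        qed
      qed
      have "image_mset (shape R m) (mset_set (kids R m (Suc m1 + i)))
        = image_mset (\<lambda>j. shape R m (Suc m1 + j)) (mset_set (kids Q m2 i))"
        unfolding K by (subst image_mset_mset_set[symmetric]) (auto simp: multiset.map_comp o_def inj_on_def)
      also have "\<dots> = image_mset (shape Q m2) (mset_set (kids Q m2 i))"
      proof (rule image_mset_cong)
        fix j assume "j \<in># mset_set (kids Q m2 i)"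
        then have "i < j" "j \<le> m2" by (auto simp: kids_def)
        then show "shape R m (Suc m1 + j) = shape Q m2 j" using less.hyps[of j] by simp
      qed
      finally show ?case using shape.simps[of R m "Suc m1 + i"] shape.simps[of Q m2 i] by simp
    qed
    have Ps: "shape R m i = shape P m1 i" if "i \<in> {1..m1}" for i
      using that
    proof (induction "m1 - i" arbitrary: i rule: less_induct)
      case less
      have K: "kids R m i = kids P m1 i" using less.prems by (auto simp: kids_def R_def m_def)
      have "image_mset (shape R m) (mset_set (kids P m1 i)) = image_mset (shape P m1) (mset_set (kids P m1 i))"
      proof (rule image_mset_cong)
        fix j assume "j \<in># mset_set (kids P m1 i)"
        then have "i < j" "j \<le> m1" by (auto simp: kids_def)
        then show "shape R m j = shape P m1 j" using less.hyps[of j] less.prems by simp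
      qed
      then show ?case using shape.simps[of R m i] shape.simps[of P m1 i] K by simp
    qed
    have K0: "kids R m 0 = insert (Suc m1) (kids P m1 0)" by (auto simp: kids_def R_def m_def)
    have "Suc m1 \<notin> kids P m1 0" by (simp add: kids_def)
    then have "image_mset (shape R m) (mset_set (kids R m 0))
      = add_mset (shape R m (Suc m1)) (image_mset (shape R m) (mset_set (kids P m1 0)))"
      unfolding K0 by simp
    also have "image_mset (shape R m) (mset_set (kids P m1 0)) = image_mset (shape P m1) (mset_set (kids P m1 0))"
      by (rule image_mset_cong) (use Ps in \<open>auto simp: kids_def\<close>)
    also have "\<dots> = M'" using P(2) shape.simps[of P m1 0] by simp
    also have "shape R m (Suc m1) = c" using Qs[of 0] Q(2) by simp
    finally have "shape R m 0 = t" using shape.simps[of R m 0] by (simp add: t M)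
    moreover have "rsize t - 1 = m" using sz by (simp add: m_def)
    ultimately show ?thesis using R by (intro exI[of _ R]) auto
  qed
qed

section \<open>Weighted sums over rooted trees\<close>

text \<open>A product of \<open>f\<close> over all vertices, in which the side alternates with the
  depth and \<open>f\<close> sees the branches at the vertex. The result is a function of the side
  so that the recursion stays primitive.\<close>

primrec wt :: "(bool \<Rightarrow> rtree multiset \<Rightarrow> real) \<Rightarrow> rtree \<Rightarrow> bool \<Rightarrow> real" where
  "wt f (Node M) = (\<lambda>s. f s M * \<Prod>\<^sub># (image_mset (\<lambda>h. h (\<not> s)) (image_mset (wt f) M)))"

lemma wt_Node: "wt f (Node M) s = f s M * (\<Prod>c\<in>#M. wt f c (\<not> s))"
  by (simp add: multiset.map_comp o_def)

declare wt.simps [simp del]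

definition msets_le :: "'a set \<Rightarrow> nat \<Rightarrow> 'a multiset set" where
  "msets_le A K = {M. set_mset M \<subseteq> A \<and> (\<forall>a. count M a \<le> K)}"

lemma msets_le_bij:
  assumes A: "finite A"
  shows "bij_betw (\<lambda>M. restrict (count M) A) (msets_le A K) (PiE A (\<lambda>_. {..K}))"
proof (rule bij_betw_byWitness[of _ "\<lambda>g. \<Sum>a\<in>A. replicate_mset (g a) a"])
  have cnt: "count (\<Sum>a\<in>A. replicate_mset (g a) a) x = (if x \<in> A then g x else 0)" for g x
    using A by (simp add: count_sum)
  show "\<forall>M\<in>msets_le A K. (\<Sum>a\<in>A. replicate_mset (restrict (count M) A a) a) = M"
  proof
    fix M assume M: "M \<in> msets_le A K"
    show "(\<Sum>a\<in>A. replicate_mset (restrict (count M) A a) a) = M"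
    proof (rule multiset_eqI)
      fix x show "count (\<Sum>a\<in>A. replicate_mset (restrict (count M) A a) a) x = count M x"
        unfolding cnt using M by (auto simp: msets_le_def not_in_iff)
    qed
  qed
  show "\<forall>g\<in>PiE A (\<lambda>_. {..K}). restrict (count (\<Sum>a\<in>A. replicate_mset (g a) a)) A = g"
    by (intro ballI ext) (auto simp: cnt PiE_def extensional_def)
  show "(\<lambda>M. restrict (count M) A) ` msets_le A K \<subseteq> PiE A (\<lambda>_. {..K})"
    by (auto simp: msets_le_def)
  show "(\<lambda>g. \<Sum>a\<in>A. replicate_mset (g a) a) ` PiE A (\<lambda>_. {..K}) \<subseteq> msets_le A K"
  proof
    fix M assume "M \<in> (\<lambda>g. \<Sum>a\<in>A. replicate_mset (g a) a) ` PiE A (\<lambda>_. {..K})"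
    then obtain g where g: "g \<in> PiE A (\<lambda>_. {..K})" and M: "M = (\<Sum>a\<in>A. replicate_mset (g a) a)" by auto
    have "x \<in> A" if "x \<in># M" for x using cnt[of g x] that M by (metis count_eq_zero_iff)
    moreover have "count M x \<le> K" for x using cnt[of g x] g M by auto
    ultimately show "M \<in> msets_le A K" by (auto simp: msets_le_def)
  qed
qed

lemma finite_msets_le: "finite A \<Longrightarrow> finite (msets_le A K)"
  using bij_betw_finite[OF msets_le_bij[of A K]] by (simp add: finite_PiE)

lemma prod_mset_eq_prod_count:
  fixes v :: "'a \<Rightarrow> real"
  assumes "finite A" "set_mset M \<subseteq> A"
  shows "(\<Prod>c\<in>#M. v c) = (\<Prod>a\<in>A. v a ^ count M a)"
  unfolding image_prod_mset_multiplicity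
  using assms by (intro prod.mono_neutral_left) (auto simp: not_in_iff)

text \<open>Euler product: a multiset is an independent choice of a multiplicity for each element of
  \<open>A\<close>.\<close>

lemma sum_msets_le:
  fixes v :: "'a \<Rightarrow> real"
  assumes A: "finite A"
  shows "(\<Sum>M\<in>msets_le A K. \<Prod>c\<in>#M. v c) = (\<Prod>a\<in>A. \<Sum>k\<le>K. v a ^ k)"
proof -
  have "(\<Sum>M\<in>msets_le A K. \<Prod>c\<in>#M. v c) = (\<Sum>M\<in>msets_le A K. \<Prod>a\<in>A. v a ^ restrict (count M) A a)"
    by (intro sum.cong refl) (simp add: prod_mset_eq_prod_count[OF A] msets_le_def)
  also have "\<dots> = (\<Sum>g\<in>PiE A (\<lambda>_. {..K}). \<Prod>a\<in>A. v a ^ g a)"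
    by (rule sum.reindex_bij_betw[OF msets_le_bij[OF A]])
  also have "\<dots> = (\<Prod>a\<in>A. \<Sum>k\<le>K. v a ^ k)" by (rule prod_sum_PiE[symmetric]) (use A in auto)
  finally show ?thesis .
qed

lemma sum_msets_upper:
  fixes v :: "'a \<Rightarrow> real"
  assumes A: "finite A" and v: "\<And>a. a \<in> A \<Longrightarrow> 0 \<le> v a \<and> v a < 1"
    and M: "finite \<M>" "\<And>M. M \<in> \<M> \<Longrightarrow> set_mset M \<subseteq> A"
  shows "(\<Sum>M\<in>\<M>. \<Prod>c\<in>#M. v c) \<le> (\<Prod>a\<in>A. 1 / (1 - v a))"
proof -
  define K where "K = Max (insert 0 (size ` \<M>))"
  have "size M \<le> K" if "M \<in> \<M>" for M unfolding K_def using M(1) that by (intro Max_ge) auto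
  then have sub: "\<M> \<subseteq> msets_le A K"
    using M(2) by (auto simp: msets_le_def intro: order_trans[OF count_le_size])
  have nn: "0 \<le> (\<Prod>c\<in>#M. v c)" if "M \<in> msets_le A K" for M
    using that v prod_mset_eq_prod_count[OF A, of M v] by (auto simp: msets_le_def intro!: prod_nonneg)
  have "(\<Sum>M\<in>\<M>. \<Prod>c\<in>#M. v c) \<le> (\<Sum>M\<in>msets_le A K. \<Prod>c\<in>#M. v c)"
    by (rule sum_mono2[OF finite_msets_le[OF A] sub]) (use nn in auto)
  also have "\<dots> = (\<Prod>a\<in>A. \<Sum>k\<le>K. v a ^ k)" by (rule sum_msets_le[OF A])
  also have "\<dots> \<le> (\<Prod>a\<in>A. 1 / (1 - v a))"
  proof (rule prod_mono)
    fix a assume a: "a \<in> A"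
    have "(\<Sum>k\<le>K. v a ^ k) \<le> (\<Sum>k. v a ^ k)"
      using v[OF a] by (intro sum_le_suminf summable_geometric) auto
    also have "\<dots> = 1 / (1 - v a)" using v[OF a] by (intro suminf_geometric) auto
    finally show "0 \<le> (\<Sum>k\<le>K. v a ^ k) \<and> (\<Sum>k\<le>K. v a ^ k) \<le> 1 / (1 - v a)"
      using v[OF a] by (auto intro!: sum_nonneg)
  qed
  finally show ?thesis .
qed

definition leaf :: rtree where "leaf = Node {#}"

definition nodew :: "(bool \<Rightarrow> real) \<Rightarrow> (bool \<Rightarrow> real) \<Rightarrow> (bool \<Rightarrow> real) \<Rightarrow> bool \<Rightarrow> rtree multiset \<Rightarrow> real" where
  "nodew l u w s M = (if M = {#} then l s else if M = {#leaf#} then u s else w s)"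

lemma wt_pos:
  assumes "\<And>s M. 0 < f s M" shows "0 < wt f t s"
proof (induction t arbitrary: s)
  case (Node M)
  have "0 < (\<Prod>c\<in>#M. wt f c (\<not> s))" using Node by (induction M) auto
  then show ?case using assms by (simp add: wt_Node)
qed

lemma wt_le_power:
  assumes f: "\<And>s M. 0 < f s M" "\<And>s M. f s M \<le> \<mu>"
  shows "wt f t s \<le> \<mu> ^ rsize t"
proof (induction t arbitrary: s)
  case (Node M)
  have "(\<Prod>c\<in>#M. wt f c (\<not> s)) \<le> \<mu> ^ (\<Sum>\<^sub># (image_mset rsize M))"
    using Node
  proof (induction M)
    case (add c M)
    have "wt f c (\<not> s) * (\<Prod>c\<in>#M. wt f c (\<not> s)) \<le> \<mu> ^ rsize c * \<mu> ^ (\<Sum>\<^sub># (image_mset rsize M))"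
    proof (rule mult_mono)
      show "0 \<le> (\<Prod>c\<in>#M. wt f c (\<not> s))"
        by (induction M) (auto intro: mult_nonneg_nonneg less_imp_le[OF wt_pos[OF f(1)]])
      show "0 \<le> \<mu> ^ rsize c" using f(1)[of s M] f(2)[of s M] by simp
    qed (use add in auto)
    then show ?case by (simp add: power_add)
  qed simp
  moreover have "0 \<le> (\<Prod>c\<in>#M. wt f c (\<not> s))"
    by (induction M) (auto intro: mult_nonneg_nonneg less_imp_le[OF wt_pos[OF f(1)]])
  ultimately show ?case
    using f(1)[of s M] f(2)[of s M] by (simp add: wt_Node mult_mono)
qed

text \<open>One step of the functional equation of the generating function: a tree is a root with a
  multiset of branches. \<open>Q\<close> bounds the sum over all multisets; the empty one and
  \<open>{#leaf#}\<close> account for \<open>1\<close> and \<open>l (\<not> s)\<close> of it and get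
  root weights of their own.\<close>

lemma sum_wt_step:
  assumes pos: "\<And>s. 0 < l s" "\<And>s. 0 < u s" "\<And>s. 0 < w s"
    and A: "finite A" "leaf \<in> A" "\<And>c. c \<in> A \<Longrightarrow> wt (nodew l u w) c (\<not> s) < 1"
    and A': "finite A'" "\<And>M. Node M \<in> A' \<Longrightarrow> set_mset M \<subseteq> A"
    and Q: "(\<Prod>c\<in>A. 1 / (1 - wt (nodew l u w) c (\<not> s))) \<le> Q"
  shows "(\<Sum>t\<in>A'. wt (nodew l u w) t s) \<le> l s + u s * l (\<not> s) + w s * (Q - 1 - l (\<not> s))"
proof -
  let ?W = "wt (nodew l u w)"
  have posn: "0 < nodew l u w s M" for s M using pos by (simp add: nodew_def)
  note wpos = wt_pos[of "nodew l u w", OF posn]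
  define \<M> where "\<M> = insert {#} (insert {#leaf#} {M. Node M \<in> A'})"
  have finM: "finite {M. Node M \<in> A'}"
    using finite_vimageI[OF A'(1), of Node] by (simp add: vimage_def inj_def)
  have fin: "finite \<M>" using finM by (simp add: \<M>_def)
  have sub: "set_mset M \<subseteq> A" if "M \<in> \<M>" for M using that A A' by (auto simp: \<M>_def)
  define h where "h M = (\<Prod>c\<in>#M. ?W c (\<not> s))" for M
  have h0: "0 \<le> h M" for M unfolding h_def
    by (induction M) (auto intro: mult_nonneg_nonneg less_imp_le[OF wpos])
  have hl: "h {#leaf#} = l (\<not> s)" by (simp add: h_def leaf_def wt_Node nodew_def)
  have he: "h {#} = 1" by (simp add: h_def)
  have nw: "nodew l u w s {#} = l s" "nodew l u w s {#leaf#} = u s" by (simp_all add: nodew_def)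
  have "(\<Sum>t\<in>A'. ?W t s) = (\<Sum>M\<in>{M. Node M \<in> A'}. ?W (Node M) s)"
    by (rule sum.reindex_bij_witness[of _ Node "\<lambda>t. case t of Node M \<Rightarrow> M"]) (auto split: rtree.splits)
  also have "\<dots> \<le> (\<Sum>M\<in>\<M>. ?W (Node M) s)"
    using fin wpos by (intro sum_mono2) (auto simp: \<M>_def intro: less_imp_le)
  also have "\<dots> = (\<Sum>M\<in>\<M>. nodew l u w s M * h M)" by (simp add: wt_Node h_def)
  also have "\<dots> = nodew l u w s {#} * h {#} + (nodew l u w s {#leaf#} * h {#leaf#}
      + (\<Sum>M\<in>\<M> - {{#}} - {{#leaf#}}. nodew l u w s M * h M))"
    using fin by (subst sum.remove[of _ "{#}"], simp, simp add: \<M>_def, subst sum.remove[of _ "{#leaf#}"]) (auto simp: \<M>_def)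
  also have "(\<Sum>M\<in>\<M> - {{#}} - {{#leaf#}}. nodew l u w s M * h M) = w s * (\<Sum>M\<in>\<M> - {{#}} - {{#leaf#}}. h M)"
    unfolding sum_distrib_left by (intro sum.cong) (auto simp: nodew_def)
  also have "(\<Sum>M\<in>\<M> - {{#}} - {{#leaf#}}. h M) = (\<Sum>M\<in>\<M>. h M) - 1 - l (\<not> s)"
  proof -
    have "(\<Sum>M\<in>\<M>. h M) = h {#} + (h {#leaf#} + (\<Sum>M\<in>\<M> - {{#}} - {{#leaf#}}. h M))"
      using fin by (subst sum.remove[of _ "{#}"], simp, simp add: \<M>_def, subst sum.remove[of _ "{#leaf#}"]) (auto simp: \<M>_def)
    then show ?thesis using hl he by simp
  qed
  finally have "(\<Sum>t\<in>A'. ?W t s) \<le> l s + (u s * l (\<not> s) + w s * ((\<Sum>M\<in>\<M>. h M) - 1 - l (\<not> s)))"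
    by (simp only: nw hl he)
  moreover have "(\<Sum>M\<in>\<M>. h M) \<le> Q"
    unfolding h_def
    by (rule order_trans[OF sum_msets_upper[OF A(1) _ fin sub] Q]) (use A(3) wpos in \<open>auto intro: less_imp_le\<close>)
  then have "w s * ((\<Sum>M\<in>\<M>. h M) - 1 - l (\<not> s)) \<le> w s * (Q - 1 - l (\<not> s))"
    using pos by (intro mult_left_mono less_imp_le[OF pos(3)]) simp
  ultimately show ?thesis by linarith
qed

section \<open>Explicit upper bounds for the weighted series\<close>

text \<open>Follows from \<open>(1 - y + y^2/2) * (1 + y + y^2/2) = 1 + y^4/4\<close>.\<close>

lemma exp_minus_le:
  fixes y :: real assumes "0 \<le> y" shows "exp (- y) \<le> 1 - y + y\<^sup>2 / 2"
proof -
  have e: "1 + y + y\<^sup>2 / 2 \<le> exp y" using exp_lower_Taylor_quadratic[OF assms] .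
  have p: "0 < 1 + y + y\<^sup>2 / 2" using assms by (simp add: add_pos_nonneg)
  have "1 \<le> (1 - y + y\<^sup>2 / 2) * (1 + y + y\<^sup>2 / 2)"
    using assms by (simp add: algebra_simps power2_eq_square)
  then have "1 / (1 + y + y\<^sup>2 / 2) \<le> 1 - y + y\<^sup>2 / 2" using p by (simp add: divide_le_eq)
  moreover have "exp (- y) \<le> 1 / (1 + y + y\<^sup>2 / 2)"
    using e p by (simp add: exp_minus inverse_eq_divide frac_le)
  ultimately show ?thesis by linarith
qed

text \<open>The condition on \<open>\<kappa>\<close> says that the quadratic upper bound for
  \<open>exp (- \<kappa> * v)\<close> stays below \<open>1 - v\<close> up to \<open>v = V\<close>.
  If \<open>V\<close> is small, \<open>\<kappa>\<close> can be close to 1.\<close>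

lemma inverse_one_minus_le_exp:
  fixes v \<kappa> :: real
  assumes "0 \<le> v" "v \<le> V" "V < 1" "0 \<le> \<kappa>" "\<kappa>\<^sup>2 * V \<le> 2 * (\<kappa> - 1)"
  shows "1 / (1 - v) \<le> exp (\<kappa> * v)"
proof -
  have "\<kappa>\<^sup>2 * v \<le> \<kappa>\<^sup>2 * V" using assms by (intro mult_left_mono) auto
  then have "\<kappa>\<^sup>2 * v * v \<le> 2 * (\<kappa> - 1) * v" using assms by (intro mult_right_mono) linarith+
  then have "1 - \<kappa> * v + (\<kappa> * v)\<^sup>2 / 2 \<le> 1 - v"
    by (simp add: algebra_simps power2_eq_square)
  then have "exp (- (\<kappa> * v)) \<le> 1 - v" using exp_minus_le[of "\<kappa> * v"] assms(1,4) mult_nonneg_nonneg[of \<kappa> v] by linarith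
  then have "1 \<le> exp (\<kappa> * v) * (1 - v)"
    using mult_left_mono[of "exp (- (\<kappa> * v))" "1 - v" "exp (\<kappa> * v)"] by (simp add: exp_minus)
  then show ?thesis using assms by (simp add: divide_le_eq)
qed

lemma prod_inverse_le:
  fixes v :: "'a \<Rightarrow> real"
  assumes A: "finite A" "S \<subseteq> A" and v: "\<And>a. a \<in> A \<Longrightarrow> 0 \<le> v a \<and> v a < 1" "\<And>a. a \<in> A - S \<Longrightarrow> v a \<le> V"
    and \<kappa>: "V < 1" "0 \<le> \<kappa>" "\<kappa>\<^sup>2 * V \<le> 2 * (\<kappa> - 1)"
    and Y: "(\<Sum>a\<in>A. v a) \<le> Y" and \<sigma>: "\<sigma> \<le> (\<Sum>a\<in>S. v a)" and C: "(\<Prod>a\<in>S. 1 / (1 - v a)) \<le> C"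
  shows "(\<Prod>a\<in>A. 1 / (1 - v a)) \<le> C * exp (\<kappa> * (Y - \<sigma>))"
proof -
  have finS: "finite S" using A finite_subset by blast
  have "(\<Prod>a\<in>A - S. 1 / (1 - v a)) \<le> (\<Prod>a\<in>A - S. exp (\<kappa> * v a))"
  proof (rule prod_mono)
    fix a assume "a \<in> A - S"
    then show "0 \<le> 1 / (1 - v a) \<and> 1 / (1 - v a) \<le> exp (\<kappa> * v a)"
      using v(1)[of a] v(2)[of a] inverse_one_minus_le_exp[of "v a" V \<kappa>] \<kappa> by auto
  qed
  also have "(\<Prod>a\<in>A - S. exp (\<kappa> * v a)) = exp (\<kappa> * (\<Sum>a\<in>A - S. v a))"
    using A by (simp add: exp_sum sum_distrib_left)
  also have "\<dots> \<le> exp (\<kappa> * (Y - \<sigma>))"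
  proof -
    have "(\<Sum>a\<in>A - S. v a) = (\<Sum>a\<in>A. v a) - (\<Sum>a\<in>S. v a)" using A finS by (simp add: sum_diff)
    then have "(\<Sum>a\<in>A - S. v a) \<le> Y - \<sigma>" using Y \<sigma> by simp
    then show ?thesis using \<kappa> by (simp add: mult_left_mono)
  qed
  finally have 1: "(\<Prod>a\<in>A - S. 1 / (1 - v a)) \<le> exp (\<kappa> * (Y - \<sigma>))" .
  have 0: "0 \<le> (\<Prod>a\<in>S. 1 / (1 - v a))"
  proof (rule prod_nonneg)
    fix a assume "a \<in> S"
    then have "v a < 1" using v(1) A by blast
    then show "0 \<le> 1 / (1 - v a)" by simp
  qed
  have "(\<Prod>a\<in>A. 1 / (1 - v a)) = (\<Prod>a\<in>A - S. 1 / (1 - v a)) * (\<Prod>a\<in>S. 1 / (1 - v a))"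
    by (rule prod.subset_diff[OF A(2,1)])
  also have "\<dots> \<le> exp (\<kappa> * (Y - \<sigma>)) * (\<Prod>a\<in>S. 1 / (1 - v a))" by (rule mult_right_mono[OF 1 0])
  also have "\<dots> \<le> exp (\<kappa> * (Y - \<sigma>)) * C" using C by (intro mult_left_mono) auto
  finally show ?thesis by (simp add: mult.commute)
qed

lemma rsize_pos: "0 < rsize t" by (cases t) simp

lemma rsize_ne0 [simp]: "rsize t \<noteq> 0" using rsize_pos[of t] by simp

lemma finite_rtrees: "finite {t. rsize t \<le> N}"
proof (induction N)
  case 0 then show ?case by simp
next
  case (Suc N)
  let ?A = "{t. rsize t \<le> N}"
  have "{t. rsize t \<le> Suc N} \<subseteq> Node ` msets_le ?A N"
  proof
    fix t assume t: "t \<in> {t. rsize t \<le> Suc N}"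
    obtain M where M: "t = Node M" by (cases t)
    have sum: "\<Sum>\<^sub># (image_mset rsize M) \<le> N" using t M by simp
    have "rsize c \<le> N" if "c \<in># M" for c
      using sum that by (auto dest!: multi_member_split)
    moreover have "size M \<le> \<Sum>\<^sub># (image_mset rsize M)"
    proof (induction M)
      case (add c M) then show ?case using rsize_pos[of c] by auto
    qed simp
    ultimately have "count M a \<le> N" for a using count_le_size[of M a] sum by linarith
    then have "M \<in> msets_le ?A N" using \<open>\<And>c. c \<in># M \<Longrightarrow> rsize c \<le> N\<close> by (auto simp: msets_le_def)
    then show "t \<in> Node ` msets_le ?A N" using M by simp
  qed
  then show ?case using finite_msets_le[OF Suc] finite_subset by blast
qed

definition small_trees :: "rtree set" where "small_trees = {t. rsize t \<le> 4}"

text \<open>Trees with at most four vertices are summed exactly; for the others \<open>1 / (1 - w) \<le> exp (\<kappa> * w)\<close> suffices.\<close>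

lemma sum_wt_bound:
  fixes l u w :: "bool \<Rightarrow> real"
  defines "W \<equiv> wt (nodew l u w)"
  assumes pos: "\<And>s. 0 < l s" "\<And>s. 0 < u s" "\<And>s. 0 < w s"
    and \<mu>: "\<And>s. l s \<le> \<mu>" "\<And>s. u s \<le> \<mu>" "\<And>s. w s \<le> \<mu>" "\<mu> < 1"
    and \<kappa>: "0 \<le> \<kappa>" "\<kappa>\<^sup>2 * \<mu> ^ 5 \<le> 2 * (\<kappa> - 1)"
    and \<sigma>: "\<And>s. \<sigma> s \<le> (\<Sum>t\<in>small_trees. W t s)" "\<And>s. (\<Sum>t\<in>small_trees. W t s) \<le> Y s"
    and C: "\<And>s. (\<Prod>t\<in>small_trees. 1 / (1 - W t s)) \<le> C s"
    and step: "\<And>s. l s + u s * l (\<not> s) + w s * (C (\<not> s) * exp (\<kappa> * (Y (\<not> s) - \<sigma> (\<not> s))) - 1 - l (\<not> s)) \<le> Y s"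
  shows "(\<Sum>t | rsize t \<le> N. W t s) \<le> Y s"
proof -
  have posn: "0 < nodew l u w s M" for s M using pos by (simp add: nodew_def)
  have len: "nodew l u w s M \<le> \<mu>" for s M using \<mu> by (simp add: nodew_def)
  have \<mu>0: "0 < \<mu>" using posn[of True "{#}"] len[of True "{#}"] by linarith
  have W0: "0 < W t s" for t s unfolding W_def by (rule wt_pos[OF posn])
  have Wle: "W t s \<le> \<mu> ^ rsize t" for t s unfolding W_def by (rule wt_le_power[OF posn len])
  have W1: "W t s < 1" for t s
  proof -
    have "\<mu> ^ rsize t \<le> \<mu> ^ 1" using \<mu>0 \<mu>(4) rsize_pos[of t] by (intro power_decreasing) auto
    then show ?thesis using Wle[of t s] \<mu>(4) by simp
  qed
  have finS: "finite small_trees" unfolding small_trees_def by (rule finite_rtrees)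
  \<comment> \<open>\<open>small_trees\<close> belongs to every stage, so that its exact factor can
    always be split off, and branches of trees in \<open>B (Suc N)\<close> still lie in
    \<open>B N\<close>. By \<open>step\<close>, \<open>Y\<close> is a supersolution of the
    functional equation, hence no stage can exceed it.\<close>
  define B where "B N = {t. rsize t \<le> N} \<union> small_trees" for N
  have finB: "finite (B N)" for N using finS finite_rtrees by (simp add: B_def)
  have "\<forall>s. (\<Sum>t\<in>B N. W t s) \<le> Y s" for N
  proof (induction N)
    case 0
    then show ?case using \<sigma>(2) by (simp add: B_def)
  next
    case (Suc N)
    show ?case
    proof
      fix s
      have sub: "set_mset M \<subseteq> B N" if "Node M \<in> B (Suc N)" for M
      proof
        fix c assume "c \<in># M"
        then have "rsize c < rsize (Node M)" by (auto dest!: multi_member_split)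
        then show "c \<in> B N" using that by (auto simp: B_def small_trees_def)
      qed
      have "(\<Prod>c\<in>B N. 1 / (1 - W c (\<not> s))) \<le> C (\<not> s) * exp (\<kappa> * (Y (\<not> s) - \<sigma> (\<not> s)))"
      proof (rule prod_inverse_le[OF finB _ _ _ _ \<kappa>(1) \<kappa>(2) _ \<sigma>(1) C])
        show "small_trees \<subseteq> B N" by (simp add: B_def)
        show "0 \<le> W a (\<not> s) \<and> W a (\<not> s) < 1" for a using W0 W1 by (simp add: less_imp_le)
        show "W a (\<not> s) \<le> \<mu> ^ 5" if "a \<in> B N - small_trees" for a
        proof -
          have "5 \<le> rsize a" using that by (auto simp: small_trees_def)
          then have "\<mu> ^ rsize a \<le> \<mu> ^ 5" using \<mu>0 \<mu>(4) by (intro power_decreasing) auto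
          then show ?thesis using Wle[of a "\<not> s"] by linarith
        qed
        show "\<mu> ^ 5 < 1" using \<mu>0 \<mu>(4) by (simp add: power_less_one_iff)
        show "(\<Sum>a\<in>B N. W a (\<not> s)) \<le> Y (\<not> s)" using Suc.IH by blast
      qed
      from sum_wt_step[OF pos finB[of N] _ _ finB[of "Suc N"] sub this[unfolded W_def]]
      show "(\<Sum>t\<in>B (Suc N). W t s) \<le> Y s"
        using step[of s] W1 by (fastforce simp: W_def B_def small_trees_def leaf_def)
    qed
  qed
  then have "(\<Sum>t\<in>B N. W t s) \<le> Y s" by blast
  moreover have "(\<Sum>t | rsize t \<le> N. W t s) \<le> (\<Sum>t\<in>B N. W t s)"
    using finB W0 by (intro sum_mono2) (auto simp: B_def intro: less_imp_le)
  ultimately show ?thesis by linarith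
qed

lemma small_trees_eq:
  "small_trees = {leaf, Node {#leaf#}, Node {#Node {#leaf#}#}, Node {#leaf, leaf#},
     Node {#Node {#Node {#leaf#}#}#}, Node {#Node {#leaf, leaf#}#}, Node {#Node {#leaf#}, leaf#}, Node {#leaf, leaf, leaf#}}"
  (is "_ = ?S")
proof
  have r1: "t = leaf" if "rsize t \<le> 1" for t
  proof -
    obtain M where M: "t = Node M" by (cases t)
    show ?thesis
    proof (cases M)
      case (add c M') then show ?thesis using that M rsize_pos[of c] by simp
    qed (simp add: M leaf_def)
  qed
  have r2: "t = leaf \<or> t = Node {#leaf#}" if "rsize t \<le> 2" for t
  proof -
    obtain M where M: "t = Node M" by (cases t)
    show ?thesis
    proof (cases M)
      case (add c M')
      show ?thesis
      proof (cases M')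
        case empty then show ?thesis using that M add r1[of c] by simp
      next
        case (add d M'') then show ?thesis using that M \<open>M = _\<close> rsize_pos[of c] rsize_pos[of d] by simp
      qed
    qed (simp add: M leaf_def)
  qed
  have r3: "t = leaf \<or> t = Node {#leaf#} \<or> t = Node {#Node {#leaf#}#} \<or> t = Node {#leaf, leaf#}" if "rsize t \<le> 3" for t
  proof -
    obtain M where M: "t = Node M" by (cases t)
    show ?thesis
    proof (cases M)
      case (add c M')
      show ?thesis
      proof (cases M')
        case empty then show ?thesis using that M add r2[of c] by auto
      next
        case (add d M'')
        show ?thesis
        proof (cases M'')
          case empty
          then show ?thesis using that M \<open>M = _\<close> add r1[of c] r1[of d] rsize_pos[of c] rsize_pos[of d] by simp
        next
          case (add e M3)
          then show ?thesis using that M \<open>M = _\<close> \<open>M' = _\<close> rsize_pos[of c] rsize_pos[of d] rsize_pos[of e] by simp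
        qed
      qed
    qed (simp add: M leaf_def)
  qed
  show "small_trees \<subseteq> ?S"
  proof
    fix t assume "t \<in> small_trees"
    then have t: "rsize t \<le> 4" by (simp add: small_trees_def)
    obtain M where M: "t = Node M" by (cases t)
    show "t \<in> ?S"
    proof (cases M)
      case c: (add c M')
      show ?thesis
      proof (cases M')
        case empty then show ?thesis using t M c r3[of c] by auto
      next
        case d: (add d M'')
        show ?thesis
        proof (cases M'')
          case empty
          then have cd: "rsize c + rsize d \<le> 3" using t M c d by simp
          then consider "rsize c \<le> 1" "rsize d \<le> 2" | "rsize c \<le> 2" "rsize d \<le> 1"
            using rsize_pos[of c] rsize_pos[of d] by linarith
          then show ?thesis
            by cases (use r1[of c] r2[of d] r2[of c] r1[of d] M c d empty in \<open>auto simp: add_mset_commute\<close>)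
        next
          case e: (add e M3)
          show ?thesis
          proof (cases M3)
            case empty
            then have "rsize c \<le> 1" "rsize d \<le> 1" "rsize e \<le> 1"
              using t M c d e rsize_pos[of c] rsize_pos[of d] rsize_pos[of e] by simp_all
            then have "c = leaf" "d = leaf" "e = leaf" using r1 by simp_all
            then show ?thesis using M c d e empty by simp
          next
            case (add f M4)
            then show ?thesis using t M c d e rsize_pos[of c] rsize_pos[of d] rsize_pos[of e] rsize_pos[of f] by simp
          qed
        qed
      qed
    qed (simp add: M leaf_def)
  qed
  show "?S \<subseteq> small_trees" by (auto simp: small_trees_def leaf_def)
qed

text \<open>The Lagrange remainder is \<open>exp t / 720 * q ^ 6\<close> with
  \<open>exp t \<le> 3\<close>, whence the denominator 240.\<close>

lemma exp_upper_Taylor: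
  fixes q :: real assumes "0 \<le> q" "q \<le> 1"
  shows "exp q \<le> 1 + q + q\<^sup>2 / 2 + q ^ 3 / 6 + q ^ 4 / 24 + q ^ 5 / 120 + q ^ 6 / 240"
proof -
  obtain t where t: "\<bar>t\<bar> \<le> \<bar>q\<bar>" "exp q = (\<Sum>m<6. q ^ m / fact m) + exp t / fact 6 * q ^ 6"
    using Maclaurin_exp_le[of q 6] by blast
  have "exp t \<le> 3"
    using t(1) assms exp_le by (smt (verit) exp_le_cancel_iff)
  then have "exp t / fact 6 * q ^ 6 \<le> 3 / 720 * q ^ 6"
    using assms by (intro mult_right_mono) (auto simp: fact_numeral)
  then show ?thesis using t(2) by (simp add: eval_nat_numeral fact_numeral)
qed

lemma exp_lower_Taylor:
  fixes q :: real assumes "0 \<le> q"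
  shows "1 + q + q\<^sup>2 / 2 + q ^ 3 / 6 + q ^ 4 / 24 + q ^ 5 / 120 \<le> exp q"
proof -
  obtain t where t: "exp q = (\<Sum>m<6. q ^ m / fact m) + exp t / fact 6 * q ^ 6"
    using Maclaurin_exp_le[of q 6] by blast
  have "0 \<le> exp t / fact 6 * q ^ 6" using assms by simp
  then show ?thesis using t by (simp add: eval_nat_numeral fact_numeral)
qed

lemma sum_small_trees:
  "(\<Sum>t\<in>small_trees. F t) = F leaf + F (Node {#leaf#}) + F (Node {#Node {#leaf#}#}) + F (Node {#leaf, leaf#})
    + F (Node {#Node {#Node {#leaf#}#}#}) + F (Node {#Node {#leaf, leaf#}#}) + F (Node {#Node {#leaf#}, leaf#})
    + F (Node {#leaf, leaf, leaf#})" for F :: "rtree \<Rightarrow> real"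
  unfolding small_trees_eq by (simp add: leaf_def add_ac)

lemma prod_small_trees:
  "(\<Prod>t\<in>small_trees. F t) = F leaf * F (Node {#leaf#}) * F (Node {#Node {#leaf#}#}) * F (Node {#leaf, leaf#})
    * F (Node {#Node {#Node {#leaf#}#}#}) * F (Node {#Node {#leaf, leaf#}#}) * F (Node {#Node {#leaf#}, leaf#})
    * F (Node {#leaf, leaf, leaf#})" for F :: "rtree \<Rightarrow> real"
  unfolding small_trees_eq by (simp add: leaf_def mult_ac)

lemma wt_small:
  fixes l u w :: "bool \<Rightarrow> real"
  defines "W \<equiv> wt (nodew l u w)"
  shows "W leaf s = l s" "W (Node {#leaf#}) s = u s * l (\<not> s)"
    "W (Node {#Node {#leaf#}#}) s = w s * (u (\<not> s) * l s)"
    "W (Node {#leaf, leaf#}) s = w s * (l (\<not> s))\<^sup>2"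
    "W (Node {#Node {#Node {#leaf#}#}#}) s = w s * (w (\<not> s) * (u s * l (\<not> s)))"
    "W (Node {#Node {#leaf, leaf#}#}) s = w s * (w (\<not> s) * (l s)\<^sup>2)"
    "W (Node {#Node {#leaf#}, leaf#}) s = w s * (u (\<not> s) * l s * l (\<not> s))"
    "W (Node {#leaf, leaf, leaf#}) s = w s * l (\<not> s) ^ 3"
  unfolding W_def by (simp_all add: wt_Node nodew_def leaf_def power2_eq_square power3_eq_cube)

text \<open>The weights are \<open>679/2000 = 0.3395\<close> times \<open>5/6\<close> and
  \<open>6/5\<close>. \<open>\<mu>\<close> is the largest of them and \<open>\<kappa>\<close> is
  just large enough for \<open>\<mu> ^ 5\<close>; \<open>\<sigma>\<close> and \<open>C\<close> are
  the sum and the product over the small trees, rounded down and up.\<close>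

lemma sum_wt_bound_single:
  fixes l u w :: "bool \<Rightarrow> real"
  assumes "l = (\<lambda>_. 679/2400)" "u = (\<lambda>_. 679/2400)" "w = (\<lambda>_. 2037/5000)"
  shows "(\<Sum>t | rsize t \<le> N. wt (nodew l u w) t s) \<le> 84/100"
proof (rule sum_wt_bound[where \<mu> = "2037/5000" and \<kappa> = "10057/10000" and \<sigma> = "\<lambda>_. 47319/100000"
      and Y = "\<lambda>_. 84/100" and C = "\<lambda>_. 16949/10000"])
  show "47319/100000 \<le> (\<Sum>t\<in>small_trees. wt (nodew l u w) t s)" for s
    unfolding sum_small_trees wt_small assms by (simp add: power2_eq_square power3_eq_cube)
  show "(\<Sum>t\<in>small_trees. wt (nodew l u w) t s) \<le> 84/100" for s
    unfolding sum_small_trees wt_small assms by (simp add: power2_eq_square power3_eq_cube)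
  show "(\<Prod>t\<in>small_trees. 1 / (1 - wt (nodew l u w) t s)) \<le> 16949/10000" for s
    unfolding prod_small_trees wt_small assms by (simp add: power2_eq_square power3_eq_cube)
  have "exp (10057/10000 * (84/100 - 47319/100000)) \<le> (14462/10000 :: real)"
    by (rule order_trans[OF exp_upper_Taylor]) (simp_all add: power2_eq_square eval_nat_numeral)
  then have "w s * (16949/10000 * exp (10057/10000 * (84/100 - 47319/100000)) - 1 - l (\<not> s))
      \<le> w s * (16949/10000 * (14462/10000) - 1 - l (\<not> s))" for s
    by (intro mult_left_mono) (simp_all add: assms)
  moreover have "l s + u s * l (\<not> s) + w s * (16949/10000 * (14462/10000) - 1 - l (\<not> s)) \<le> 84/100" for s
    by (simp add: assms)
  ultimately show "l s + u s * l (\<not> s) + w s * (16949/10000 * exp (10057/10000 * (84/100 - 47319/100000)) - 1 - l (\<not> s)) \<le> 84/100" for s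
    by (meson add_left_mono order_trans)
qed (simp_all add: assms power2_eq_square eval_nat_numeral)

text \<open>The weights are \<open>679/2000\<close> times powers of \<open>13/12\<close>: the cube
  \<open>2197/1728\<close>, its inverse, and \<open>(12/13)^2 = 144/169\<close>. As the side
  alternates with the depth, the two sides give coupled inequalities with separate bounds.\<close>

lemma sum_wt_bound_sides:
  fixes l u w :: "bool \<Rightarrow> real"
  assumes "l = (\<lambda>s. if s then 679/2000 * (1728/2197) else 679/2000 * (144/169))"
    "u = (\<lambda>s. if s then 679/2000 * (2197/1728) else 679/2000)" "w = u"
  shows "(\<Sum>t | rsize t \<le> N. wt (nodew l u w) t s) \<le> (if s then 847/1000 else 79/100)"
proof (rule sum_wt_bound[where \<mu> = "4317/10000" and \<kappa> = "10077/10000"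
      and \<sigma> = "\<lambda>s. if s then 51765/100000 else 48986/100000"
      and Y = "\<lambda>s. if s then 847/1000 else 79/100" and C = "\<lambda>s. if s then 17711/10000 else 17297/10000"])
  show "(if s then 51765/100000 else 48986/100000) \<le> (\<Sum>t\<in>small_trees. wt (nodew l u w) t s)" for s
    unfolding sum_small_trees wt_small assms by (cases s) (simp_all add: power2_eq_square power3_eq_cube)
  show "(\<Sum>t\<in>small_trees. wt (nodew l u w) t s) \<le> (if s then 847/1000 else 79/100)" for s
    unfolding sum_small_trees wt_small assms by (cases s) (simp_all add: power2_eq_square power3_eq_cube)
  show "(\<Prod>t\<in>small_trees. 1 / (1 - wt (nodew l u w) t s)) \<le> (if s then 17711/10000 else 17297/10000)" for s
    unfolding prod_small_trees wt_small assms by (cases s) (simp_all add: power2_eq_square power3_eq_cube)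
  have 1: "exp (10077/10000 * (847/1000 - 51765/100000)) \<le> (13936/10000 :: real)"
    by (rule order_trans[OF exp_upper_Taylor]) (simp_all add: power2_eq_square eval_nat_numeral)
  have 2: "exp (10077/10000 * (79/100 - 48986/100000)) \<le> (13532/10000 :: real)"
    by (rule order_trans[OF exp_upper_Taylor]) (simp_all add: power2_eq_square eval_nat_numeral)
  have "w s * ((if \<not> s then 17711/10000 else 17297/10000)
      * exp (10077/10000 * ((if \<not> s then 847/1000 else 79/100) - (if \<not> s then 51765/100000 else 48986/100000))) - 1 - l (\<not> s))
     \<le> w s * ((if \<not> s then 17711/10000 else 17297/10000)
      * (if \<not> s then 13936/10000 else 13532/10000) - 1 - l (\<not> s))" for s
  proof (intro mult_left_mono diff_right_mono)
    show "exp (10077/10000 * ((if \<not> s then 847/1000 else 79/100) - (if \<not> s then 51765/100000 else 48986/100000)))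
      \<le> (if \<not> s then 13936/10000 else 13532/10000 :: real)"
      using 1 2 by (cases s) (simp_all only: if_True if_False not_True_eq_False not_False_eq_True)
  qed (simp_all add: assms)
  moreover have "l s + u s * l (\<not> s) + w s * ((if \<not> s then 17711/10000 else 17297/10000)
      * (if \<not> s then 13936/10000 else 13532/10000) - 1 - l (\<not> s)) \<le> (if s then 847/1000 else 79/100)" for s
    by (cases s) (simp_all add: assms)
  ultimately show "l s + u s * l (\<not> s) + w s * ((if \<not> s then 17711/10000 else 17297/10000)
      * exp (10077/10000 * ((if \<not> s then 847/1000 else 79/100) - (if \<not> s then 51765/100000 else 48986/100000))) - 1 - l (\<not> s))
      \<le> (if s then 847/1000 else 79/100)" for s
    by (meson add_left_mono order_trans)
qed (simp_all add: assms power2_eq_square eval_nat_numeral)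

section \<open>A lower bound for the number of rooted trees\<close>

lemma one_over_ge_exp:
  fixes v :: real assumes "v < 1" shows "exp v \<le> 1 / (1 - v)"
proof -
  have "1 - v \<le> exp (- v)" using exp_ge_add_one_self[of "- v"] by simp
  then have "exp v * (1 - v) \<le> exp v * exp (- v)" by (intro mult_left_mono) auto
  then show ?thesis using assms by (simp add: exp_minus le_divide_eq)
qed

text \<open>If the sum \<open>s\<close> were finite, it would satisfy \<open>s \<ge> x * C * exp (s - \<sigma>)\<close>, and \<open>x * C * exp (- \<sigma>) * exp s > s\<close> by
  \<open>exp s \<ge> exp 1 * s\<close>.\<close>

lemma rtree_sums_unbounded:
  fixes x :: real
  assumes x: "x = 3387/10000"
  shows "\<exists>N. B < (\<Sum>t | rsize t \<le> N. x ^ rsize t)"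
proof (rule ccontr)
  assume "\<not> ?thesis"
  then have bd: "(\<Sum>t | rsize t \<le> N. x ^ rsize t) \<le> B" for N by (simp add: not_less)
  define v :: "rtree \<Rightarrow> real" where "v t = x ^ rsize t" for t
  have v: "0 < v t" "v t < 1" for t
    using x rsize_pos[of t] by (auto simp: v_def power_less_one_iff)
  have v_Node: "v (Node M) = x * (\<Prod>c\<in>#M. v c)" for M
  proof -
    have "(\<Prod>c\<in>#M. v c) = x ^ (\<Sum>\<^sub># (image_mset rsize M))"
      by (induction M) (auto simp: v_def power_add)
    then show ?thesis by (simp add: v_def)
  qed
  define s where "s = (SUP N. \<Sum>t | rsize t \<le> N. v t)"
  have bdd: "bdd_above (range (\<lambda>N. \<Sum>t | rsize t \<le> N. v t))"
    using bd by (intro bdd_aboveI2[of _ _ B]) (simp add: v_def)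
  have le_s: "(\<Sum>t\<in>A. v t) \<le> s" if "finite A" for A
  proof -
    define N where "N = Max (insert 0 (rsize ` A))"
    have "A \<subseteq> {t. rsize t \<le> N}" unfolding N_def using that by (auto intro!: Max_ge)
    then have "(\<Sum>t\<in>A. v t) \<le> (\<Sum>t | rsize t \<le> N. v t)"
      using v by (intro sum_mono2 finite_rtrees) (auto intro: less_imp_le)
    also have "\<dots> \<le> s" unfolding s_def by (rule cSUP_upper[OF _ bdd]) simp
    finally show ?thesis .
  qed
  define C where "C = (\<Prod>t\<in>small_trees. 1 / (1 - v t))"
  define \<sigma> where "\<sigma> = (\<Sum>t\<in>small_trees. v t)"
  have finS: "finite small_trees" unfolding small_trees_def by (rule finite_rtrees)
  \<comment> \<open>Multisets over \<open>A\<close> with multiplicities at most \<open>K\<close> are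
    the branches of distinct trees, whose total weight is at most \<open>s\<close>; then
    \<open>K\<close> tends to infinity.\<close>
  have prod_le: "x * (\<Prod>t\<in>A. 1 / (1 - v t)) \<le> s" if A: "finite A" for A
  proof (rule LIMSEQ_le_const2)
    show "(\<lambda>K. x * (\<Prod>t\<in>A. \<Sum>k\<le>K. v t ^ k)) \<longlonglongrightarrow> x * (\<Prod>t\<in>A. 1 / (1 - v t))"
    proof (intro tendsto_mult_left tendsto_prod)
      fix t assume "t \<in> A"
      have "(\<lambda>k. v t ^ k) sums (1 / (1 - v t))" using v[of t] by (intro geometric_sums) auto
      then show "(\<lambda>K. \<Sum>k\<le>K. v t ^ k) \<longlonglongrightarrow> 1 / (1 - v t)"
        by (simp add: sums_def_le)
    qed
    have "x * (\<Prod>t\<in>A. \<Sum>k\<le>K. v t ^ k) \<le> s" for K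
    proof -
      have "x * (\<Prod>t\<in>A. \<Sum>k\<le>K. v t ^ k) = (\<Sum>M\<in>msets_le A K. x * (\<Prod>c\<in>#M. v c))"
        unfolding sum_msets_le[OF A, symmetric] sum_distrib_left ..
      also have "\<dots> = (\<Sum>M\<in>msets_le A K. v (Node M))"
        by (simp only: v_Node)
      also have "\<dots> = (\<Sum>t\<in>Node ` msets_le A K. v t)"
        by (simp add: sum.reindex inj_on_def)
      also have "\<dots> \<le> s" by (rule le_s) (simp add: finite_msets_le A)
      finally show ?thesis .
    qed
    then show "\<exists>N. \<forall>n\<ge>N. x * (\<Prod>t\<in>A. \<Sum>k\<le>n. v t ^ k) \<le> s" by blast
  qed
  have C0: "0 \<le> C" unfolding C_def using v by (intro prod_nonneg) (simp add: less_imp_le)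
  \<comment> \<open>The factor gained in one round of the functional equation. The gain is shown for
    finite sets of trees and passed to the supremum at the end, which gives
    \<open>s \<le> s / \<rho>\<close>.\<close>
  define \<rho> where "\<rho> = x * C * exp (1 - \<sigma>)"
  have grow: "\<rho> * (\<Sum>t\<in>A. v t) \<le> s" if A: "finite A" "small_trees \<subseteq> A" for A
  proof -
    have "C * exp ((\<Sum>t\<in>A. v t) - \<sigma>) = C * (\<Prod>t\<in>A - small_trees. exp (v t))"
    proof -
      have "(\<Sum>t\<in>A. v t) - \<sigma> = (\<Sum>t\<in>A - small_trees. v t)"
        unfolding \<sigma>_def using sum_diff[OF A, of v] by simp
      then show ?thesis using A by (simp add: exp_sum)
    qed
    also have "\<dots> \<le> C * (\<Prod>t\<in>A - small_trees. 1 / (1 - v t))"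
      using C0 v by (intro mult_left_mono prod_mono) (auto intro: one_over_ge_exp)
    also have "\<dots> = (\<Prod>t\<in>A. 1 / (1 - v t))"
      unfolding C_def using prod.subset_diff[OF A(2,1), of "\<lambda>t. 1 / (1 - v t)"] by (simp add: mult.commute)
    finally have "x * (C * exp ((\<Sum>t\<in>A. v t) - \<sigma>)) \<le> x * (\<Prod>t\<in>A. 1 / (1 - v t))"
      using x by (intro mult_left_mono) auto
    also have "\<dots> \<le> s" by (rule prod_le[OF A(1)])
    finally have 1: "x * (C * exp ((\<Sum>t\<in>A. v t) - \<sigma>)) \<le> s" .
    have "(\<Sum>t\<in>A. v t) \<le> exp ((\<Sum>t\<in>A. v t) - 1)" using exp_ge_add_one_self[of "(\<Sum>t\<in>A. v t) - 1"] by simp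
    then have "\<rho> * (\<Sum>t\<in>A. v t) \<le> \<rho> * exp ((\<Sum>t\<in>A. v t) - 1)"
      unfolding \<rho>_def using C0 x by (intro mult_left_mono) auto
    also have "\<dots> = x * (C * exp ((\<Sum>t\<in>A. v t) - \<sigma>))"
      unfolding \<rho>_def by (simp add: mult.assoc flip: exp_add)
    finally show ?thesis using 1 by linarith
  qed
  have \<rho>1: "1 < \<rho>"
  proof -
    have \<sigma>: "\<sigma> = x + x\<^sup>2 + 2 * x ^ 3 + 4 * x ^ 4"
      unfolding \<sigma>_def sum_small_trees v_def by (simp add: leaf_def eval_nat_numeral)
    have C: "C = 1 / (1 - x) * (1 / (1 - x\<^sup>2)) * (1 / (1 - x ^ 3)) ^ 2 * (1 / (1 - x ^ 4)) ^ 4"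
      unfolding C_def prod_small_trees v_def by (simp add: leaf_def eval_nat_numeral)
    have "19496/10000 \<le> C" unfolding C x by (simp add: eval_nat_numeral)
    moreover have "15161/10000 \<le> exp (1 - \<sigma>)"
    proof -
      have "4162/10000 \<le> 1 - \<sigma>" unfolding \<sigma> x by (simp add: eval_nat_numeral)
      moreover have "15161/10000 \<le> exp (4162/10000 :: real)"
        by (rule order_trans[OF _ exp_lower_Taylor]) (simp_all add: eval_nat_numeral)
      ultimately show ?thesis by (meson exp_le_cancel_iff order_trans)
    qed
    ultimately have "19496/10000 * (15161/10000) \<le> C * exp (1 - \<sigma>)" by (intro mult_mono) auto
    then have "x * (19496/10000 * (15161/10000)) \<le> x * (C * exp (1 - \<sigma>))" by (intro mult_left_mono) (simp_all add: x)
    moreover have "1 < x * (19496/10000 * (15161/10000))" by (simp add: x)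
    ultimately show ?thesis unfolding \<rho>_def by (simp only: mult.assoc)
  qed
  have "\<rho> * (\<Sum>t | rsize t \<le> N. v t) \<le> s" for N
  proof -
    have "(\<Sum>t | rsize t \<le> N. v t) \<le> (\<Sum>t\<in>{t. rsize t \<le> N} \<union> small_trees. v t)"
      using v finS by (intro sum_mono2) (auto simp: finite_rtrees intro: less_imp_le)
    then have "\<rho> * (\<Sum>t | rsize t \<le> N. v t) \<le> \<rho> * (\<Sum>t\<in>{t. rsize t \<le> N} \<union> small_trees. v t)"
      using \<rho>1 by (intro mult_left_mono) auto
    also have "\<dots> \<le> s" using finS by (intro grow) (auto simp: finite_rtrees)
    finally show ?thesis .
  qed
  then have "(\<Sum>t | rsize t \<le> N. v t) \<le> s / \<rho>" for N using \<rho>1 by (simp add: le_divide_eq mult.commute)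
  then have "s \<le> s / \<rho>" unfolding s_def by (intro cSUP_least) (auto simp: s_def)
  moreover have "0 < s"
    using le_s[of "{leaf}"] v[of leaf] by simp
  ultimately show False using \<rho>1 by (simp add: le_divide_eq)
qed

lemma card_rtrees_ge_1:
  assumes "1 \<le> n" shows "1 \<le> card {t. rsize t = n}"
proof -
  have fin: "finite {t. rsize t = n}" by (rule finite_subset[OF _ finite_rtrees[of n]]) auto
  have "\<exists>t. rsize t = n"
    using assms
  proof (induction n rule: dec_induct)
    case base show ?case by (intro exI[of _ leaf]) (simp add: leaf_def)
  next
    case (step n)
    then obtain t where "rsize t = n" by blast
    then show ?case by (intro exI[of _ "Node {#t#}"]) simp
  qed
  then show ?thesis using fin by (metis (mono_tags, lifting) One_nat_def Suc_leI card_gt_0_iff empty_iff mem_Collect_eq)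
qed

text \<open>Joining two trees of different sizes under a new root is injective.\<close>

lemma card_rtrees_supermult:
  assumes "a \<noteq> b"
  shows "card {t. rsize t = a} * card {t. rsize t = b} \<le> card {t. rsize t = a + b + 1}"
proof -
  have fin: "finite {t. rsize t = n}" for n by (rule finite_subset[OF _ finite_rtrees[of n]]) auto
  have "card ({t. rsize t = a} \<times> {t. rsize t = b}) \<le> card {t. rsize t = a + b + 1}"
  proof (rule card_inj_on_le[of "\<lambda>(s, t). Node {#s, t#}"])
    show "inj_on (\<lambda>(s, t). Node {#s, t#}) ({t. rsize t = a} \<times> {t. rsize t = b})"
      using assms by (auto simp: inj_on_def add_eq_conv_ex)
  qed (auto simp: fin)
  then show ?thesis by (simp add: card_cartesian_product)
qed

text \<open>If \<open>r n * x ^ n\<close> stayed bounded at 0.339, the series would converge at the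
  smaller 0.3387. So some \<open>b\<close> satisfies \<open>r b * x ^ (b + 1) \<ge> 1\<close>, where
  the additional \<open>x\<close> pays for the new root in a join; joining with trees of size
  \<open>b\<close> carries the lower bound to all sizes.\<close>

lemma card_rtrees_growth:
  obtains c :: real where "0 < c" "\<And>n. 1 \<le> n \<Longrightarrow> c * (1000/339) ^ n \<le> card {t. rsize t = n}"
proof -
  define x :: real where "x = 339/1000"
  define y :: real where "y = 3387/10000"
  define r where "r n = card {t. rsize t = n}" for n
  have fin: "finite {t. rsize t = n}" for n by (rule finite_subset[OF _ finite_rtrees[of n]]) auto
  have "\<exists>n\<ge>1. 1 / x \<le> r n * x ^ n"
  proof (rule ccontr)
    assume "\<not> ?thesis"
    then have small: "r n * x ^ n \<le> 1 / x" if "1 \<le> n" for n using that by (meson linear)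
    have r0: "r 0 = 0" by (simp add: r_def)
    have rb: "real (r n) * y ^ n \<le> 1 / x * (y / x) ^ n" for n
    proof (cases "n = 0")
      case False
      then have "r n * x ^ n * (y / x) ^ n \<le> 1 / x * (y / x) ^ n"
        using small[of n] by (intro mult_right_mono) (auto simp: x_def y_def)
      then show ?thesis by (simp add: power_divide x_def)
    qed (simp add: r0 x_def)
    have "(\<Sum>t | rsize t \<le> N. y ^ rsize t) \<le> 1 / x * (1 / (1 - y / x))" for N
    proof -
      have "(\<Sum>t | rsize t \<le> N. y ^ rsize t) = (\<Sum>n\<le>N. \<Sum>t | t \<in> {t. rsize t \<le> N} \<and> rsize t = n. y ^ rsize t)"
        by (rule sum.group[symmetric]) (auto simp: finite_rtrees)
      also have "\<dots> = (\<Sum>n\<le>N. real (r n) * y ^ n)"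
      proof (intro sum.cong refl)
        fix n assume "n \<in> {..N}"
        then have "{t. t \<in> {t. rsize t \<le> N} \<and> rsize t = n} = {t. rsize t = n}" by auto
        then show "(\<Sum>t | t \<in> {t. rsize t \<le> N} \<and> rsize t = n. y ^ rsize t) = real (r n) * y ^ n"
          by (simp add: r_def)
      qed
      also have "\<dots> \<le> (\<Sum>n\<le>N. 1 / x * (y / x) ^ n)" by (intro sum_mono rb)
      also have "\<dots> \<le> 1 / x * (\<Sum>n. (y / x) ^ n)"
        unfolding sum_distrib_left[symmetric]
        by (intro mult_left_mono sum_le_suminf summable_geometric) (auto simp: x_def y_def)
      also have "(\<Sum>n. (y / x) ^ n) = 1 / (1 - y / x)" by (rule suminf_geometric) (simp add: x_def y_def)
      finally show ?thesis .
    qed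
    then show False using rtree_sums_unbounded[OF y_def, of "1 / x * (1 / (1 - y / x))"] by (meson not_le)
  qed
  then obtain b where b: "1 \<le> b" "1 / x \<le> r b * x ^ b" by blast
  have x0: "0 < x" "x < 1" by (auto simp: x_def)
  have rb: "1 \<le> r b * x ^ (b + 1)" using b x0 by (simp add: divide_le_eq mult_ac)
  \<comment> \<open>The join needs sizes \<open>a \<noteq> b\<close>. For
    \<open>n > 2 * b + 1\<close> the remaining size satisfies \<open>a > b\<close>; smaller
    \<open>n\<close> form the base case and determine the constant.\<close>
  have chain: "x ^ (2 * b + 1) \<le> r n * x ^ n" if "1 \<le> n" for n
    using that
  proof (induction n rule: less_induct)
    case (less n)
    show ?case
    proof (cases "n \<le> 2 * b + 1")
      case True
      have "x ^ (2 * b + 1) \<le> x ^ n" using True x0 by (intro power_decreasing) auto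
      also have "\<dots> \<le> r n * x ^ n"
        using card_rtrees_ge_1[OF less.prems] x0 by (simp add: r_def mult_le_cancel_right1)
      finally show ?thesis .
    next
      case False
      define a where "a = n - (b + 1)"
      have a: "a < n" "1 \<le> a" "a \<noteq> b" "a + b + 1 = n" using False b by (auto simp: a_def)
      have "x ^ (2 * b + 1) * 1 \<le> (r a * x ^ a) * (r b * x ^ (b + 1))"
        using less.IH[OF a(1,2)] rb x0 by (intro mult_mono) auto
      also have "\<dots> = real (r a * r b) * x ^ n"
      proof -
        have "x ^ n = x ^ a * x ^ (b + 1)" unfolding a(4)[symmetric] power_add by simp
        then show ?thesis by simp
      qed
      also have "\<dots> \<le> r n * x ^ n"
        using card_rtrees_supermult[OF a(3)] a(4) x0 unfolding r_def
        by (intro mult_right_mono) (auto simp flip: of_nat_mult)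
      finally show ?thesis by simp
    qed
  qed
  show ?thesis
  proof (rule that[of "x ^ (2 * b + 1)"])
    show "0 < x ^ (2 * b + 1)" using x0 by simp
    show "x ^ (2 * b + 1) * (1000/339) ^ n \<le> real (card {t. rsize t = n})" if "1 \<le> n" for n
    proof -
      have "x ^ (2 * b + 1) * (1 / x) ^ n \<le> r n"
        using chain[OF that] x0 by (simp add: power_one_over divide_le_eq)
      then show ?thesis by (simp add: x_def r_def)
    qed
  qed
qed

section \<open>Exceptional trees\<close>

lemma wt_const: "wt (\<lambda>_ _. x) t s = x ^ rsize t"
proof (induction t arbitrary: s)
  case (Node M)
  have "(\<Prod>c\<in>#M. wt (\<lambda>_ _. x) c (\<not> s)) = x ^ (\<Sum>\<^sub># (image_mset rsize M))"
    using Node by (induction M) (auto simp: power_add)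
  then show ?case by (simp add: wt_Node)
qed

definition kid_shapes :: "(nat \<Rightarrow> nat) \<Rightarrow> nat \<Rightarrow> nat \<Rightarrow> rtree multiset" where
  "kid_shapes par m i = image_mset (shape par m) (mset_set (kids par m i))"

text \<open>Every vertex except the root is the child of exactly one vertex, so the weights of all branches cancel.\<close>

lemma wt_shape:
  assumes par: "\<And>i. i \<in> {1..m} \<Longrightarrow> par i < i" and side: "\<And>i. i \<in> {1..m} \<Longrightarrow> side (par i) = (\<not> side i)"
    and f: "\<And>s M. 0 < f s M"
  shows "wt f (shape par m 0) (side 0) = (\<Prod>i\<le>m. f (side i) (kid_shapes par m i))"
proof -
  define D where "D i = wt f (shape par m i) (side i)" for i
  have D0: "0 < D i" for i unfolding D_def by (rule wt_pos[OF f])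
  have kids: "kids par m i = {j \<in> {1..m}. par j = i}" for i
    using par by (auto simp: kids_def)
  have D: "D i = f (side i) (kid_shapes par m i) * (\<Prod>j\<in>kids par m i. D j)" for i
  proof -
    have "D i = f (side i) (kid_shapes par m i) * (\<Prod>j\<in>#mset_set (kids par m i). wt f (shape par m j) (\<not> side i))"
      unfolding D_def by (subst shape.simps) (simp add: wt_Node kid_shapes_def multiset.map_comp o_def)
    also have "(\<Prod>j\<in>#mset_set (kids par m i). wt f (shape par m j) (\<not> side i)) = (\<Prod>j\<in>kids par m i. wt f (shape par m j) (\<not> side i))"
      by (simp add: prod_unfold_prod_mset)
    also have "\<dots> = (\<Prod>j\<in>kids par m i. D j)"
      by (intro prod.cong refl) (use side kids in \<open>auto simp: D_def\<close>)
    finally show ?thesis .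
  qed
  have "(\<Prod>i\<le>m. D i) = (\<Prod>i\<le>m. f (side i) (kid_shapes par m i)) * (\<Prod>i\<le>m. \<Prod>j\<in>kids par m i. D j)"
    by (subst D) (simp add: prod.distrib)
  also have "(\<Prod>i\<le>m. \<Prod>j\<in>kids par m i. D j) = (\<Prod>j\<in>{1..m}. D j)"
    unfolding kids
  proof (rule prod.group)
    show "par ` {1..m} \<subseteq> {..m}" using par by fastforce
  qed auto
  finally have "D 0 * (\<Prod>j\<in>{1..m}. D j) = (\<Prod>i\<le>m. f (side i) (kid_shapes par m i)) * (\<Prod>j\<in>{1..m}. D j)"
    by (simp add: atMost_atLeast0 prod.atLeast_Suc_atMost)
  moreover have "(\<Prod>j\<in>{1..m}. D j) > 0" using D0 by (intro prod_pos) auto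
  ultimately have "D 0 = (\<Prod>i\<le>m. f (side i) (kid_shapes par m i))"
    by (metis less_irrefl mult_right_cancel)
  then show ?thesis by (simp add: D_def)
qed

text \<open>Read off from \<open>wt_shape\<close> with the constant weight 2, for which the weight
  is 2 to the number of vertices.\<close>

lemma rsize_shape:
  assumes par: "\<And>i. i \<in> {1..m} \<Longrightarrow> par i < i" and side: "\<And>i. i \<in> {1..m} \<Longrightarrow> side (par i) = (\<not> side i)"
  shows "rsize (shape par m 0) = m + 1"
proof -
  have "wt (\<lambda>_ _. 2) (shape par m 0) (side 0) = (2::real) ^ (m + 1)"
    using wt_shape[of m par side "\<lambda>_ _. 2"] par side by simp
  then have "(2::real) ^ rsize (shape par m 0) = 2 ^ (m + 1)" by (simp add: wt_const)
  then show ?thesis by (rule power_inject_exp[THEN iffD1, rotated]) simp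
qed

section \<open>Leaf counts and the decomposition\<close>

definition is_leaf :: "(nat \<Rightarrow> nat) \<Rightarrow> nat \<Rightarrow> nat \<Rightarrow> bool" where
  "is_leaf par m i \<longleftrightarrow> kids par m i = {}"

definition single_leaf :: "(nat \<Rightarrow> nat) \<Rightarrow> nat \<Rightarrow> nat \<Rightarrow> bool" where
  "single_leaf par m i \<longleftrightarrow> (\<exists>j. kids par m i = {j} \<and> kids par m j = {})"

lemma shape_eq_leaf: "shape par m i = leaf \<longleftrightarrow> is_leaf par m i"
  by (subst shape.simps) (auto simp: leaf_def is_leaf_def mset_set_empty_iff)

lemma kid_shapes_iff:
  "kid_shapes par m i = {#} \<longleftrightarrow> is_leaf par m i"
  "kid_shapes par m i = {#leaf#} \<longleftrightarrow> single_leaf par m i"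
proof -
  show "kid_shapes par m i = {#} \<longleftrightarrow> is_leaf par m i"
    by (auto simp: kid_shapes_def is_leaf_def mset_set_empty_iff)
  show "kid_shapes par m i = {#leaf#} \<longleftrightarrow> single_leaf par m i"
  proof
    assume *: "kid_shapes par m i = {#leaf#}"
    then have "size (kid_shapes par m i) = 1" by simp
    then have "card (kids par m i) = 1" by (simp add: kid_shapes_def)
    then obtain j where j: "kids par m i = {j}" by (auto simp: card_1_singleton_iff)
    then have "shape par m j = leaf" using * by (simp add: kid_shapes_def)
    then show "single_leaf par m i" using j by (auto simp: single_leaf_def shape_eq_leaf is_leaf_def)
  next
    assume "single_leaf par m i"
    then obtain j where "kids par m i = {j}" "kids par m j = {}" by (auto simp: single_leaf_def)
    then show "kid_shapes par m i = {#leaf#}" by (simp add: kid_shapes_def shape_eq_leaf is_leaf_def)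
  qed
qed

lemma side_decomposes:
  fixes par :: "nat \<Rightarrow> nat" and side :: "nat \<Rightarrow> bool"
  assumes p: "p = 2 * m + 1" "prime p" and m: "m > 0" and q: "q \<ge> 2"
    and par: "\<And>i. i \<in> {1..m} \<Longrightarrow> par i < i" and side: "\<And>i. i \<in> {1..m} \<Longrightarrow> side (par i) = (\<not> side i)"
    and root: "card (kids par m 0) \<ge> 2"
    and 1: "card {i \<in> {..m}. \<not> is_leaf par m i \<and> side i} \<le> card {i \<in> {..m}. is_leaf par m i \<and> side i} + 2 * card {i \<in> {..m}. single_leaf par m i \<and> side i}"
    and 2: "3 * card {i \<in> {..m}. \<not> is_leaf par m i \<and> side i} \<le> 3 * card {i \<in> {..m}. is_leaf par m i \<and> side i} + 2 * card {i \<in> {..m}. is_leaf par m i \<and> \<not> side i}"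
    and 3: "3 * card {i \<in> {..m}. \<not> is_leaf par m i} \<le> 2 * m + 5"
  shows "decomposes (par_graph m par) (blowup_complete p q)"
proof -
  define \<beta> where "\<beta> = card {i \<in> {..m}. \<not> is_leaf par m i \<and> side i}"
  define kT where "kT = card {i \<in> {..m}. is_leaf par m i \<and> side i}"
  define kF where "kF = card {i \<in> {..m}. is_leaf par m i \<and> \<not> side i}"
  \<comment> \<open>This value balances the two counting conditions of
    \<open>tree_decomposes\<close>. They read \<open>\<beta> \<le> kT + 2 * y + 1\<close> and
    \<open>\<beta> + y \<le> kT + kF + 1\<close>; the first needs \<open>y\<close> to be about half
    of \<open>\<beta> - kT\<close>, and then the second follows from
    \<open>3 * \<beta> \<le> 3 * kT + 2 * kF\<close>. The subtraction gives 0 if the leaves suffice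
    already, and the summand 1 absorbs the rounding.\<close>
  define y where "y = (\<beta> - kT) div 2"
  have kids: "kids par m i = {j \<in> {1..m}. par j = i}" for i using par by (auto simp: kids_def)
  \<comment> \<open>With two children the root is neither a leaf nor in \<open>Y\<close>, so it
    stays in the embedded part, as \<open>tree_decomposes\<close> demands.\<close>
  have nl0: "\<not> is_leaf par m 0" "\<not> single_leaf par m 0" using root by (auto simp: is_leaf_def single_leaf_def)
  have "y \<le> card {i \<in> {..m}. single_leaf par m i \<and> side i}" using 1 by (simp add: y_def \<beta>_def kT_def)
  then obtain Y where Y: "Y \<subseteq> {i \<in> {..m}. single_leaf par m i \<and> side i}" "card Y = y" "finite Y"
    by (meson obtain_subset_with_card_n)
  define child where "child x = (THE j. kids par m x = {j})" for x
  have child: "kids par m x = {child x} \<and> is_leaf par m (child x)" if "x \<in> Y" for x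
  proof -
    obtain j where j: "kids par m x = {j}" "kids par m j = {}" using subsetD[OF Y(1) \<open>x \<in> Y\<close>] by (auto simp: single_leaf_def)
    then have "child x = j" unfolding child_def by (intro the_equality) auto
    then show ?thesis using j by (simp add: is_leaf_def)
  qed
  have child': "child x \<in> {1..m} \<and> par (child x) = x" if "x \<in> Y" for x
    using child[OF that] kids[of x] by auto
  have Y': "x \<in> {1..m} \<and> \<not> is_leaf par m x \<and> side x" if "x \<in> Y" for x
    using that Y nl0 child[OF that] by (cases "x = 0") (auto simp: is_leaf_def)
  have parnl: "\<not> is_leaf par m (par i) \<and> par i \<le> m" if "i \<in> {1..m}" for i
    using that par[OF that] kids[of "par i"] by (auto simp: is_leaf_def)
  have par_notY: "i = child (par i)" if "i \<in> {1..m}" "par i \<in> Y" for i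
    using child[OF that(2)] kids[of "par i"] that by auto
  define T where "T = {i \<in> {..m}. \<not> is_leaf par m i} - Y"
  define LA where "LA = {i \<in> {..m}. is_leaf par m i \<and> side i}"
  define LB where "LB = {i \<in> {..m}. is_leaf par m i \<and> \<not> side i} - child ` Y"
  have csub: "child ` Y \<subseteq> {i \<in> {..m}. is_leaf par m i \<and> \<not> side i}"
  proof
    fix z assume "z \<in> child ` Y"
    then obtain x where x: "x \<in> Y" "z = child x" by auto
    show "z \<in> {i \<in> {..m}. is_leaf par m i \<and> \<not> side i}"
      using child[OF x(1)] child'[OF x(1)] Y'[OF x(1)] side[of z] x by auto
  qed
  have injc: "inj_on child Y" by (rule inj_onI) (metis child')
  have cLB: "card LB = kF - y"
    unfolding LB_def kF_def using csub card_image[OF injc] Y by (subst card_Diff_subset) auto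
  have ykF: "y \<le> kF"
    using card_mono[OF _ csub] card_image[OF injc] Y by (simp add: kF_def)
  have Ysub: "Y \<subseteq> {i \<in> {..m}. \<not> is_leaf par m i \<and> side i}" using Y' by auto
  have y\<beta>: "y \<le> \<beta>" using card_mono[OF _ Ysub] Y by (simp add: \<beta>_def)
  have cTs: "card {i \<in> T. side i} = \<beta> - y"
  proof -
    have "{i \<in> T. side i} = {i \<in> {..m}. \<not> is_leaf par m i \<and> side i} - Y" by (auto simp: T_def)
    then show ?thesis using card_Diff_subset[OF Y(3) Ysub] Y by (simp add: \<beta>_def)
  qed
  show ?thesis
  proof (rule tree_decomposes[OF p m q par, of T Y LA LB child side])
    show "T \<subseteq> {..m}" by (auto simp: T_def)
    show "0 \<in> T" using nl0 Y' by (auto simp: T_def)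
    show "{..m} - T = Y \<union> LA \<union> LB \<union> child ` Y"
      using csub Y' by (auto simp: T_def LA_def LB_def)
    show "Y \<inter> LA = {}" "(Y \<union> LA) \<inter> LB = {}" using Y' by (auto simp: LA_def LB_def)
    show "(Y \<union> LA \<union> LB) \<inter> child ` Y = {}" using csub Y' by (auto simp: LA_def LB_def)
    show "par (child x) = x" if "x \<in> Y" for x using child'[OF that] by simp
    show "par i \<in> T \<and> side (par i) \<noteq> side i" if "i \<in> T - {0}" for i
    proof -
      have i: "i \<in> {1..m}" "\<not> is_leaf par m i" using that by (auto simp: T_def)
      have "par i \<notin> Y" using par_notY[OF i(1)] child i by metis
      then show ?thesis using parnl[OF i(1)] side[OF i(1)] by (auto simp: T_def)
    qed
    show "par i \<in> T \<and> \<not> side (par i)" if "i \<in> Y \<union> LA" for i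
    proof -
      have i: "i \<in> {1..m}" "side i" using that Y' nl0 by (auto simp: LA_def Suc_le_eq intro!: gr0I)
      then have "\<not> side (par i)" using side by simp
      then have "par i \<notin> Y" using Y' by blast
      then show ?thesis using parnl[OF i(1)] \<open>\<not> side (par i)\<close> by (auto simp: T_def)
    qed
    show "par i \<in> T \<and> side (par i)" if "i \<in> LB" for i
    proof -
      have i: "i \<in> {1..m}" "\<not> side i" "i \<notin> child ` Y" using that nl0 by (auto simp: LB_def Suc_le_eq intro!: gr0I)
      then have "par i \<notin> Y" using par_notY[OF i(1)] by blast
      then show ?thesis using parnl[OF i(1)] side[OF i(1)] i by (auto simp: T_def)
    qed
    have kT: "card LA = kT" by (simp add: LA_def kT_def)
    have b2: "3 * \<beta> \<le> 3 * kT + 2 * kF" using 2 by (simp add: \<beta>_def kT_def kF_def)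
    have yy: "2 * y \<le> \<beta> - kT" "\<beta> - kT \<le> 2 * y + 1" by (auto simp: y_def)
    show "card {i \<in> T. side i} \<le> card Y + card LA + 1" unfolding cTs kT Y(2) using yy by linarith
    show "card {i \<in> T. side i} + card Y \<le> card LA + card LB + 1"
      unfolding cTs kT Y(2) cLB using yy y\<beta> ykF b2 by linarith
    have "card T \<le> card {i \<in> {..m}. \<not> is_leaf par m i}" by (intro card_mono) (auto simp: T_def)
    then show "3 * card T \<le> p + 4" using 3 p by linarith
  qed
qed

lemma root_side:
  assumes "\<And>i. i \<in> {1..m} \<Longrightarrow> par i < (i::nat)"
  shows "\<exists>side :: nat \<Rightarrow> bool. side 0 = b \<and> (\<forall>i\<in>{1..m}. side (par i) = (\<not> side i))"
proof -
  have "\<exists>g :: nat \<Rightarrow> bool. \<forall>i\<in>{1..m}. g i = (if False then g (par i) else \<not> g (par i))"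
    by (rule recursive_colouring[of _ id]) (use assms in auto)
  then obtain g :: "nat \<Rightarrow> bool" where g: "\<forall>i\<in>{1..m}. g i = (\<not> g (par i))" by auto
  show ?thesis
  proof (cases "g 0 = b")
    case True then show ?thesis using g by (intro exI[of _ g]) auto
  next
    case False then show ?thesis using g by (intro exI[of _ "\<lambda>i. \<not> g i"]) auto
  qed
qed

text \<open>Up to the factor \<open>679/2000\<close> per vertex, the weights are powers of \<open>6/5\<close> and of \<open>13/12\<close> whose total exponents are
  nonnegative exactly when the inequality in \<open>w_single_shape\<close> or \<open>w_sides_shape\<close> holds.\<close>

definition w_single :: "rtree \<Rightarrow> bool \<Rightarrow> real" where
  "w_single = wt (nodew (\<lambda>_. 679/2400) (\<lambda>_. 679/2400) (\<lambda>_. 2037/5000))"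

definition w_sides :: "rtree \<Rightarrow> bool \<Rightarrow> real" where
  "w_sides = wt (nodew (\<lambda>s. if s then 679/2000 * (1728/2197) else 679/2000 * (144/169))
     (\<lambda>s. if s then 679/2000 * (2197/1728) else 679/2000)
     (\<lambda>s. if s then 679/2000 * (2197/1728) else 679/2000))"

text \<open>Either colour class of the tree may have to play the role of \<open>side\<close>, hence
  both values for \<open>w_sides\<close>. The weights in \<open>w_single\<close> do not depend on
  the side, and \<open>True\<close> is an arbitrary choice.\<close>

definition exceptional :: "nat \<Rightarrow> rtree \<Rightarrow> bool" where
  "exceptional n t \<longleftrightarrow> (679/2000) ^ n \<le> w_single t True \<or> (679/2000) ^ n \<le> w_sides t True \<or> (679/2000) ^ n \<le> w_sides t False"

text \<open>Markov's inequality: an exceptional tree contributes at least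
  \<open>(679/2000) ^ n\<close> to one of three sums that are bounded independently of
  \<open>n\<close>, each by less than 1.\<close>

lemma card_exceptional:
  "card {t. rsize t = n \<and> exceptional n t} * (679/2000) ^ n \<le> (3::real)"
proof -
  let ?E = "{t. rsize t = n \<and> exceptional n t}"
  have fin: "finite ?E" by (rule finite_subset[OF _ finite_rtrees[of n]]) auto
  have pos: "0 < w_single t s" "0 < w_sides t s" for t s
    unfolding w_single_def w_sides_def by (rule wt_pos, simp add: nodew_def)+
  have "card ?E * (679/2000) ^ n = (\<Sum>t\<in>?E. (679/2000 :: real) ^ n)" by simp
  also have "\<dots> \<le> (\<Sum>t\<in>?E. w_single t True + w_sides t True + w_sides t False)"
  proof (rule sum_mono)
    fix t assume "t \<in> ?E"
    then show "(679/2000) ^ n \<le> w_single t True + w_sides t True + w_sides t False"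
      using pos(1)[of t True] pos(2)[of t True] pos(2)[of t False] by (auto simp: exceptional_def)
  qed
  also have "\<dots> \<le> (\<Sum>t | rsize t \<le> n. w_single t True + w_sides t True + w_sides t False)"
    proof (rule sum_mono2[OF finite_rtrees])
    show "0 \<le> w_single t True + w_sides t True + w_sides t False" for t
      using pos(1)[of t True] pos(2)[of t True] pos(2)[of t False] by linarith
  qed auto
  also have "\<dots> = (\<Sum>t | rsize t \<le> n. w_single t True) + (\<Sum>t | rsize t \<le> n. w_sides t True) + (\<Sum>t | rsize t \<le> n. w_sides t False)"
    by (simp add: sum.distrib)
  also have "\<dots> \<le> 84/100 + 847/1000 + 79/100"
    using sum_wt_bound_single[OF refl refl refl, where N = n and s = True]
      sum_wt_bound_sides[OF refl refl refl, where N = n and s = True]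
      sum_wt_bound_sides[OF refl refl refl, where N = n and s = False]
    unfolding w_single_def w_sides_def by simp
  finally show ?thesis by simp
qed

lemma card_filter_conj:
  assumes "finite A" shows "card {i \<in> A. P i} = card {i \<in> A. P i \<and> Q i} + card {i \<in> A. P i \<and> \<not> Q i}"
proof -
  have "{i \<in> A. P i} = {i \<in> A. P i \<and> Q i} \<union> {i \<in> A. P i \<and> \<not> Q i}" by auto
  moreover have "{i \<in> A. P i \<and> Q i} \<inter> {i \<in> A. P i \<and> \<not> Q i} = {}" by auto
  ultimately show ?thesis using assms by (simp add: card_Un_disjoint)
qed

lemma prod_if_power:
  fixes c :: real
  assumes "finite A" shows "(\<Prod>i\<in>A. if P i then c else 1) = c ^ card {i \<in> A. P i}"
  using assms by (simp add: prod.If_cases Int_def)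

lemma w_single_shape:
  assumes par: "\<And>i. i \<in> {1..m} \<Longrightarrow> par i < i"
    and le: "card {i \<in> {..m}. is_leaf par m i} + 2 * card {i \<in> {..m}. single_leaf par m i} \<le> card {i \<in> {..m}. \<not> is_leaf par m i}"
  shows "(679/2000) ^ (m + 1) \<le> w_single (shape par m 0) True"
proof -
  obtain side where side: "side 0 = True" "\<And>i. i \<in> {1..m} \<Longrightarrow> side (par i) = (\<not> side i)"
    using root_side[of m par True, OF par] by blast
  have sl: "single_leaf par m i \<Longrightarrow> \<not> is_leaf par m i" for i by (auto simp: single_leaf_def is_leaf_def)
  let ?a = "card {i \<in> {..m}. \<not> is_leaf par m i \<and> \<not> single_leaf par m i}"
  let ?b = "card {i \<in> {..m}. is_leaf par m i \<or> single_leaf par m i}"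
  have c1: "card {i \<in> {..m}. \<not> is_leaf par m i} = card {i \<in> {..m}. single_leaf par m i} + ?a"
  proof -
    have "{i \<in> {..m}. \<not> is_leaf par m i \<and> single_leaf par m i} = {i \<in> {..m}. single_leaf par m i}" using sl by auto
    then show ?thesis using card_filter_conj[of "{..m}" "\<lambda>i. \<not> is_leaf par m i" "single_leaf par m"] by simp
  qed
  have c2: "?b = card {i \<in> {..m}. is_leaf par m i} + card {i \<in> {..m}. single_leaf par m i}"
  proof -
    have "{i \<in> {..m}. is_leaf par m i \<or> single_leaf par m i} = {i \<in> {..m}. is_leaf par m i} \<union> {i \<in> {..m}. single_leaf par m i}" by auto
    moreover have "{i \<in> {..m}. is_leaf par m i} \<inter> {i \<in> {..m}. single_leaf par m i} = {}" using sl by auto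
    ultimately show ?thesis by (simp add: card_Un_disjoint)
  qed
  \<comment> \<open>Every single-leaf vertex is a non-leaf, so cancelling one copy of them in
    \<open>le\<close> compares the vertices with factor \<open>5/6\<close> to those with factor
    \<open>6/5\<close>.\<close>
  have ba: "?b \<le> ?a" using le c1 c2 by linarith
  have "w_single (shape par m 0) True
    = (\<Prod>i\<le>m. nodew (\<lambda>_. 679/2400) (\<lambda>_. 679/2400) (\<lambda>_. 2037/5000) (side i) (kid_shapes par m i))"
    unfolding w_single_def side(1)[symmetric]
    by (rule wt_shape[of m par side]) (use par side in \<open>auto simp: nodew_def\<close>)
  also have "\<dots> = (\<Prod>i\<le>m. 679/2000 * ((if \<not> is_leaf par m i \<and> \<not> single_leaf par m i then 6/5 else 1) * (if is_leaf par m i \<or> single_leaf par m i then 5/6 else 1)))"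
    by (intro prod.cong refl) (auto simp: nodew_def kid_shapes_iff)
  also have "\<dots> = (679/2000) ^ (m + 1) * ((6/5) ^ ?a * (5/6) ^ ?b)"
    by (simp only: prod.distrib prod_if_power[OF finite_atMost] prod_constant card_atMost Suc_eq_plus1)
  also have "(6/5 :: real) ^ ?a * (5/6) ^ ?b \<ge> (6/5) ^ ?b * (5/6) ^ ?b"
    using ba by (intro mult_right_mono power_increasing) auto
  then have "(679/2000) ^ (m + 1) * 1 \<le> (679/2000 :: real) ^ (m + 1) * ((6/5) ^ ?a * (5/6) ^ ?b)"
    by (intro mult_left_mono) (auto simp: power_mult_distrib[symmetric])
  finally show ?thesis by simp
qed

lemma w_sides_shape:
  assumes par: "\<And>i. i \<in> {1..m} \<Longrightarrow> par i < i"
    and side: "\<And>i. i \<in> {1..m} \<Longrightarrow> side (par i) = (\<not> side i)"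
    and le: "3 * card {i \<in> {..m}. is_leaf par m i \<and> side i} + 2 * card {i \<in> {..m}. is_leaf par m i \<and> \<not> side i}
       \<le> 3 * card {i \<in> {..m}. \<not> is_leaf par m i \<and> side i}"
  shows "(679/2000) ^ (m + 1) \<le> w_sides (shape par m 0) (side 0)"
proof -
  let ?a = "card {i \<in> {..m}. \<not> is_leaf par m i \<and> side i}"
  let ?b = "card {i \<in> {..m}. is_leaf par m i \<and> side i}"
  let ?c = "card {i \<in> {..m}. is_leaf par m i \<and> \<not> side i}"
  define l :: "bool \<Rightarrow> real" where "l = (\<lambda>s. if s then 679/2000 * (1728/2197) else 679/2000 * (144/169))"
  define u :: "bool \<Rightarrow> real" where "u = (\<lambda>s. if s then 679/2000 * (2197/1728) else 679/2000)"
  have "w_sides (shape par m 0) (side 0) = (\<Prod>i\<le>m. nodew l u u (side i) (kid_shapes par m i))"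
    unfolding w_sides_def l_def[symmetric] u_def[symmetric]
    by (rule wt_shape[of m par side]) (use par side in \<open>auto simp: nodew_def l_def u_def\<close>)
  also have "\<dots> = (\<Prod>i\<le>m. 679/2000 * ((if \<not> is_leaf par m i \<and> side i then (13/12) ^ 3 else 1)
      * ((if is_leaf par m i \<and> side i then (12/13) ^ 3 else 1) * (if is_leaf par m i \<and> \<not> side i then (12/13) ^ 2 else 1))))"
    by (intro prod.cong refl) (auto simp: nodew_def kid_shapes_iff l_def u_def power3_eq_cube power2_eq_square)
  also have "\<dots> = (679/2000) ^ (m + 1) * (((13/12) ^ 3) ^ ?a * (((12/13) ^ 3) ^ ?b * ((12/13) ^ 2) ^ ?c))"
    by (simp only: prod.distrib prod_if_power[OF finite_atMost] prod_constant card_atMost Suc_eq_plus1)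
  also have "\<dots> = (679/2000) ^ (m + 1) * ((13/12) ^ (3 * ?a) * (12/13) ^ (3 * ?b + 2 * ?c))"
    by (simp only: power_mult power_add)
  finally have eq: "w_sides (shape par m 0) (side 0) = (679/2000) ^ (m + 1) * ((13/12) ^ (3 * ?a) * (12/13) ^ (3 * ?b + 2 * ?c))" .
  have "(13/12 :: real) ^ (3 * ?b + 2 * ?c) * (12/13) ^ (3 * ?b + 2 * ?c) \<le> (13/12) ^ (3 * ?a) * (12/13) ^ (3 * ?b + 2 * ?c)"
    using le by (intro mult_right_mono power_increasing) auto
  moreover have "(13/12 :: real) ^ (3 * ?b + 2 * ?c) * (12/13) ^ (3 * ?b + 2 * ?c) = 1"
    by (simp add: power_mult_distrib[symmetric])
  ultimately have "1 \<le> (13/12 :: real) ^ (3 * ?a) * (12/13) ^ (3 * ?b + 2 * ?c)" by linarith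
  then have "(679/2000) ^ (m + 1) * 1 \<le> (679/2000 :: real) ^ (m + 1) * ((13/12) ^ (3 * ?a) * (12/13) ^ (3 * ?b + 2 * ?c))"
    by (intro mult_left_mono) auto
  then show ?thesis unfolding eq by simp
qed

text \<open>\<open>e1\<close> adds up the first counting condition over the two sides, so it holds
  on at least one of them, and \<open>e2\<close> or \<open>e3\<close> supplies the second condition
  there. The sum of \<open>e2\<close> and \<open>e3\<close> gives
  \<open>8 * (\<beta> + \<alpha>) < 5 * (m + 1)\<close>, more than enough room for the greedy
  embedding.\<close>

lemma unexceptional_decomposes:
  assumes p: "p = 2 * m + 1" "prime p" and m: "m > 0" and q: "q \<ge> 2"
    and par: "\<And>i. i \<in> {1..m} \<Longrightarrow> par i < i" and root: "card (kids par m 0) \<ge> 2"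
    and good: "\<not> exceptional (m + 1) (shape par m 0)"
  shows "decomposes (par_graph m par) (blowup_complete p q)"
proof -
  obtain side where side: "side 0 = True" "\<And>i. i \<in> {1..m} \<Longrightarrow> side (par i) = (\<not> side i)"
    using root_side[of m par True, OF par] by blast
  define side' where "side' i = (\<not> side i)" for i
  have side': "side' 0 = False" "\<And>i. i \<in> {1..m} \<Longrightarrow> side' (par i) = (\<not> side' i)"
    using side by (auto simp: side'_def)
  let ?c = "\<lambda>P. card {i \<in> {..m}. P i}"
  define \<beta> where "\<beta> = ?c (\<lambda>i. \<not> is_leaf par m i \<and> side i)"
  define \<alpha> where "\<alpha> = ?c (\<lambda>i. \<not> is_leaf par m i \<and> \<not> side i)"
  define kT where "kT = ?c (\<lambda>i. is_leaf par m i \<and> side i)"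
  define kF where "kF = ?c (\<lambda>i. is_leaf par m i \<and> \<not> side i)"
  define qT where "qT = ?c (\<lambda>i. single_leaf par m i \<and> side i)"
  define qF where "qF = ?c (\<lambda>i. single_leaf par m i \<and> \<not> side i)"
  have n0: "?c (\<lambda>i. \<not> is_leaf par m i) = \<beta> + \<alpha>" and k: "?c (is_leaf par m) = kT + kF" and qq: "?c (single_leaf par m) = qT + qF"
    unfolding \<alpha>_def \<beta>_def kT_def kF_def qT_def qF_def by (rule card_filter_conj; simp)+
  have tot: "\<beta> + \<alpha> + (kT + kF) = m + 1"
  proof -
    have "card {i \<in> {..m}. True} = ?c (\<lambda>i. True \<and> is_leaf par m i) + ?c (\<lambda>i. True \<and> \<not> is_leaf par m i)"
      by (rule card_filter_conj) simp
    then show ?thesis using n0 k by simp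
  qed
  have e1: "\<beta> + \<alpha> < kT + kF + 2 * (qT + qF)"
    using w_single_shape[of m par, OF par] good n0 k qq by (fastforce simp: exceptional_def not_le)
  have e2: "3 * \<beta> < 3 * kT + 2 * kF"
    using w_sides_shape[of m par side, OF par side(2)] good side(1) by (fastforce simp: exceptional_def not_le \<beta>_def kT_def kF_def)
  have e3: "3 * \<alpha> < 3 * kF + 2 * kT"
    using w_sides_shape[of m par side', OF par side'(2)] good side'(1)
    by (fastforce simp: exceptional_def not_le \<alpha>_def kT_def kF_def side'_def)
  have 3: "3 * ?c (\<lambda>i. \<not> is_leaf par m i) \<le> 2 * m + 5" using n0 tot e2 e3 by linarith
  show ?thesis
  proof (cases "\<beta> \<le> kT + 2 * qT")
    case True
    show ?thesis
      by (rule side_decomposes[of p m q par side, OF p m q par side(2) root _ _ 3])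
         (use True e2 in \<open>simp_all add: \<beta>_def kT_def kF_def qT_def\<close>)
  next
    case False
    then have e4: "\<alpha> \<le> kF + 2 * qF" using e1 by (linarith | presburger | auto)
    show ?thesis
      by (rule side_decomposes[of p m q par side', OF p m q par side'(2) root _ _ 3])
         (use e3 e4 in \<open>simp_all add: \<alpha>_def kT_def kF_def qF_def side'_def\<close>)
  qed
qed

section \<open>From rooted shapes to unlabelled trees\<close>

text \<open>Among the first three vertices of any search order, one is adjacent to the other two.
  The search is restarted there, so that the leaves of the rooted tree are those of the tree
  itself.\<close>

lemma tree_branching_root:
  assumes T: "T \<in> trees m" and m: "m \<ge> 2"
  obtains par where "\<And>i. i \<in> {1..m} \<Longrightarrow> par i < i" "card (kids par m 0) \<ge> 2" "graph_iso T (par_graph m par)"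
proof -
  have tree: "is_tree T" "card (edges T) = m" using T by (auto simp: trees_def)
  then obtain v0 where "v0 \<in> verts T" by (auto simp: is_tree_def connected_graph_def)
  from tree_parent_function[OF tree this] obtain \<phi> par where
    \<phi>: "bij_betw \<phi> {..m} (verts T)" and par: "\<forall>i\<in>{1..m}. par i < i"
    and E: "edges T = (\<lambda>i. {\<phi> (par i), \<phi> i}) ` {1..m}" by blast
  have p1: "par 1 = 0" using par[rule_format, of 1] m by simp
  have p2: "par 2 = 0 \<or> par 2 = 1" using par[rule_format, of 2] m by auto
  obtain c a b where cab: "c \<le> m" "a \<le> m" "b \<le> m" "a \<noteq> b" "{\<phi> c, \<phi> a} \<in> edges T" "{\<phi> c, \<phi> b} \<in> edges T"
  proof -
    have e1: "{\<phi> 0, \<phi> 1} \<in> edges T" using p1 m unfolding E by (intro image_eqI[of _ _ 1]) auto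
    have e2: "{\<phi> (par 2), \<phi> 2} \<in> edges T" using m unfolding E by (intro image_eqI[of _ _ 2]) auto
    show ?thesis
    proof (cases "par 2 = 0")
      case True then show ?thesis using that[of 0 1 2] e1 e2 m by simp
    next
      case False
      then have "par 2 = 1" using p2 by simp
      then show ?thesis using that[of 1 0 2] e1 e2 m by (simp add: insert_commute)
    qed
  qed
  have inj: "inj_on \<phi> {..m}" using \<phi> by (simp add: bij_betw_def)
  have vs: "\<phi> c \<in> verts T" "\<phi> a \<in> verts T" "\<phi> b \<in> verts T" "\<phi> a \<noteq> \<phi> b"
    using \<phi> cab inj_onD[OF inj, of a b] by (auto simp: bij_betw_def)
  from tree_parent_function[OF tree vs(1)] obtain \<psi> par' where
    \<psi>: "bij_betw \<psi> {..m} (verts T)" "\<psi> 0 = \<phi> c" and par': "\<forall>i\<in>{1..m}. par' i < i"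
    and E': "edges T = (\<lambda>i. {\<psi> (par' i), \<psi> i}) ` {1..m}" by blast
  have par'': "\<And>i. i \<in> {1..m} \<Longrightarrow> par' i < i" using par' by blast
  have adj: "\<forall>u\<in>{..m}. \<forall>v\<in>{..m}. adj (par_graph m par') u v \<longleftrightarrow> adj T (\<psi> u) (\<psi> v)"
    by (rule tree_iso_par_graph[OF \<psi>(1) par'' E'])
  have kid: "\<exists>i\<in>kids par' m 0. \<psi> i = w" if "w \<in> verts T" "{\<phi> c, w} \<in> edges T" for w
  proof -
    obtain i where i: "i \<le> m" "w = \<psi> i" using \<psi>(1) \<open>w \<in> verts T\<close> by (auto simp: bij_betw_def)
    then have "adj (par_graph m par') 0 i" using adj that(2) \<psi>(2) by auto
    then obtain j where "j \<in> {1..m}" "{0, i} = {par' j, j}" unfolding par_graph_adj by blast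
    then have "i \<in> kids par' m 0" using par''[of j] by (auto simp: kids_def doubleton_eq_iff)
    then show ?thesis using i by blast
  qed
  obtain i j where ij: "i \<in> kids par' m 0" "\<psi> i = \<phi> a" "j \<in> kids par' m 0" "\<psi> j = \<phi> b"
    using kid[of "\<phi> a"] kid[of "\<phi> b"] cab vs by blast
  then have "i \<noteq> j" using vs by auto
  then have "card {i, j} = 2" by simp
  moreover have "card {i, j} \<le> card (kids par' m 0)" using ij by (intro card_mono) auto
  ultimately have "card (kids par' m 0) \<ge> 2" by simp
  moreover have "graph_iso (par_graph m par') T"
    unfolding graph_iso_def using \<psi>(1) adj by (intro exI[of _ \<psi>]) (simp add: par_graph_def)
  ultimately show ?thesis using that[of par'] par'' graph_iso_sym by blast
qed

lemma decomposes_iso: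
  assumes "graph_iso T S" "decomposes S G" shows "decomposes T G"
  using assms unfolding decomposes_def by (meson graph_iso_trans)

lemma unlabelled_trees_class:
  assumes "C \<in> unlabelled_trees m" "T \<in> C"
  shows "T \<in> trees m" "C = {S \<in> trees m. graph_iso T S}"
proof -
  obtain S where S: "S \<in> trees m" "C = {S' \<in> trees m. graph_iso S S'}"
    using assms(1) by (auto simp: unlabelled_trees_def quotient_def)
  then show "T \<in> trees m" using assms(2) by simp
  have "graph_iso S T" using S assms(2) by simp
  then show "C = {S \<in> trees m. graph_iso T S}"
    unfolding S(2) using graph_iso_trans graph_iso_sym by blast
qed

text \<open>Each bad class is sent to the shape of one of its rootings at a branching vertex. A
  shape determines the class, so nothing is lost here; a factor \<open>m + 1\<close> enters only in
  \<open>card_rtrees_le\<close>.\<close>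

lemma card_bad_classes:
  assumes p: "prime (2 * m + 1)" and m: "m \<ge> 2" and r: "r \<ge> 2"
  shows "card {C \<in> unlabelled_trees m. \<not> (\<forall>T\<in>C. decomposes T (blowup_complete (2 * m + 1) r))}
    \<le> card {t. rsize t = m + 1 \<and> exceptional (m + 1) t}"
proof -
  let ?B = "{C \<in> unlabelled_trees m. \<not> (\<forall>T\<in>C. decomposes T (blowup_complete (2 * m + 1) r))}"
  have ex: "\<exists>t. rsize t = m + 1 \<and> exceptional (m + 1) t \<and>
      (\<exists>par. (\<forall>i\<in>{1..m}. par i < i) \<and> shape par m 0 = t \<and> (\<exists>T\<in>C. graph_iso T (par_graph m par)))" if C: "C \<in> ?B" for C
  proof -
    obtain T where T: "T \<in> C" "\<not> decomposes T (blowup_complete (2 * m + 1) r)" using C by blast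
    have "T \<in> trees m" using unlabelled_trees_class[of C m T] C T by blast
    from tree_branching_root[OF this m] obtain par where
      par: "\<And>i. i \<in> {1..m} \<Longrightarrow> par i < i" "card (kids par m 0) \<ge> 2" "graph_iso T (par_graph m par)" by blast
    have "exceptional (m + 1) (shape par m 0)"
    proof (rule ccontr)
      assume "\<not> ?thesis"
      then have "decomposes (par_graph m par) (blowup_complete (2 * m + 1) r)"
        using m by (intro unexceptional_decomposes[OF refl p _ r par(1,2)]) auto
      then show False using T(2) decomposes_iso[OF par(3)] by blast
    qed
    moreover have "rsize (shape par m 0) = m + 1"
    proof -
      obtain side :: "nat \<Rightarrow> bool" where "\<And>i. i \<in> {1..m} \<Longrightarrow> side (par i) = (\<not> side i)"
        using root_side[of m par True, OF par(1)] by blast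
      from rsize_shape[of m par side, OF par(1) this] show ?thesis .
    qed
    ultimately show ?thesis using par T by blast
  qed
  define h where "h C = (SOME t. rsize t = m + 1 \<and> exceptional (m + 1) t \<and>
      (\<exists>par. (\<forall>i\<in>{1..m}. par i < i) \<and> shape par m 0 = t \<and> (\<exists>T\<in>C. graph_iso T (par_graph m par))))"
    for C :: "(nat set \<times> nat set set) set"
  have h: "rsize (h C) = m + 1 \<and> exceptional (m + 1) (h C) \<and>
      (\<exists>par. (\<forall>i\<in>{1..m}. par i < i) \<and> shape par m 0 = h C \<and> (\<exists>T\<in>C. graph_iso T (par_graph m par)))" if "C \<in> ?B" for C
    unfolding h_def by (rule someI_ex[OF ex[OF that]])
  show ?thesis
  proof (rule card_inj_on_le[of h])
    show "inj_on h ?B"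
    proof (rule inj_onI)
      fix C C' assume CC: "C \<in> ?B" "C' \<in> ?B" "h C = h C'"
      obtain par T where 1: "\<forall>i\<in>{1..m}. par i < i" "shape par m 0 = h C" "T \<in> C" "graph_iso T (par_graph m par)"
        using h[OF CC(1)] by blast
      obtain par' T' where 2: "\<forall>i\<in>{1..m}. par' i < i" "shape par' m 0 = h C'" "T' \<in> C'" "graph_iso T' (par_graph m par')"
        using h[OF CC(2)] by blast
      have "graph_iso (par_graph m par) (par_graph m par')"
        using 1 2 CC(3) by (intro shape_eq_imp_iso) auto
      then have "graph_iso T T'" using 1(4) 2(4) graph_iso_trans graph_iso_sym by blast
      have u: "C \<in> unlabelled_trees m" "C' \<in> unlabelled_trees m" using CC by auto
      note k = unlabelled_trees_class[OF u(1) 1(3)] unlabelled_trees_class[OF u(2) 2(3)]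
      show "C = C'" unfolding k(2) k(4) using \<open>graph_iso T T'\<close> graph_iso_trans graph_iso_sym by blast
    qed
    show "h ` ?B \<subseteq> {t. rsize t = m + 1 \<and> exceptional (m + 1) t}" using h by blast
    show "finite {t. rsize t = m + 1 \<and> exceptional (m + 1) t}"
      by (rule finite_subset[OF _ finite_rtrees[of "m + 1"]]) auto
  qed
qed

text \<open>A rooted tree is determined by its unlabelled tree together with the place of the root
  in a fixed representative \<open>rep\<close> of the class.\<close>

lemma card_rtrees_le:
  "card {t. rsize t = m + 1} \<le> card (unlabelled_trees m) * (m + 1)"
proof -
  let ?R = "{t. rsize t = m + 1}"
  define pr where "pr t = (SOME par. (\<forall>i\<in>{1..m}. par i < i) \<and> shape par m 0 = t)" for t
  have pr: "(\<forall>i\<in>{1..m}. pr t i < i) \<and> shape (pr t) m 0 = t" if "t \<in> ?R" for t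
  proof -
    have "rsize t = m + 1" using that by simp
    then have "\<exists>par. (\<forall>i\<in>{1..m}. par i < i) \<and> shape par m 0 = t" using shape_realisation[of t] by simp
    then show ?thesis unfolding pr_def by (rule someI_ex)
  qed
  define cl where "cl t = {S \<in> trees m. graph_iso (par_graph m (pr t)) S}" for t
  have tr: "par_graph m (pr t) \<in> trees m" if "t \<in> ?R" for t using pr[OF that] by (intro par_graph_in_trees) auto
  have cl: "cl t \<in> unlabelled_trees m" if "t \<in> ?R" for t
    unfolding cl_def unlabelled_trees_def using tr[OF that] by (auto simp: quotient_def)
  define rep where "rep C = (SOME t. t \<in> ?R \<and> cl t = C)" for C
  have rep: "rep (cl t) \<in> ?R \<and> cl (rep (cl t)) = cl t" if "t \<in> ?R" for t
    unfolding rep_def by (rule someI_ex) (use that in blast)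
  have iso: "graph_iso (par_graph m (pr t)) (par_graph m (pr (rep (cl t))))" if t: "t \<in> ?R" for t
  proof -
    have "par_graph m (pr (rep (cl t))) \<in> cl (rep (cl t))"
      using tr rep[OF t] graph_iso_refl unfolding cl_def by blast
    then have "par_graph m (pr (rep (cl t))) \<in> cl t" using rep[OF t] by simp
    moreover have "S \<in> cl t \<Longrightarrow> graph_iso (par_graph m (pr t)) S" for S unfolding cl_def by blast
    ultimately show ?thesis by blast
  qed
  define \<psi> where "\<psi> t = (SOME f. bij_betw f {..m} {..m} \<and> (\<forall>u\<in>{..m}. \<forall>v\<in>{..m}.
      adj (par_graph m (pr t)) u v \<longleftrightarrow> adj (par_graph m (pr (rep (cl t)))) (f u) (f v)))" for t
  have \<psi>: "bij_betw (\<psi> t) {..m} {..m} \<and> (\<forall>u\<in>{..m}. \<forall>v\<in>{..m}.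
      adj (par_graph m (pr t)) u v \<longleftrightarrow> adj (par_graph m (pr (rep (cl t)))) (\<psi> t u) (\<psi> t v))" if "t \<in> ?R" for t
  proof -
    have "\<exists>f. bij_betw f {..m} {..m} \<and> (\<forall>u\<in>{..m}. \<forall>v\<in>{..m}.
      adj (par_graph m (pr t)) u v \<longleftrightarrow> adj (par_graph m (pr (rep (cl t)))) (f u) (f v))"
      using iso[OF that] unfolding graph_iso_def by (simp add: par_graph_def)
    then show ?thesis unfolding \<psi>_def by (rule someI_ex)
  qed
  have "inj_on (\<lambda>t. (cl t, \<psi> t 0)) ?R"
  proof (rule inj_onI)
    fix t t' assume t: "t \<in> ?R" and t': "t' \<in> ?R" and eq: "(cl t, \<psi> t 0) = (cl t', \<psi> t' 0)"
    \<comment> \<open>\<open>g \<circ> \<psi> t\<close> passes from one realisation through the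
      common representative to the other; equal root places make it fix 0, so the shapes
      agree.\<close>
    define g where "g = inv_into {..m} (\<psi> t')"
    have b: "bij_betw (\<psi> t) {..m} {..m}" "bij_betw (\<psi> t') {..m} {..m}" using \<psi> t t' by auto
    have g: "bij_betw g {..m} {..m}" unfolding g_def by (rule bij_betw_inv_into[OF b(2)])
    have \<psi>g: "\<psi> t' (g i) = i" "g i \<in> {..m}" if "i \<in> {..m}" for i
      using bij_betw_inv_into_right[OF b(2) that] bij_betwE[OF g] that by (auto simp: g_def)
    have \<psi>m: "\<psi> t i \<in> {..m}" if "i \<in> {..m}" for i using bij_betwE[OF b(1)] that by blast
    have "shape (pr t) m 0 = shape (pr t') m 0"
    proof (rule rooted_iso_imp_shape_eq[of m "pr t" "pr t'" "g \<circ> \<psi> t"])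
      show "bij_betw (g \<circ> \<psi> t) {..m} {..m}" by (rule bij_betw_trans[OF b(1) g])
      show "(g \<circ> \<psi> t) 0 = 0"
        using eq bij_betw_inv_into_left[OF b(2), of 0] by (simp add: g_def)
      show "\<forall>u\<in>{..m}. \<forall>v\<in>{..m}. adj (par_graph m (pr t)) u v \<longleftrightarrow> adj (par_graph m (pr t')) ((g \<circ> \<psi> t) u) ((g \<circ> \<psi> t) v)"
      proof (intro ballI)
        fix u v assume uv: "u \<in> {..m}" "v \<in> {..m}"
        have "adj (par_graph m (pr t')) (g (\<psi> t u)) (g (\<psi> t v))
          \<longleftrightarrow> adj (par_graph m (pr (rep (cl t')))) (\<psi> t' (g (\<psi> t u))) (\<psi> t' (g (\<psi> t v)))"
          using \<psi>[OF t'] \<psi>g(2)[OF \<psi>m[OF uv(1)]] \<psi>g(2)[OF \<psi>m[OF uv(2)]] by blast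
        also have "\<dots> \<longleftrightarrow> adj (par_graph m (pr (rep (cl t)))) (\<psi> t u) (\<psi> t v)"
          using \<psi>g(1)[OF \<psi>m[OF uv(1)]] \<psi>g(1)[OF \<psi>m[OF uv(2)]] eq by simp
        also have "\<dots> \<longleftrightarrow> adj (par_graph m (pr t)) u v" using \<psi>[OF t] uv by blast
        finally show "adj (par_graph m (pr t)) u v \<longleftrightarrow> adj (par_graph m (pr t')) ((g \<circ> \<psi> t) u) ((g \<circ> \<psi> t) v)" by simp
      qed
    qed (use pr[OF t] pr[OF t'] in auto)
    then show "t = t'" using pr[OF t] pr[OF t'] by simp
  qed
  then have "card ?R \<le> card (unlabelled_trees m \<times> {..m})"
  proof (rule card_inj_on_le)
    show "(\<lambda>t. (cl t, \<psi> t 0)) ` ?R \<subseteq> unlabelled_trees m \<times> {..m}"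
      using cl \<psi> by (auto simp: bij_betw_def)
  qed (simp add: finite_unlabelled_trees)
  then show ?thesis by (simp add: card_cartesian_product)
qed

text \<open>With \<open>n = m + 1\<close>, there are at most \<open>3 * (2000/679) ^ n\<close> bad
  classes among at least \<open>c * (1000/339) ^ n / n\<close> classes, and the quotient of the two
  rates is \<open>678/679\<close>.\<close>

lemma bad_probability:
  obtains c :: real where "0 < c"
    "\<And>m r. prime (2 * m + 1) \<Longrightarrow> m \<ge> 2 \<Longrightarrow> r \<ge> 2 \<Longrightarrow>
      1 - c * (real m + 1) * (678/679) ^ (m + 1)
        \<le> measure_pmf.prob (random_tree m) {C. \<forall>T\<in>C. decomposes T (blowup_complete (2 * m + 1) r)}"
proof -
  obtain c :: real where c: "0 < c" "\<And>n. 1 \<le> n \<Longrightarrow> c * (1000/339) ^ n \<le> card {t. rsize t = n}"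
    by (rule card_rtrees_growth) blast
  show ?thesis
  proof (rule that[of "3 / c"])
    show "0 < 3 / c" using c by simp
    fix m r :: nat assume p: "prime (2 * m + 1)" and m: "m \<ge> 2" and r: "r \<ge> 2"
    let ?U = "unlabelled_trees m"
    let ?P = "\<lambda>C. \<forall>T\<in>C. decomposes T (blowup_complete (2 * m + 1) r)"
    define n where "n = m + 1"
    have U: "finite ?U" "?U \<noteq> {}" using finite_unlabelled_trees unlabelled_trees_nonempty by auto
    then have cU: "0 < card ?U" by (simp add: card_gt_0_iff)
    have bad: "card {C \<in> ?U. \<not> ?P C} * (679/2000) ^ n \<le> (3::real)"
    proof -
      have "card {C \<in> ?U. \<not> ?P C} * (679/2000 :: real) ^ n \<le> card {t. rsize t = n \<and> exceptional n t} * (679/2000) ^ n"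
        using card_bad_classes[OF p m r] by (intro mult_right_mono) (auto simp: n_def)
      then show ?thesis using card_exceptional[of n] by linarith
    qed
    have all: "c * (1000/339) ^ n \<le> card ?U * real n"
    proof -
      have "c * (1000/339) ^ n \<le> card {t. rsize t = n}" using c(2)[of n] by (simp add: n_def)
      also have "\<dots> \<le> card ?U * real n"
        using card_rtrees_le[of m] unfolding n_def by (metis of_nat_le_iff of_nat_mult)
      finally show ?thesis .
    qed
    have "real (card {C \<in> ?U. \<not> ?P C}) \<le> 3 * (2000/679) ^ n"
    proof -
      have "real (card {C \<in> ?U. \<not> ?P C}) * ((679/2000) ^ n * (2000/679) ^ n) \<le> 3 * (2000/679) ^ n"
        using mult_right_mono[OF bad, of "(2000/679) ^ n"] by (simp add: mult.assoc)
      then show ?thesis by (simp add: power_mult_distrib[symmetric])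
    qed
    also have "(2000/679 :: real) ^ n = (1000/339) ^ n * (678/679) ^ n"
      by (simp add: power_mult_distrib[symmetric])
    also have "3 * ((1000/339) ^ n * (678/679) ^ n) = 3 / c * (678/679) ^ n * (c * (1000/339) ^ n)"
      using c by simp
    also have "\<dots> \<le> 3 / c * (678/679) ^ n * (card ?U * real n)"
      using c all by (intro mult_left_mono) auto
    finally have "card {C \<in> ?U. \<not> ?P C} / card ?U \<le> 3 / c * real n * (678/679) ^ n"
      using cU by (simp add: divide_le_eq mult_ac)
    moreover have "measure_pmf.prob (random_tree m) {C. ?P C} = 1 - card {C \<in> ?U. \<not> ?P C} / card ?U"
    proof -
      have "measure_pmf.prob (random_tree m) {C. ?P C} = card (?U \<inter> {C. ?P C}) / card ?U"
        unfolding random_tree_def by (rule measure_pmf_of_set[OF U(2,1)])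
      moreover have "card ?U = card {C \<in> ?U. ?P C} + card {C \<in> ?U. \<not> ?P C}"
        using card_filter_conj[OF U(1), of "\<lambda>_. True" ?P] by simp
      moreover have "?U \<inter> {C. ?P C} = {C \<in> ?U. ?P C}" by auto
      ultimately have "measure_pmf.prob (random_tree m) {C. ?P C} = (real (card ?U) - card {C \<in> ?U. \<not> ?P C}) / card ?U"
        by (simp only: of_nat_add add_diff_cancel_right')
      then show ?thesis using cU by (simp add: diff_divide_distrib)
    qed
    ultimately show "1 - 3 / c * (real m + 1) * (678/679) ^ (m + 1) \<le> measure_pmf.prob (random_tree m) {C. ?P C}"
      by (simp add: n_def add.commute)
  qed
qed

theorem theorem1:
  fixes r :: nat
  assumes "r \<ge> 2"
  shows "((\<lambda>m. measure_pmf.prob (random_tree m)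
             {C. \<forall>T\<in>C. decomposes T (blowup_complete (2 * m + 1) r)}) \<longlongrightarrow> 1)
         (inf sequentially (principal {m. m > 0 \<and> prime (2 * m + 1)}))"
proof -
  obtain c :: real where "0 < c" and c: "\<And>m r. prime (2 * m + 1) \<Longrightarrow> m \<ge> 2 \<Longrightarrow> r \<ge> 2 \<Longrightarrow>
      1 - c * (real m + 1) * (678/679) ^ (m + 1)
        \<le> measure_pmf.prob (random_tree m) {C. \<forall>T\<in>C. decomposes T (blowup_complete (2 * m + 1) r)}"
    by (rule bad_probability) blast
  let ?F = "inf sequentially (principal {m. m > 0 \<and> prime (2 * m + 1)})"
  let ?g = "\<lambda>m. 1 - c * (real m + 1) * (678/679) ^ (m + 1)"
  have "(\<lambda>m. real m * (678/679) ^ m) \<longlonglongrightarrow> 0" by (rule powser_times_n_limit_0) simp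
  then have "(\<lambda>m. real (Suc m) * (678/679) ^ Suc m) \<longlonglongrightarrow> 0" by (rule LIMSEQ_Suc)
  then have "(\<lambda>m. 1 - c * (real (Suc m) * (678/679) ^ Suc m)) \<longlonglongrightarrow> 1 - c * 0"
    by (intro tendsto_intros)
  then have "?g \<longlonglongrightarrow> 1" by (simp add: mult_ac add_ac)
  then have lim: "(?g \<longlongrightarrow> 1) ?F" by (rule tendsto_mono[OF inf_le1])
  show ?thesis
  proof (rule tendsto_sandwich[OF _ _ lim tendsto_const])
    show "\<forall>\<^sub>F m in ?F. ?g m \<le> measure_pmf.prob (random_tree m) {C. \<forall>T\<in>C. decomposes T (blowup_complete (2 * m + 1) r)}"
      unfolding eventually_inf_principal using eventually_ge_at_top[of 2] by eventually_elim (use c assms in auto)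
    show "\<forall>\<^sub>F m in ?F. measure_pmf.prob (random_tree m) {C. \<forall>T\<in>C. decomposes T (blowup_complete (2 * m + 1) r)} \<le> 1"
      by (intro always_eventually allI measure_pmf.prob_le_1)
  qed
qed

end
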